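(* Let $T=[T_1,\ldots,T_n]\in[B(\mathcal H)^n]_1^-$ be a row contraction. Then the characteristic function $\Theta_T$ is a noncommutative polynomial of degree $m\in\mathbb N$ if and only if there exist subspaces $\mathcal H_0$, $\mathcal H_1$, and $\mathcal H_2$ of $\mathcal H$ such that $\mathcal H=\mathcal H_0\oplus\mathcal H_1\oplus\mathcal H_2$ and each $T_i$ admits a representation $$T_i=\begin{bmatrix}V_i&*&*\\0&N_i&*\\0&0&W_i\end{bmatrix},\qquad i=1,\ldots,n,$$ where $V=[V_1,\ldots,V_n]\in[B(\mathcal H_0)^n]_1^-$ is a pure isometry, $N=[N_1,\ldots,N_n]\in[B(\mathcal H_1)^n]_1^-$ is a nilpotent row contraction of order $m$, and $W=[W_1,\ldots,W_n]\in[B(\mathcal H_2)^n]_1^-$ is a coisometry. Moreover, the degree of $\Theta_T$ is the smallest possible order of $N$ in the representation of $T$.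
   Context: $n\ge1$ is an integer, $\mathbb N=\{0,1,2,\ldots\}$, Hilbert spaces are complex, subspaces are closed, direct sums are orthogonal, and summands may be $\{0\}$; $*$ denotes an unspecified entry. $\mathbb F_n^+$ is the unital free semigroup on $g_1,\ldots,g_n$ with identity $g_0$; $|g_0|=0$, $|g_{i_1}\cdots g_{i_k}|=k$; for $X=(X_1,\ldots,X_n)\in B(\mathcal H)^n$ put $X_{g_0}=I$ and $X_\alpha=X_{i_1}\cdots X_{i_k}$ if $\alpha=g_{i_1}\cdots g_{i_k}$. $[B(\mathcal H)^n]_1^-$ is the set of row contractions, i.e. $(X_1,\ldots,X_n)\in B(\mathcal H)^n$ with $\sum_iX_iX_i^*\le I$; an $n$-tuple is identified with the row operator $[X_1,\ldots,X_n]:\mathcal H^{(n)}\to\mathcal H$, where $\mathcal H^{(n)}$ is the direct sum of $n$ copies of $\mathcal H$. A row contraction $T$ is pure if $\lim_{k\to\infty}\sum_{|\alpha|=k}\|T_\alpha^*h\|^2=0$ for all $h\in\mathcal H$; it is an isometry if $T_i^*T_j=\delta_{ij}I$ for all $i,j$, a pure isometry if it is both an isometry and pure, and a coisometry if $\sum_iT_iT_i^*=I$. An $n$-tuple $N$ is nilpotent if there is $m\in\mathbb N$ with $N_\alpha=0$ for all $|\alpha|=m$; the smallest such $m$ is its order (so order $0$ means the space is $\{0\}$). Defect operators: $\Delta_T=(I-\sum_iT_iT_i^* )^{1/2}\in B(\mathcal H)$, $\Delta_{T^*}=(I-T^*T)^{1/2}\in B(\mathcal H^{(n)})$; defect spaces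 $\mathcal D_T=\overline{\Delta_T\mathcal H}$, $\mathcal D_{T^*}=\overline{\Delta_{T^*}\mathcal H^{(n)}}$. The characteristic function of $T$ is the function defined, for any Hilbert space $\mathcal G$ and $X\in B(\mathcal G)^n$ with $\|\sum_iX_iX_i^*\|<1$, by $$\Theta_T(X)=-I_{\mathcal G}\otimes(T|_{\mathcal D_{T^*}})+(I_{\mathcal G}\otimes\Delta_T)\Big(I-\sum_{i=1}^nX_i\otimes T_i^*\Big)^{-1}[X_1\otimes I_{\mathcal H},\ldots,X_n\otimes I_{\mathcal H}](I_{\mathcal G}\otimes\Delta_{T^*}|_{\mathcal D_{T^*}}).$$ It has a unique expansion $\Theta_T(X)=\sum_{k\ge0}\sum_{|\alpha|=k}X_\alpha\otimes A_{(\alpha)}$ with $A_{(\alpha)}\in B(\mathcal D_{T^*},\mathcal D_T)$. It is a noncommutative polynomial if only finitely many $A_{(\alpha)}$ are nonzero; its degree is then the largest $|\alpha|$ with $A_{(\alpha)}\ne0$, with the convention that constants (including zero) have degree $0$.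
   Formalization: Equivalence is read as: Θ_T is a polynomial of some degree iff a representation with N of some order exists; the degree is the least order, attained. For equal m the converse fails (shift: degree 0, also order 1). G ranges over subspaces of any infinite-dimensional Hilbert space. *)

theory Defs
  imports "HOL-Analysis.Analysis"
begin

section \<open>Complex Hilbert spaces\<close>

text \<open>
  The norm and the topology are those of the underlying real inner product space, whose inner
  product is the real part of the complex one. The complex inner product is linear in its first
  argument. The zero space is allowed.
\<close>

class chilbert_space = real_inner + complete_space +
  fixes scaleC :: "complex \<Rightarrow> 'a \<Rightarrow> 'a"  (infixr \<open>*\<^sub>C\<close> 75)
    and cinner :: "'a \<Rightarrow> 'a \<Rightarrow> complex"
  assumes scaleC_add_right: "c *\<^sub>C (x + y) = c *\<^sub>C x + c *\<^sub>C y"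
    and scaleC_add_left: "(c + d) *\<^sub>C x = c *\<^sub>C x + d *\<^sub>C x"
    and scaleC_scaleC: "c *\<^sub>C (d *\<^sub>C x) = (c * d) *\<^sub>C x"
    and scaleR_scaleC: "r *\<^sub>R x = complex_of_real r *\<^sub>C x"
    and cinner_commute: "cinner x y = cnj (cinner y x)"
    and cinner_add_left: "cinner (x + y) z = cinner x z + cinner y z"
    and cinner_scaleC_left: "cinner (c *\<^sub>C x) y = c * cinner x y"
    and Re_cinner: "Re (cinner x y) = inner x y"

text \<open>The type \<open>'h ^ 'n\<close> is the orthogonal direct sum of \<open>CARD('n)\<close> copies of \<open>'h\<close>.\<close>

instantiation vec :: (chilbert_space, finite) chilbert_space
begin

definition scaleC_vec_def: "c *\<^sub>C (x :: 'a ^ 'b) = (\<chi> i. c *\<^sub>C (x $ i))"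
definition cinner_vec_def: "cinner (x :: 'a ^ 'b) y = (\<Sum>i\<in>UNIV. cinner (x $ i) (y $ i))"

instance
proof
  fix x y z :: "'a ^ 'b" and c d :: complex and r :: real
  show "c *\<^sub>C (x + y) = c *\<^sub>C x + c *\<^sub>C y"
    by (simp add: scaleC_vec_def vec_eq_iff scaleC_add_right)
  show "(c + d) *\<^sub>C x = c *\<^sub>C x + d *\<^sub>C x"
    by (simp add: scaleC_vec_def vec_eq_iff scaleC_add_left)
  show "c *\<^sub>C (d *\<^sub>C x) = (c * d) *\<^sub>C x"
    by (simp add: scaleC_vec_def vec_eq_iff scaleC_scaleC)
  show "r *\<^sub>R x = complex_of_real r *\<^sub>C x"
    by (simp add: scaleC_vec_def vec_eq_iff scaleR_scaleC)
  show "cinner x y = cnj (cinner y x)"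
    unfolding cinner_vec_def cnj_sum by (intro sum.cong refl cinner_commute)
  show "cinner (x + y) z = cinner x z + cinner y z"
    by (simp add: cinner_vec_def cinner_add_left sum.distrib)
  show "cinner (c *\<^sub>C x) y = c * cinner x y"
    by (simp add: cinner_vec_def scaleC_vec_def cinner_scaleC_left sum_distrib_left)
  show "Re (cinner x y) = inner x y"
    by (simp add: cinner_vec_def inner_vec_def Re_cinner)
qed

end

definition csubspace :: "'a::chilbert_space set \<Rightarrow> bool" where
  "csubspace S \<longleftrightarrow> 0 \<in> S \<and> (\<forall>x\<in>S. \<forall>y\<in>S. x + y \<in> S) \<and> (\<forall>c. \<forall>x\<in>S. c *\<^sub>C x \<in> S)"

definition closed_csubspace :: "'a::chilbert_space set \<Rightarrow> bool" where
  "closed_csubspace S \<longleftrightarrow> csubspace S \<and> closed S"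

definition closed_cspan :: "'a::chilbert_space set \<Rightarrow> 'a set" where
  "closed_cspan A = closure (csubspace hull A)"

definition infinite_dimensional :: "'a::chilbert_space itself \<Rightarrow> bool" where
  "infinite_dimensional _ \<longleftrightarrow> (\<forall>B::'a set. finite B \<longrightarrow> csubspace hull B \<noteq> UNIV)"

definition orthogonal_sum3 ::
  "'a::chilbert_space set \<Rightarrow> 'a set \<Rightarrow> 'a set \<Rightarrow> bool" where
  "orthogonal_sum3 H0 H1 H2 \<longleftrightarrow>
     (\<forall>x\<in>H0. \<forall>y\<in>H1. cinner x y = 0) \<and>
     (\<forall>x\<in>H0. \<forall>z\<in>H2. cinner x z = 0) \<and>
     (\<forall>y\<in>H1. \<forall>z\<in>H2. cinner y z = 0) \<and>
     (\<forall>h. \<exists>x\<in>H0. \<exists>y\<in>H1. \<exists>z\<in>H2. h = x + y + z)"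


section \<open>Operators on closed subspaces\<close>

text \<open>
  A Hilbert space is represented by a closed subspace of a type of class \<^class>\<open>chilbert_space\<close>
  (possibly all of it), and an operator by a function on that type of which only the values on
  the subspace matter.
\<close>

definition bounded_op ::
  "'a::chilbert_space set \<Rightarrow> 'b::chilbert_space set \<Rightarrow> ('a \<Rightarrow> 'b) \<Rightarrow> bool" where
  "bounded_op S R f \<longleftrightarrow>
     (\<forall>x\<in>S. f x \<in> R) \<and>
     (\<forall>x\<in>S. \<forall>y\<in>S. f (x + y) = f x + f y) \<and>
     (\<forall>c. \<forall>x\<in>S. f (c *\<^sub>C x) = c *\<^sub>C f x) \<and>
     (\<exists>K. \<forall>x\<in>S. norm (f x) \<le> K * norm x)"

definition op_norm ::
  "'a::chilbert_space set \<Rightarrow> ('a \<Rightarrow> 'b::chilbert_space) \<Rightarrow> real" where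
  "op_norm S f = (SUP x\<in>S. norm (f x) / norm x)"

text \<open>The adjoint of an operator with domain the closed subspace \<open>S\<close>.\<close>

definition adj ::
  "'a::chilbert_space set \<Rightarrow> ('a \<Rightarrow> 'b::chilbert_space) \<Rightarrow> 'b \<Rightarrow> 'a" where
  "adj S f y = (THE z. z \<in> S \<and> (\<forall>x\<in>S. cinner (f x) y = cinner x z))"

definition positive_op :: "'a::chilbert_space set \<Rightarrow> ('a \<Rightarrow> 'a) \<Rightarrow> bool" where
  "positive_op S f \<longleftrightarrow>
     bounded_op S S f \<and> (\<forall>x\<in>S. cinner (f x) x \<in> \<real> \<and> 0 \<le> Re (cinner (f x) x))"

definition sqrt_op :: "('a::chilbert_space \<Rightarrow> 'a) \<Rightarrow> 'a \<Rightarrow> 'a" where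
  "sqrt_op f = (THE R. positive_op UNIV R \<and> R \<circ> R = f)"


section \<open>Row contractions\<close>

text \<open>
  An \<open>n\<close>-tuple is a family indexed by a finite type \<open>'n\<close>, with \<open>n = CARD('n) \<ge> 1\<close>. The free
  semigroup on \<open>n\<close> generators is the monoid \<open>'n list\<close> of words, with \<^term>\<open>length\<close> as \<open>|\<alpha>|\<close>.
\<close>

definition word_op :: "('n \<Rightarrow> 'a \<Rightarrow> 'a) \<Rightarrow> 'n list \<Rightarrow> 'a \<Rightarrow> 'a" where
  "word_op X \<alpha> = foldr (\<lambda>i f. X i \<circ> f) \<alpha> id"

definition row_op ::
  "('n::finite \<Rightarrow> 'a::chilbert_space \<Rightarrow> 'b::chilbert_space) \<Rightarrow> 'a ^ 'n \<Rightarrow> 'b" where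
  "row_op X x = (\<Sum>i\<in>UNIV. X i (x $ i))"

definition row_contraction ::
  "'a::chilbert_space set \<Rightarrow> ('n::finite \<Rightarrow> 'a \<Rightarrow> 'a) \<Rightarrow> bool" where
  "row_contraction S X \<longleftrightarrow>
     (\<forall>i. bounded_op S S (X i)) \<and>
     positive_op S (\<lambda>h. h - (\<Sum>i\<in>UNIV. X i (adj S (X i) h)))"

definition strict_row_contraction ::
  "'a::chilbert_space set \<Rightarrow> ('n::finite \<Rightarrow> 'a \<Rightarrow> 'a) \<Rightarrow> bool" where
  "strict_row_contraction S X \<longleftrightarrow>
     (\<forall>i. bounded_op S S (X i)) \<and>
     op_norm S (\<lambda>h. \<Sum>i\<in>UNIV. X i (adj S (X i) h)) < 1"

definition row_pure ::
  "'a::chilbert_space set \<Rightarrow> ('n::finite \<Rightarrow> 'a \<Rightarrow> 'a) \<Rightarrow> bool" where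
  "row_pure S X \<longleftrightarrow>
     (\<forall>h\<in>S. (\<lambda>k. \<Sum>\<alpha> | length \<alpha> = k. (norm (adj S (word_op X \<alpha>) h))\<^sup>2) \<longlonglongrightarrow> 0)"

definition row_isometry ::
  "'a::chilbert_space set \<Rightarrow> ('n::finite \<Rightarrow> 'a \<Rightarrow> 'a) \<Rightarrow> bool" where
  "row_isometry S X \<longleftrightarrow>
     (\<forall>i j. \<forall>h\<in>S. adj S (X i) (X j h) = (if i = j then h else 0))"

definition row_coisometry ::
  "'a::chilbert_space set \<Rightarrow> ('n::finite \<Rightarrow> 'a \<Rightarrow> 'a) \<Rightarrow> bool" where
  "row_coisometry S X \<longleftrightarrow> (\<forall>h\<in>S. (\<Sum>i\<in>UNIV. X i (adj S (X i) h)) = h)"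

definition nilpotent_of_order ::
  "'a::chilbert_space set \<Rightarrow> ('n::finite \<Rightarrow> 'a \<Rightarrow> 'a) \<Rightarrow> nat \<Rightarrow> bool" where
  "nilpotent_of_order S X m \<longleftrightarrow>
     (\<forall>\<alpha>. length \<alpha> = m \<longrightarrow> (\<forall>h\<in>S. word_op X \<alpha> h = 0)) \<and>
     (\<forall>k<m. \<not> (\<forall>\<alpha>. length \<alpha> = k \<longrightarrow> (\<forall>h\<in>S. word_op X \<alpha> h = 0)))"


section \<open>Hilbert space tensor products\<close>

text \<open>
  A Hilbert space tensor product is determined up to unitary equivalence by the following
  properties of the map \<open>(g, h) \<mapsto> g \<otimes> h\<close>.
\<close>

definition hilbert_tensor ::
  "('g::chilbert_space \<Rightarrow> 'h::chilbert_space \<Rightarrow> 'k::chilbert_space) \<Rightarrow> bool" where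
  "hilbert_tensor t \<longleftrightarrow>
     (\<forall>g g' h. t (g + g') h = t g h + t g' h) \<and>
     (\<forall>g h h'. t g (h + h') = t g h + t g h') \<and>
     (\<forall>c g h. t (c *\<^sub>C g) h = c *\<^sub>C t g h \<and> t g (c *\<^sub>C h) = c *\<^sub>C t g h) \<and>
     (\<forall>g g' h h'. cinner (t g h) (t g' h') = cinner g g' * cinner h h') \<and>
     closed_cspan {t g h | g h. True} = UNIV"

text \<open>The tensor product of \<open>G\<close> with the direct sum of copies of \<open>H\<close>, identified with the
  direct sum of copies of the tensor product of \<open>G\<close> with \<open>H\<close>.\<close>

definition tensor_vec ::
  "('g \<Rightarrow> 'h \<Rightarrow> 'k) \<Rightarrow> 'g \<Rightarrow> 'h ^ 'n \<Rightarrow> 'k ^ ('n::finite)" where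
  "tensor_vec t g x = (\<chi> i. t g (x $ i))"

definition tensor_space ::
  "('g::chilbert_space \<Rightarrow> 'h::chilbert_space \<Rightarrow> 'k::chilbert_space) \<Rightarrow>
   'g set \<Rightarrow> 'h set \<Rightarrow> 'k set" where
  "tensor_space t G D = closed_cspan {t g d | g d. g \<in> G \<and> d \<in> D}"

text \<open>
  The operator \<open>A \<otimes> B\<close> on the tensor product of \<open>G\<close> and \<open>D\<close>; \<open>t\<close> and \<open>u\<close> are the tensor product
  maps of the domain and of the codomain. Its values outside that space are irrelevant.
\<close>

definition tensor_op ::
  "('g::chilbert_space \<Rightarrow> 'a::chilbert_space \<Rightarrow> 'k::chilbert_space) \<Rightarrow>
   ('g \<Rightarrow> 'b::chilbert_space \<Rightarrow> 'l::chilbert_space) \<Rightarrow>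
   'g set \<Rightarrow> 'a set \<Rightarrow> ('g \<Rightarrow> 'g) \<Rightarrow> ('a \<Rightarrow> 'b) \<Rightarrow> 'k \<Rightarrow> 'l" where
  "tensor_op t u G D A B = (SOME F.
     bounded_op (tensor_space t G D) UNIV F \<and>
     (\<forall>g\<in>G. \<forall>d\<in>D. F (t g d) = u (A g) (B d)))"


section \<open>The characteristic function\<close>

definition defect_op :: "('n::finite \<Rightarrow> 'h::chilbert_space \<Rightarrow> 'h) \<Rightarrow> 'h \<Rightarrow> 'h" where
  "defect_op T = sqrt_op (\<lambda>h. h - (\<Sum>i\<in>UNIV. T i (adj UNIV (T i) h)))"

definition defect_op_star ::
  "('n::finite \<Rightarrow> 'h::chilbert_space \<Rightarrow> 'h) \<Rightarrow> 'h ^ 'n \<Rightarrow> 'h ^ 'n" where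
  "defect_op_star T = sqrt_op (\<lambda>x. x - adj UNIV (row_op T) (row_op T x))"

definition defect_space :: "('n::finite \<Rightarrow> 'h::chilbert_space \<Rightarrow> 'h) \<Rightarrow> 'h set" where
  "defect_space T = closure (range (defect_op T))"

definition defect_space_star ::
  "('n::finite \<Rightarrow> 'h::chilbert_space \<Rightarrow> 'h) \<Rightarrow> ('h ^ 'n) set" where
  "defect_space_star T = closure (range (defect_op_star T))"

text \<open>
  \<open>char_fun t T G X\<close> is the value of the characteristic function of \<open>T\<close> at the tuple \<open>X\<close> of
  operators on the closed subspace \<open>G\<close> of \<open>'g\<close>; it is an operator on the tensor product of \<open>G\<close>
  with the defect space of the adjoint row.
\<close>

definition char_fun ::
  "('g::chilbert_space \<Rightarrow> 'h::chilbert_space \<Rightarrow> 'k::chilbert_space) \<Rightarrow>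
   ('n::finite \<Rightarrow> 'h \<Rightarrow> 'h) \<Rightarrow> 'g set \<Rightarrow> ('n \<Rightarrow> 'g \<Rightarrow> 'g) \<Rightarrow> 'k ^ 'n \<Rightarrow> 'k" where
  "char_fun t T G X x =
     (let D = defect_space_star T;
          resolvent = inv_into (tensor_space t G UNIV)
            (\<lambda>z. z - (\<Sum>i\<in>UNIV. tensor_op t t G UNIV (X i) (adj UNIV (T i)) z))
      in - tensor_op (tensor_vec t) t G D id (row_op T) x
         + tensor_op t t G UNIV id (defect_op T)
             (resolvent
               (row_op (\<lambda>i. tensor_op t t G UNIV (X i) id)
                 (tensor_op (tensor_vec t) (tensor_vec t) G D id (defect_op_star T) x))))"

text \<open>
  The family \<open>A\<close> is the coefficient family of the characteristic function, with the expansion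
  converging in operator norm. As in the informal definition the space \<open>G\<close> varies; here it ranges
  over all closed subspaces of the type \<open>'g\<close>. When \<open>'g\<close> is infinite-dimensional it contains
  enough tuples of matrices to determine the restriction of every \<open>A \<alpha>\<close> to the defect space.
\<close>

definition char_fun_expansion ::
  "('g::chilbert_space \<Rightarrow> 'h::chilbert_space \<Rightarrow> 'k::chilbert_space) \<Rightarrow>
   ('n::finite \<Rightarrow> 'h \<Rightarrow> 'h) \<Rightarrow> ('n list \<Rightarrow> 'h ^ 'n \<Rightarrow> 'h) \<Rightarrow> bool" where
  "char_fun_expansion t T A \<longleftrightarrow>
     (\<forall>\<alpha>. bounded_op (defect_space_star T) (defect_space T) (A \<alpha>)) \<and>
     (\<forall>G X. closed_csubspace G \<and> strict_row_contraction G X \<longrightarrow>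
        (\<lambda>N. op_norm (tensor_space (tensor_vec t) G (defect_space_star T))
           (\<lambda>x. char_fun t T G X x
              - (\<Sum>k<N. \<Sum>\<alpha> | length \<alpha> = k.
                   tensor_op (tensor_vec t) t G (defect_space_star T) (word_op X \<alpha>) (A \<alpha>) x)))
        \<longlonglongrightarrow> 0)"

definition coeff_support ::
  "('n::finite \<Rightarrow> 'h::chilbert_space \<Rightarrow> 'h) \<Rightarrow> ('n list \<Rightarrow> 'h ^ 'n \<Rightarrow> 'h) \<Rightarrow> 'n list set" where
  "coeff_support T A = {\<alpha>. \<exists>x\<in>defect_space_star T. A \<alpha> x \<noteq> 0}"

text \<open>Inserting \<open>0\<close> gives the zero polynomial degree \<open>0\<close>.\<close>

definition char_fun_polynomial_of_degree ::
  "('g::chilbert_space \<Rightarrow> 'h::chilbert_space \<Rightarrow> 'k::chilbert_space) \<Rightarrow>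
   ('n::finite \<Rightarrow> 'h \<Rightarrow> 'h) \<Rightarrow> nat \<Rightarrow> bool" where
  "char_fun_polynomial_of_degree t T m \<longleftrightarrow>
     (\<exists>A. char_fun_expansion t T A \<and> finite (coeff_support T A) \<and>
          m = Max (insert 0 (length ` coeff_support T A)))"


section \<open>Upper triangular representations\<close>

definition upper_triangular_representation ::
  "('n::finite \<Rightarrow> 'h::chilbert_space \<Rightarrow> 'h) \<Rightarrow> 'h set \<Rightarrow> 'h set \<Rightarrow> 'h set \<Rightarrow>
   ('n \<Rightarrow> 'h \<Rightarrow> 'h) \<Rightarrow> ('n \<Rightarrow> 'h \<Rightarrow> 'h) \<Rightarrow> ('n \<Rightarrow> 'h \<Rightarrow> 'h) \<Rightarrow> bool" where
  "upper_triangular_representation T H0 H1 H2 V N W \<longleftrightarrow>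
     (\<exists>A B C. \<forall>i.
        bounded_op H1 H0 (A i) \<and> bounded_op H2 H0 (B i) \<and> bounded_op H2 H1 (C i) \<and>
        (\<forall>x\<in>H0. \<forall>y\<in>H1. \<forall>z\<in>H2.
           T i (x + y + z) = (V i x + A i y + B i z) + (N i y + C i z) + W i z))"

definition has_representation_of_order ::
  "('n::finite \<Rightarrow> 'h::chilbert_space \<Rightarrow> 'h) \<Rightarrow> nat \<Rightarrow> bool" where
  "has_representation_of_order T m \<longleftrightarrow>
     (\<exists>H0 H1 H2 V N W.
        closed_csubspace H0 \<and> closed_csubspace H1 \<and> closed_csubspace H2 \<and>
        orthogonal_sum3 H0 H1 H2 \<and>
        upper_triangular_representation T H0 H1 H2 V N W \<and>
        row_contraction H0 V \<and> row_isometry H0 V \<and> row_pure H0 V \<and>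
        row_contraction H1 N \<and> nilpotent_of_order H1 N m \<and>
        row_contraction H2 W \<and> row_coisometry H2 W)"

end

theory Submission
  imports Defs
begin

text \<open>
  Write \<open>T\<^sub>\<beta>\<^sup>*\<close> for the product of the adjoints \<open>T\<^sub>i\<^sup>*\<close> in the order of the letters of \<open>\<beta>\<close>. Expanding the resolvent
  in the characteristic function as a geometric series shows that its constant coefficient is \<open>- T\<close> and
  that the coefficient of a word \<open>\<beta> j\<close> is \<open>\<Delta>\<^sub>T T\<^sub>\<beta>\<^sup>* P\<^sub>j \<Delta>\<^bsub>T*\<^esub>\<close>, with \<open>P\<^sub>j\<close> the \<open>j\<close>-th coordinate of the direct sum. That
  this family is an expansion is \<open>char_fun_expansion_char_coeff\<close>; that it is the only one is
  \<open>expansion_coeff_unique\<close>, proved by evaluating at finite shifts that single out one word. The degree is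
  therefore at most \<open>m\<close> if and only if \<open>\<Delta>\<^sub>T T\<^sub>\<beta>\<^sup>* P\<^sub>j \<Delta>\<^bsub>T*\<^esub> = 0\<close> whenever \<open>\<bar>\<beta>\<bar> \<ge> m\<close>, and the rest is geometry in \<open>H\<close>.

  Let a representation with a nilpotent part of order \<open>m\<close> be given. As \<open>V\<close> is isometric, \<open>P\<^sub>j \<Delta>\<^bsub>T*\<^esub>\<close> takes its values
  orthogonally to \<open>H\<^sub>0\<close>; from there \<open>T\<^sub>\<beta>\<^sup>*\<close> leads into \<open>H\<^sub>2\<close> as soon as \<open>\<bar>\<beta>\<bar> \<ge> m\<close>; and \<open>\<Delta>\<^sub>T\<close> vanishes on \<open>H\<^sub>2\<close> because \<open>W\<close> is
  a coisometry. So the degree is at most \<open>m\<close> (\<open>char_coeff_eq_0_of_representation\<close>).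

  Conversely, let the coefficients of all words longer than \<open>m\<close> vanish. Take for \<open>H\<^sub>2\<close> the largest subspace
  invariant under the \<open>T\<^sub>i\<^sup>*\<close> on which \<open>\<Delta>\<^sub>T\<close> vanishes, and for \<open>H\<^sub>1 \<oplus> H\<^sub>2\<close> the subspace of the vectors that all \<open>T\<^sub>\<beta>\<^sup>*\<close>
  with \<open>\<bar>\<beta>\<bar> = m\<close> take into \<open>H\<^sub>2\<close>. The hypothesis says that \<open>P\<^sub>j \<Delta>\<^bsub>T*\<^esub>\<close> maps the defect space into \<open>H\<^sub>1 \<oplus> H\<^sub>2\<close>, so that \<open>\<Delta>\<^bsub>T*\<^esub>\<close>
  vanishes on the copies of \<open>H\<^sub>0\<close> and \<open>T\<close> is isometric there. It is pure there because a vector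
  that survives in all ranges of words would lie in \<open>H\<^sub>2\<close> (\<open>isometric_part_pure\<close>), and the middle
  compression is nilpotent of some order \<open>k \<le> m\<close> (\<open>representation_of_vanishing_coeffs\<close>). If \<open>m\<close> is the
  degree, then \<open>m \<le> k\<close> by the preceding paragraph, so that the order is exactly \<open>m\<close>, and no representation has
  a smaller one.
\<close>

section \<open>Complex inner products, projections and adjoints\<close>

lemma inner_scaleC_left: "inner (c *\<^sub>C x) (y::'a::chilbert_space) = Re (c * cinner x y)"
  by (metis Re_cinner cinner_scaleC_left)

lemma Im_cinner: "Im (cinner x y) = - inner (\<i> *\<^sub>C x) (y::'a::chilbert_space)"
  by (simp add: inner_scaleC_left)

lemma cinner_scaleC_right: "cinner x (c *\<^sub>C y) = cnj c * cinner x (y::'a::chilbert_space)"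
  by (metis cinner_commute cinner_scaleC_left complex_cnj_mult)

lemma cinner_add_right: "cinner x (y + z) = cinner x y + cinner x (z::'a::chilbert_space)"
  by (metis cinner_commute cinner_add_left complex_cnj_add)

lemma cinner_self: "cinner x x = complex_of_real ((norm (x::'a::chilbert_space))\<^sup>2)"
proof -
  have "Im (cinner x x) = 0"
    using cinner_commute[of x x] by (metis add_cancel_right_right cnj.simps(2) complex_cnj_cancel_iff neg_equal_zero)
  then show ?thesis
    by (simp add: complex_eq_iff Re_cinner power2_norm_eq_inner)
qed

lemma scaleC_zero_left [simp]: "0 *\<^sub>C (x::'a::chilbert_space) = 0"
  by (metis scaleR_scaleC of_real_0 scaleR_zero_left)

lemma scaleC_zero_right [simp]: "c *\<^sub>C (0::'a::chilbert_space) = 0"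
  by (metis add_cancel_right_right scaleC_add_right)

lemma scaleC_one [simp]: "1 *\<^sub>C (x::'a::chilbert_space) = x"
  by (metis scaleR_scaleC of_real_1 scaleR_one)

lemma scaleC_minus_right: "c *\<^sub>C (- x) = - (c *\<^sub>C (x::'a::chilbert_space))"
  by (metis add.right_inverse add_eq_0_iff scaleC_add_right scaleC_zero_right)

lemma scaleC_minus_left: "(- c) *\<^sub>C x = - (c *\<^sub>C (x::'a::chilbert_space))"
  by (metis add.right_inverse add_eq_0_iff scaleC_add_left scaleC_zero_left)

lemma scaleC_diff_right: "c *\<^sub>C (x - y) = c *\<^sub>C x - c *\<^sub>C (y::'a::chilbert_space)"
  by (metis diff_conv_add_uminus scaleC_add_right scaleC_minus_right)

lemma scaleC_scaleR: "c *\<^sub>C (r *\<^sub>R x) = r *\<^sub>R (c *\<^sub>C (x::'a::chilbert_space))"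
  by (simp add: scaleR_scaleC scaleC_scaleC mult.commute)

lemma norm_scaleC: "norm (c *\<^sub>C x) = cmod c * norm (x::'a::chilbert_space)"
proof -
  have "cinner (c *\<^sub>C x) (c *\<^sub>C x) = (c * cnj c) * cinner x x"
    by (simp add: cinner_scaleC_left cinner_scaleC_right)
  then have "complex_of_real ((norm (c *\<^sub>C x))\<^sup>2) = complex_of_real ((cmod c * norm x)\<^sup>2)"
    unfolding cinner_self complex_norm_square[symmetric] by (simp add: power_mult_distrib)
  then show ?thesis
    by (simp only: of_real_eq_iff) (simp add: power2_eq_iff_nonneg)
qed

lemma cinner_zero_left [simp]: "cinner 0 (x::'a::chilbert_space) = 0"
  using cinner_scaleC_left[of 0 0 x] by simp

lemma cinner_zero_right [simp]: "cinner (x::'a::chilbert_space) 0 = 0"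
  using cinner_scaleC_right[of x 0 0] by simp

lemma cinner_sum_left: "cinner (\<Sum>i\<in>I. f i) (y::'a::chilbert_space) = (\<Sum>i\<in>I. cinner (f i) y)"
  by (induction I rule: infinite_finite_induct) (auto simp: cinner_add_left)

lemma cinner_sum_right: "cinner (y::'a::chilbert_space) (\<Sum>i\<in>I. f i) = (\<Sum>i\<in>I. cinner y (f i))"
  by (induction I rule: infinite_finite_induct) (auto simp: cinner_add_right)

lemma cinner_minus_left: "cinner (- x) (y::'a::chilbert_space) = - cinner x y"
  by (metis add.right_inverse add_eq_0_iff cinner_add_left cinner_zero_left)

lemma cinner_diff_left: "cinner (x - z) (y::'a::chilbert_space) = cinner x y - cinner z y"
  by (metis cinner_add_left cinner_minus_left diff_conv_add_uminus)

lemma cinner_eq_inner: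
  "cinner x (y::'a::chilbert_space) = Complex (inner x y) (- inner (\<i> *\<^sub>C x) y)"
  by (simp add: complex_eq_iff Re_cinner Im_cinner)

lemma bounded_linear_scaleC: "bounded_linear (\<lambda>x::'a::chilbert_space. c *\<^sub>C x)"
  by (rule bounded_linear_intro[where K="cmod c"])
     (auto simp: scaleC_add_right scaleC_scaleR norm_scaleC mult.commute)

lemma csubspace_subspace: "csubspace S \<Longrightarrow> subspace S"
  by (auto simp: csubspace_def subspace_def scaleR_scaleC)

lemma csubspaceI: "subspace S \<Longrightarrow> (\<And>c x. x \<in> S \<Longrightarrow> c *\<^sub>C x \<in> S) \<Longrightarrow> csubspace S"
  by (auto simp: csubspace_def subspace_def)

lemma csubspace_scaleC: "csubspace S \<Longrightarrow> x \<in> S \<Longrightarrow> c *\<^sub>C x \<in> S"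
  by (auto simp: csubspace_def)

lemma closed_csubspaceD:
  assumes "closed_csubspace S"
  shows "subspace S" "closed S" "csubspace S" "0 \<in> S"
    "\<And>x y. x \<in> S \<Longrightarrow> y \<in> S \<Longrightarrow> x + y \<in> S" "\<And>x y. x \<in> S \<Longrightarrow> y \<in> S \<Longrightarrow> x - y \<in> S"
  using assms csubspace_subspace[of S]
  by (auto simp: closed_csubspace_def csubspace_def subspace_diff)

lemma closed_csubspace_UNIV [simp]: "closed_csubspace UNIV"
  by (auto simp: closed_csubspace_def csubspace_def)

lemma closed_csubspace_Int:
  "closed_csubspace S \<Longrightarrow> closed_csubspace R \<Longrightarrow> closed_csubspace (S \<inter> R)"
  by (auto simp: closed_csubspace_def csubspace_def)

lemma parallelogram_law:
  fixes a b :: "'a::real_inner"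
  shows "(norm (a - b))\<^sup>2 + (norm (a + b))\<^sup>2 = 2 * (norm a)\<^sup>2 + 2 * (norm b)\<^sup>2"
  by (simp add: power2_norm_eq_inner inner_add_left inner_add_right inner_diff_left inner_diff_right)

lemma norm_diff_squared:
  fixes a b :: "'a::real_inner"
  shows "(norm (a - b))\<^sup>2 = (norm a)\<^sup>2 - 2 * inner b a + (norm b)\<^sup>2"
  by (simp add: power2_norm_eq_inner inner_diff_left inner_diff_right inner_commute)

text \<open>
  A minimizing sequence for the distance from \<open>x\<close> to \<open>S\<close> is Cauchy by the parallelogram law, and at its
  limit \<open>p\<close> no move within \<open>S\<close> brings \<open>p\<close> closer to \<open>x\<close>.
\<close>

lemma nearest_point_orthogonal:
  fixes S :: "'a::{real_inner, complete_space} set"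
  assumes "subspace S" "closed S"
  shows "\<exists>p\<in>S. \<forall>s\<in>S. inner s (x - p) = 0"
proof -
  define d where "d = Inf ((\<lambda>s. (norm (x - s))\<^sup>2) ` S)"
  have S0: "0 \<in> S" using assms(1) by (simp add: subspace_0)
  have d_le: "d \<le> (norm (x - s))\<^sup>2" if "s \<in> S" for s
    unfolding d_def using that by (intro cINF_lower bdd_belowI[of _ 0]) auto
  have "\<exists>s\<in>S. (norm (x - s))\<^sup>2 < d + inverse (real (Suc n))" for n
  proof (rule ccontr)
    assume "\<not> ?thesis"
    then have "d + inverse (real (Suc n)) \<le> d"
      using S0 by (subst (2) d_def, intro cINF_greatest) (auto simp: not_less)
    then show False by (simp add: field_simps)
  qed
  then obtain s where sS: "s n \<in> S" and sd: "(norm (x - s n))\<^sup>2 < d + inverse (real (Suc n))" for n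
    by metis
  have dist_s: "(dist (s m) (s n))\<^sup>2 \<le> 2 * inverse (real (Suc m)) + 2 * inverse (real (Suc n))" for m n
  proof -
    have "(1/2) *\<^sub>R (s m + s n) \<in> S"
      using sS assms(1) by (intro subspace_scale subspace_add)
    then have "d \<le> (norm (x - (1/2) *\<^sub>R (s m + s n)))\<^sup>2" by (rule d_le)
    also have "x - (1/2) *\<^sub>R (s m + s n) = (1/2) *\<^sub>R ((x - s m) + (x - s n))"
      by (simp add: scaleR_add_right scaleR_diff_right flip: scaleR_add_left)
    finally have "4 * d \<le> (norm ((x - s m) + (x - s n)))\<^sup>2" by (simp add: power_divide)
    moreover have "(norm ((x - s n) - (x - s m)))\<^sup>2 + (norm ((x - s m) + (x - s n)))\<^sup>2
        = 2 * (norm (x - s m))\<^sup>2 + 2 * (norm (x - s n))\<^sup>2"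
      using parallelogram_law[of "x - s m" "x - s n"] by (simp add: norm_minus_commute)
    ultimately show ?thesis using sd[of m] sd[of n] by (simp add: dist_norm)
  qed
  have "Cauchy s"
  proof (rule metric_CauchyI)
    fix e :: real assume "e > 0"
    then obtain M where M: "inverse (real (Suc M)) < e\<^sup>2 / 4"
      using reals_Archimedean[of "e\<^sup>2/4"] by auto
    have "dist (s m) (s n) < e" if "m \<ge> M" "n \<ge> M" for m n
    proof -
      have "inverse (real (Suc m)) \<le> inverse (real (Suc M))" "inverse (real (Suc n)) \<le> inverse (real (Suc M))"
        using that by (auto intro!: le_imp_inverse_le)
      then have "(dist (s m) (s n))\<^sup>2 < e\<^sup>2" using dist_s[of m n] M by linarith
      then show ?thesis using \<open>e > 0\<close> by (simp add: power_less_imp_less_base)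
    qed
    then show "\<exists>M. \<forall>m\<ge>M. \<forall>n\<ge>M. dist (s m) (s n) < e" by blast
  qed
  then obtain p where p: "s \<longlonglongrightarrow> p" using Cauchy_convergent convergent_def by blast
  have pS: "p \<in> S" using assms(2) sS p by (rule closed_sequentially)
  have "(\<lambda>n. (norm (x - s n))\<^sup>2) \<longlonglongrightarrow> (norm (x - p))\<^sup>2"
    by (intro tendsto_intros p)
  moreover have "(\<lambda>n. d + inverse (real (Suc n))) \<longlonglongrightarrow> d + 0"
    by (intro tendsto_intros LIMSEQ_inverse_real_of_nat)
  ultimately have pd: "(norm (x - p))\<^sup>2 \<le> d"
    using sd by (intro LIMSEQ_le[of _ _ "\<lambda>n. d + inverse (real (Suc n))"]) (auto intro: less_imp_le)
  have "inner q (x - p) = 0" if "q \<in> S" for q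
  proof (cases "q = 0")
    case False
    \<comment> \<open>the best step from \<open>p\<close> in the direction of \<open>q\<close>\<close>
    define t where "t = inner q (x - p) / (norm q)\<^sup>2"
    have nq: "(norm q)\<^sup>2 > 0" using False by simp
    have "p + t *\<^sub>R q \<in> S" using pS that assms(1) by (intro subspace_add subspace_scale)
    then have "(norm (x - p))\<^sup>2 \<le> (norm (x - (p + t *\<^sub>R q)))\<^sup>2" using d_le[of "p + t *\<^sub>R q"] pd by linarith
    also have "\<dots> = (norm (x - p))\<^sup>2 - 2 * t * inner q (x - p) + t\<^sup>2 * (norm q)\<^sup>2"
      using norm_diff_squared[of "x - p" "t *\<^sub>R q"] by (simp add: diff_diff_eq power_mult_distrib)
    also have "\<dots> = (norm (x - p))\<^sup>2 - (inner q (x - p))\<^sup>2 / (norm q)\<^sup>2"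
      using nq by (simp add: t_def field_simps power2_eq_square)
    finally have "(inner q (x - p))\<^sup>2 / (norm q)\<^sup>2 \<le> 0" by simp
    then show ?thesis using nq by (simp add: divide_le_0_iff)
  qed simp
  with pS show ?thesis by blast
qed

definition proj :: "'a::{real_inner, complete_space} set \<Rightarrow> 'a \<Rightarrow> 'a" where
  "proj S x = (SOME p. p \<in> S \<and> (\<forall>s\<in>S. inner s (x - p) = 0))"

context
  fixes S :: "'a::{real_inner, complete_space} set"
  assumes S: "subspace S" "closed S"
begin

lemma proj_spec: "proj S x \<in> S" "s \<in> S \<Longrightarrow> inner s (x - proj S x) = 0"
proof -
  have "proj S x \<in> S \<and> (\<forall>s\<in>S. inner s (x - proj S x) = 0)"
    unfolding proj_def using nearest_point_orthogonal[OF S, of x] by (intro someI_ex[of "\<lambda>p. p \<in> S \<and> (\<forall>s\<in>S. inner s (x - p) = 0)"]) blast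
  then show "proj S x \<in> S" "s \<in> S \<Longrightarrow> inner s (x - proj S x) = 0" by auto
qed

lemma inner_proj: "s \<in> S \<Longrightarrow> inner s (proj S x) = inner s x"
  using proj_spec(2)[of s x] by (simp add: inner_diff_right)

lemma proj_eqI:
  assumes "p \<in> S" "\<And>s. s \<in> S \<Longrightarrow> inner s (x - p) = 0"
  shows "proj S x = p"
proof -
  have "proj S x - p \<in> S" using assms proj_spec(1) S by (intro subspace_diff)
  then have "inner (proj S x - p) (x - p) = 0" "inner (proj S x - p) (x - proj S x) = 0"
    using assms(2) proj_spec(2) by blast+
  then have "inner (proj S x - p) (proj S x - p) = 0" by (simp add: inner_diff_right)
  then show ?thesis by simp
qed

lemma proj_id: "x \<in> S \<Longrightarrow> proj S x = x"
  by (rule proj_eqI) auto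

lemma proj_orthogonal_comp: "x - proj S x \<in> S\<^sup>\<bottom>"
  by (auto simp: orthogonal_comp_def orthogonal_def proj_spec)

lemma norm_proj_le: "norm (proj S x) \<le> norm x"
proof -
  have "norm (proj S x) * norm (proj S x) = inner (proj S x) x"
    using inner_proj[OF proj_spec(1), of x x] by (simp add: power2_norm_eq_inner[symmetric] power2_eq_square)
  also have "\<dots> \<le> norm (proj S x) * norm x" by (rule norm_cauchy_schwarz)
  finally show ?thesis by (metis mult_le_cancel_left_pos norm_ge_zero norm_zero order_le_less)
qed

lemma proj_bounded_linear: "bounded_linear (proj S)"
proof (rule bounded_linear_intro[where K=1])
  show "proj S (x + y) = proj S x + proj S y" for x y
    using S by (intro proj_eqI) (auto intro!: subspace_add simp: proj_spec(1) inner_diff_right inner_add_right inner_proj)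
  show "proj S (r *\<^sub>R x) = r *\<^sub>R proj S x" for r x
    using S by (intro proj_eqI) (auto intro!: subspace_scale simp: proj_spec(1) inner_diff_right inner_proj)
  show "norm (proj S x) \<le> norm x * 1" for x by (simp add: norm_proj_le)
qed

end

lemma orthogonal_compI: "(\<And>s. s \<in> S \<Longrightarrow> inner s x = 0) \<Longrightarrow> x \<in> S\<^sup>\<bottom>"
  by (simp add: orthogonal_comp_def orthogonal_def)

lemma orthogonal_compD: "x \<in> S\<^sup>\<bottom> \<Longrightarrow> s \<in> S \<Longrightarrow> inner s x = 0"
  by (simp add: orthogonal_comp_def orthogonal_def)

lemma inner_scaleC_cnj: "inner (c *\<^sub>C x) (y::'a::chilbert_space) = inner x (cnj c *\<^sub>C y)"
  by (metis Re_cinner cinner_scaleC_left cinner_scaleC_right complex_cnj_cnj)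

lemma closed_csubspace_orthogonal_comp:
  fixes S :: "'a::chilbert_space set"
  assumes "closed_csubspace S"
  shows "closed_csubspace (S\<^sup>\<bottom>)"
proof -
  have "S\<^sup>\<bottom> = (\<Inter>s\<in>S. {x. inner s x = 0})"
    by (auto simp: orthogonal_comp_def orthogonal_def)
  moreover have "closed \<dots>" by (intro closed_INT ballI closed_Collect_eq continuous_intros)
  moreover have "csubspace (S\<^sup>\<bottom>)"
  proof (rule csubspaceI[OF subspace_orthogonal_comp])
    fix c x assume x: "x \<in> S\<^sup>\<bottom>"
    show "c *\<^sub>C x \<in> S\<^sup>\<bottom>"
    proof (rule orthogonal_compI)
      fix s assume "s \<in> S"
      then have "cnj c *\<^sub>C s \<in> S" using assms by (simp add: closed_csubspace_def csubspace_scaleC)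
      then show "inner s (c *\<^sub>C x) = 0" using orthogonal_compD[OF x] by (metis inner_scaleC_cnj complex_cnj_cnj)
    qed
  qed
  ultimately show ?thesis by (simp add: closed_csubspace_def)
qed

text \<open>
  A complex subspace contains \<open>\<i> s\<close> along with \<open>s\<close>, and the imaginary part of a complex inner product is
  the real inner product with \<open>\<i> s\<close> up to sign. Orthogonality to a complex subspace, and likewise the
  defining property of an adjoint, can therefore be checked in the real inner product.
\<close>

lemma cinner_eq_0_of_inner:
  assumes "csubspace S" "\<And>s. s \<in> S \<Longrightarrow> inner s x = 0" "s \<in> S"
  shows "cinner s x = 0"
  using assms by (simp add: cinner_eq_inner csubspace_scaleC complex_eq_iff)

text \<open>
  The operators of the proof are taken on whole types, where their linearity holds without side
  conditions. An operator on a closed subspace enters by composition with \<^const>\<open>proj\<close>.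
\<close>

definition bclin :: "('a::chilbert_space \<Rightarrow> 'b::chilbert_space) \<Rightarrow> bool" where
  "bclin f \<longleftrightarrow> bounded_linear f \<and> (\<forall>c x. f (c *\<^sub>C x) = c *\<^sub>C f x)"

lemma bclinD:
  assumes "bclin f"
  shows "bounded_linear f" "f (x + y) = f x + f y" "f (x - y) = f x - f y" "f 0 = 0"
    "f (- x) = - f x" "f (r *\<^sub>R x) = r *\<^sub>R f x" "f (c *\<^sub>C x) = c *\<^sub>C f x"
    "f (sum g I) = (\<Sum>i\<in>I. f (g i))"
proof -
  show 1: "bounded_linear f" "f (c *\<^sub>C x) = c *\<^sub>C f x" using assms by (auto simp: bclin_def)
  then interpret bounded_linear f by simp
  show "f (x + y) = f x + f y" "f (x - y) = f x - f y" "f 0 = 0"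
    "f (- x) = - f x" "f (r *\<^sub>R x) = r *\<^sub>R f x" "f (sum g I) = (\<Sum>i\<in>I. f (g i))"
    by (auto simp: add diff zero neg scale sum)
qed

lemma bclin_continuous_on: "bclin f \<Longrightarrow> continuous_on S f"
  by (simp add: bclinD(1) linear_continuous_on)

lemma bclin_tendsto: "bclin f \<Longrightarrow> (g \<longlongrightarrow> l) F \<Longrightarrow> ((\<lambda>n. f (g n)) \<longlongrightarrow> f l) F"
  using bclinD(1) bounded_linear.tendsto by blast

lemma bclin_bounded_op: "bclin f \<longleftrightarrow> bounded_op UNIV UNIV f"
proof
  assume f: "bounded_op UNIV UNIV f"
  then obtain K where K: "\<And>x. norm (f x) \<le> K * norm x" by (auto simp: bounded_op_def)
  have "bounded_linear f"
    using f K by (intro bounded_linear_intro[where K=K]) (auto simp: bounded_op_def scaleR_scaleC mult.commute)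
  then show "bclin f" using f by (auto simp: bclin_def bounded_op_def)
next
  assume f: "bclin f"
  then obtain K where "\<And>x. norm (f x) \<le> norm x * K" using bounded_linear.bounded bclinD(1) by blast
  then show "bounded_op UNIV UNIV f" using f by (auto simp: bounded_op_def bclinD mult.commute)
qed

lemma bclin_ident [simp]: "bclin (\<lambda>x. x)" "bclin id"
  by (auto simp: bclin_def id_def bounded_linear_ident)

lemma bclin_zero [simp]: "bclin (\<lambda>x. 0)"
  by (auto simp: bclin_def bounded_linear_zero)

lemma bclin_compose: "bclin f \<Longrightarrow> bclin g \<Longrightarrow> bclin (\<lambda>x. f (g x))"
  by (auto simp: bclin_def bounded_linear_compose)

lemma bclin_add: "bclin f \<Longrightarrow> bclin g \<Longrightarrow> bclin (\<lambda>x. f x + g x)"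
  by (auto simp: bclin_def bounded_linear_add scaleC_add_right)

lemma bclin_diff: "bclin f \<Longrightarrow> bclin g \<Longrightarrow> bclin (\<lambda>x. f x - g x)"
  by (auto simp: bclin_def bounded_linear_sub scaleC_diff_right)

lemma bclin_minus: "bclin f \<Longrightarrow> bclin (\<lambda>x. - f x)"
  by (auto simp: bclin_def bounded_linear_minus scaleC_minus_right)

lemma bclin_scaleR: "bclin f \<Longrightarrow> bclin (\<lambda>x. r *\<^sub>R f x)"
  by (auto simp: bclin_def scaleC_scaleR intro: bounded_linear_compose[OF bounded_linear_scaleR_right])

lemma bclin_sum: "(\<And>i. i \<in> I \<Longrightarrow> bclin (f i)) \<Longrightarrow> bclin (\<lambda>x. \<Sum>i\<in>I. f i x)"
  by (induction I rule: infinite_finite_induct) (auto intro: bclin_add)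

lemma bclin_vec_nth: "bclin (\<lambda>x::'a::chilbert_space^'n::finite. x $ i)"
  by (auto simp: bclin_def bounded_linear_vec_nth scaleC_vec_def)

lemma axis_eq_sum: "(x::'a::comm_monoid_add^'n::finite) = (\<Sum>i\<in>UNIV. axis i (x $ i))"
  by (simp add: vec_eq_iff axis_def)

lemma norm_axis: "norm (axis i x :: 'a::real_inner^'n::finite) = norm x"
  by (simp add: norm_eq_sqrt_inner inner_axis)

lemma bclin_axis: "bclin (\<lambda>x. axis i x :: 'a::chilbert_space^'n::finite)"
proof -
  have "bounded_linear (\<lambda>x. axis i x :: 'a^'n)"
    by (rule bounded_linear_intro[where K=1]) (auto simp: norm_axis, auto simp: vec_eq_iff axis_def)
  then show ?thesis by (auto simp: bclin_def vec_eq_iff axis_def scaleC_vec_def)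
qed

lemma bclin_vec_lambda:
  assumes "\<And>i. bclin (f i)"
  shows "bclin (\<lambda>x. (\<chi> i. f i x) :: 'b::chilbert_space^'n::finite)"
proof -
  have "(\<lambda>x. (\<chi> i. f i x) :: 'b^'n) = (\<lambda>x. \<Sum>i\<in>UNIV. axis i (f i x))"
    by (rule ext, subst axis_eq_sum) simp
  then show ?thesis using assms by (simp add: bclin_sum bclin_compose[OF bclin_axis])
qed

lemma bclin_row_op: "(\<And>i. bclin (X i)) \<Longrightarrow> bclin (row_op X)"
  unfolding row_op_def by (intro bclin_sum bclin_compose[OF _ bclin_vec_nth])

lemma bclin_proj:
  fixes S :: "'a::chilbert_space set"
  assumes S: "closed_csubspace S"
  shows "bclin (proj S)"
proof -
  note D = closed_csubspaceD[OF S]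
  have "proj S (c *\<^sub>C x) = c *\<^sub>C proj S x" for c x
  proof (rule proj_eqI[OF D(1,2)])
    show "c *\<^sub>C proj S x \<in> S" using proj_spec(1)[OF D(1,2)] D(3) by (simp add: csubspace_scaleC)
    fix s assume "s \<in> S"
    then have "cnj c *\<^sub>C s \<in> S" using D(3) by (simp add: csubspace_scaleC)
    then have "inner (cnj c *\<^sub>C s) (x - proj S x) = 0" by (rule proj_spec(2)[OF D(1,2)])
    then show "inner s (c *\<^sub>C x - c *\<^sub>C proj S x) = 0"
      by (simp add: inner_scaleC_cnj scaleC_diff_right)
  qed
  then show ?thesis using proj_bounded_linear[OF D(1,2)] by (simp add: bclin_def)
qed

lemma bclin_extend:
  assumes S: "closed_csubspace S" and f: "bounded_op S R f"
  shows "bclin (\<lambda>x. f (proj S x))"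
proof -
  note D = closed_csubspaceD[OF S]
  note P = bclin_proj[OF S] and PS = proj_spec(1)[OF D(1,2)]
  obtain K where K: "\<And>x. x \<in> S \<Longrightarrow> norm (f x) \<le> K * norm x"
    using f unfolding bounded_op_def by blast
  have "norm (f (proj S x)) \<le> \<bar>K\<bar> * norm x" for x
  proof -
    have "norm (f (proj S x)) \<le> K * norm (proj S x)" using K PS by blast
    also have "\<dots> \<le> \<bar>K\<bar> * norm (proj S x)" by (simp add: mult_right_mono)
    also have "\<dots> \<le> \<bar>K\<bar> * norm x" using norm_proj_le[OF D(1,2)] by (simp add: mult_left_mono)
    finally show ?thesis .
  qed
  then show ?thesis
    using f PS unfolding bclin_bounded_op by (auto simp: bounded_op_def bclinD[OF P])
qed

text \<open>
  The Riesz representation theorem: the kernel of a nonzero functional has codimension one, so that any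
  nonzero vector orthogonal to it represents the functional up to a factor.
\<close>

lemma riesz_representation:
  fixes f :: "'a::{real_inner, complete_space} \<Rightarrow> real"
  assumes "bounded_linear f"
  shows "\<exists>z. \<forall>x. f x = inner x z"
proof (cases "\<forall>x. f x = 0")
  case False
  interpret bounded_linear f by fact
  define N where "N = {x. f x = 0}"
  have N: "subspace N" "closed N"
    by (auto simp: N_def subspace_def add scale zero intro!: closed_Collect_eq linear_continuous_on assms continuous_intros)
  from False obtain u where u: "f u \<noteq> 0" by blast
  define w where "w = u - proj N u"
  have fw: "f w = f u" using proj_spec(1)[OF N, of u] by (simp add: w_def diff N_def)
  then have w: "w \<noteq> 0" using u by (auto simp: zero)
  have "f x = inner x ((f w / (norm w)\<^sup>2) *\<^sub>R w)" for x
  proof -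
    have "x - (f x / f w) *\<^sub>R w \<in> N" using fw u by (simp add: N_def diff scale)
    then have "inner (x - (f x / f w) *\<^sub>R w) w = 0" unfolding w_def by (rule proj_spec(2)[OF N])
    then have "inner x w = (f x / f w) * (norm w)\<^sup>2" by (simp add: inner_diff_left power2_norm_eq_inner)
    then show ?thesis using fw u w by simp
  qed
  then show ?thesis by blast
qed (auto intro!: exI[of _ 0])

lemma adj_eqI:
  assumes S: "csubspace S" and f: "bounded_op S R f"
    and z: "z \<in> S" "\<And>x. x \<in> S \<Longrightarrow> inner (f x) y = inner x z"
  shows "adj S f y = z"
  unfolding adj_def
proof (rule the_equality)
  have "cinner (f x) y = cinner x z" if "x \<in> S" for x
  proof -
    have "inner (\<i> *\<^sub>C f x) y = inner (\<i> *\<^sub>C x) z"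
      using z(2)[of "\<i> *\<^sub>C x"] f that S by (simp add: bounded_op_def csubspace_scaleC)
    then show ?thesis using z(2)[OF that] by (simp add: cinner_eq_inner)
  qed
  with z(1) show "z \<in> S \<and> (\<forall>x\<in>S. cinner (f x) y = cinner x z)" by blast
next
  fix z' assume z': "z' \<in> S \<and> (\<forall>x\<in>S. cinner (f x) y = cinner x z')"
  have "z' - z \<in> S" using z' z(1) S by (simp add: csubspace_subspace subspace_diff)
  then have "inner (z' - z) z' = inner (z' - z) z" using z' z(2) by (metis Re_cinner)
  then have "inner (z' - z) (z' - z) = 0" by (simp add: inner_diff_right)
  then show "z' = z" by simp
qed

text \<open>
  Existence of the adjoint, from the Riesz theorem for \<open>x \<mapsto> inner (f (proj S x)) y\<close>.
\<close>

lemma adj_spec: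
  assumes S: "closed_csubspace S" and f: "bounded_op S R f"
  shows "adj S f y \<in> S" "x \<in> S \<Longrightarrow> inner (f x) y = inner x (adj S f y)"
proof -
  note D = closed_csubspaceD[OF S]
  have "bounded_linear (\<lambda>x. inner (f (proj S x)) y)"
    using bclin_extend[OF S f] by (intro bounded_linear_inner_left_comp) (simp add: bclin_def)
  then obtain w where w: "\<And>x. inner (f (proj S x)) y = inner x w" using riesz_representation by blast
  have *: "inner (f x) y = inner x (proj S w)" if "x \<in> S" for x
    using w[of x] that by (simp add: proj_id[OF D(1,2)] inner_proj[OF D(1,2)])
  have "adj S f y = proj S w"
    by (rule adj_eqI[OF D(3) f]) (use proj_spec(1)[OF D(1,2)] * in auto)
  with * show "adj S f y \<in> S" "x \<in> S \<Longrightarrow> inner (f x) y = inner x (adj S f y)"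
    using proj_spec(1)[OF D(1,2)] by auto
qed

lemma adj_cinner:
  assumes S: "closed_csubspace S" and f: "bounded_op S R f" and x: "x \<in> S"
  shows "cinner (f x) y = cinner x (adj S f y)"
proof -
  have "inner (\<i> *\<^sub>C f x) y = inner (\<i> *\<^sub>C x) (adj S f y)"
    using adj_spec(2)[OF S f, of "\<i> *\<^sub>C x"] f x closed_csubspaceD(3)[OF S]
    by (simp add: bounded_op_def csubspace_scaleC)
  then show ?thesis using adj_spec(2)[OF S f x] by (simp add: cinner_eq_inner)
qed

lemma bounded_op_adj:
  assumes S: "closed_csubspace S" and f: "bounded_op S R f"
  shows "bounded_op UNIV S (adj S f)"
proof -
  note D = closed_csubspaceD[OF S]
  note A = adj_spec[OF S f]
  have add: "adj S f (x + y) = adj S f x + adj S f y" for x y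
    by (rule adj_eqI[OF D(3) f]) (auto simp: A D inner_add_right)
  have sc: "adj S f (c *\<^sub>C x) = c *\<^sub>C adj S f x" for c x
  proof (rule adj_eqI[OF D(3) f])
    fix s assume s: "s \<in> S"
    then have "cnj c *\<^sub>C s \<in> S" using D(3) by (simp add: csubspace_scaleC)
    from A(2)[OF this] show "inner (f s) (c *\<^sub>C x) = inner s (c *\<^sub>C adj S f x)"
      using s f by (metis bounded_op_def inner_scaleC_cnj complex_cnj_cnj)
  qed (use A(1) D(3) csubspace_scaleC in blast)
  obtain K where K: "\<And>x. x \<in> S \<Longrightarrow> norm (f x) \<le> K * norm x"
    using f unfolding bounded_op_def by blast
  have "norm (adj S f y) \<le> \<bar>K\<bar> * norm y" for y
  proof -
    let ?z = "adj S f y"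
    have "norm ?z * norm ?z = inner (f ?z) y"
      using A by (simp add: power2_norm_eq_inner[symmetric] power2_eq_square)
    also have "\<dots> \<le> norm (f ?z) * norm y" by (rule norm_cauchy_schwarz)
    also have "\<dots> \<le> (\<bar>K\<bar> * norm ?z) * norm y"
      by (intro mult_right_mono order_trans[OF K[OF A(1)]]) auto
    finally have "norm ?z * norm ?z \<le> norm ?z * (\<bar>K\<bar> * norm y)" by (simp add: mult_ac)
    then show ?thesis
      by (cases "norm ?z = 0") (auto simp: mult_le_cancel_left)
  qed
  then show ?thesis using A add sc by (auto simp: bounded_op_def)
qed

lemma bclin_adj: "closed_csubspace S \<Longrightarrow> bounded_op S R f \<Longrightarrow> bclin (adj S f)"
  unfolding bclin_bounded_op by (drule (1) bounded_op_adj) (simp add: bounded_op_def)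

lemma adj_UNIV:
  assumes "bclin f"
  shows "inner (f x) y = inner x (adj UNIV f y)" "inner y (f x) = inner (adj UNIV f y) x"
    "bclin (adj UNIV f)"
proof -
  have f: "bounded_op UNIV UNIV f" using assms by (simp add: bclin_bounded_op)
  show "inner (f x) y = inner x (adj UNIV f y)" "inner y (f x) = inner (adj UNIV f y) x"
    using adj_spec(2)[OF closed_csubspace_UNIV f, of x y] by (auto simp: inner_commute)
  show "bclin (adj UNIV f)" by (rule bclin_adj[OF closed_csubspace_UNIV f])
qed

lemma adj_UNIV_eqI:
  assumes "bclin f" "\<And>x. inner (f x) y = inner x z"
  shows "adj UNIV f y = z"
  using assms by (intro adj_eqI[where R=UNIV]) (auto simp: bclin_bounded_op csubspace_def)

section \<open>Positive square roots\<close>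

text \<open>
  If \<open>B\<close> is a contraction, then the iterates of \<open>Y \<mapsto> (B + Y\<^sup>2) / 2\<close> from \<open>0\<close> converge to a solution
  of \<open>2 Y = B + Y\<^sup>2\<close>, that is, of \<open>(I - Y)\<^sup>2 = I - B\<close>. The same iteration on the number \<open>1\<close> in place of
  \<open>B\<close> gives a bounded increasing sequence whose increments bound those of the operators.
\<close>

primrec root_iter :: "('a::real_vector \<Rightarrow> 'a) \<Rightarrow> nat \<Rightarrow> 'a \<Rightarrow> 'a" where
  "root_iter B 0 = (\<lambda>x. 0)"
| "root_iter B (Suc n) = (\<lambda>x. (1/2) *\<^sub>R (B x + root_iter B n (root_iter B n x)))"

definition root_lim :: "('a::real_normed_vector \<Rightarrow> 'a) \<Rightarrow> 'a \<Rightarrow> 'a" where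
  "root_lim B x = lim (\<lambda>n. root_iter B n x)"

primrec root_majorant :: "nat \<Rightarrow> real" where
  "root_majorant 0 = 0"
| "root_majorant (Suc n) = (1 + (root_majorant n)\<^sup>2) / 2"

lemma root_majorant_bounds: "0 \<le> root_majorant n" "root_majorant n \<le> 1"
proof (induction n)
  case (Suc n)
  { case 1 show ?case by simp }
  { case 2 show ?case using Suc.IH power_le_one[of "root_majorant n" 2] by simp }
qed simp_all

lemma root_majorant_incseq: "root_majorant n \<le> root_majorant (Suc n)"
proof -
  have "0 \<le> (1 - root_majorant n)\<^sup>2" by simp
  then show ?thesis by (simp add: power2_eq_square algebra_simps)
qed

lemma root_majorant_Cauchy: "Cauchy root_majorant"
proof -
  obtain L where "root_majorant \<longlonglongrightarrow> L"
    by (rule incseq_convergent[of root_majorant 1])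
       (auto intro: incseq_SucI root_majorant_incseq root_majorant_bounds)
  then show ?thesis by (rule LIMSEQ_imp_Cauchy)
qed

text \<open>
  Two uses: with \<open>B = B'\<close> it says that what commutes with \<open>B\<close> commutes with its iterates, and for a row
  contraction it relates the two defect operators.
\<close>

lemma root_iter_intertwining:
  assumes C: "bclin C" and CB: "\<And>x. C (B x) = B' (C x)"
  shows "C (root_iter B n x) = root_iter B' n (C x)"
  by (induction n arbitrary: x) (simp_all add: bclinD[OF C] CB)

context
  fixes B :: "'a::chilbert_space \<Rightarrow> 'a"
  assumes B: "bclin B" and contr: "\<And>x. norm (B x) \<le> norm x"
begin

lemma bclin_root_iter: "bclin (root_iter B n)"
proof (induction n)
  case (Suc n)
  show ?case using Suc B by (auto intro!: bclin_scaleR bclin_add bclin_compose[OF Suc Suc])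
qed simp

lemma norm_root_iter: "norm (root_iter B n x) \<le> root_majorant n * norm x"
proof (induction n arbitrary: x)
  case (Suc n)
  have "norm (root_iter B n (root_iter B n x)) \<le> root_majorant n * (root_majorant n * norm x)"
    by (rule order_trans[OF Suc.IH]) (intro mult_left_mono Suc.IH root_majorant_bounds)
  then have "norm (B x + root_iter B n (root_iter B n x)) \<le> norm x + (root_majorant n)\<^sup>2 * norm x"
    using contr[of x] by (intro norm_triangle_le) (simp add: power2_eq_square mult.assoc)
  then show ?case by (simp add: algebra_simps del: scaleR_add_right)
qed simp

lemma root_iter_commute: "root_iter B m (root_iter B n x) = root_iter B n (root_iter B m x)"
  by (rule root_iter_intertwining[OF bclin_root_iter])
     (rule root_iter_intertwining[OF B, symmetric], rule refl)

lemma root_iter_increment: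
  "norm (root_iter B (Suc n) x - root_iter B n x) \<le> (root_majorant (Suc n) - root_majorant n) * norm x"
proof (induction n arbitrary: x)
  case 0
  show ?case using contr[of x] by simp
next
  case (Suc n)
  let ?Y = "root_iter B n" and ?Z = "root_iter B (Suc n)"
  let ?y = "root_majorant n" and ?z = "root_majorant (Suc n)"
  have "root_iter B (Suc (Suc n)) x - ?Z x = (1/2) *\<^sub>R (?Z (?Z x) - ?Y (?Y x))"
    unfolding root_iter.simps(2)[of B "Suc n"] by (simp only: root_iter.simps(2)[of B n]) (simp add: scaleR_diff_right algebra_simps)
  \<comment> \<open>a difference of squares factors because the iterates commute\<close>
  also have "?Z (?Z x) - ?Y (?Y x) = ?Z (?Z x - ?Y x) + ?Y (?Z x - ?Y x)"
    unfolding bclinD(3)[OF bclin_root_iter] using root_iter_commute[of "Suc n" n x] by (simp del: root_iter.simps)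
  finally have *: "root_iter B (Suc (Suc n)) x - ?Z x = (1/2) *\<^sub>R (?Z (?Z x - ?Y x) + ?Y (?Z x - ?Y x))" .
  have "norm (?Z (?Z x - ?Y x)) \<le> ?z * norm (?Z x - ?Y x)" "norm (?Y (?Z x - ?Y x)) \<le> ?y * norm (?Z x - ?Y x)"
    by (rule norm_root_iter)+
  then have "norm (root_iter B (Suc (Suc n)) x - ?Z x) \<le> (1/2) * ((?z + ?y) * norm (?Z x - ?Y x))"
    unfolding * by (simp add: distrib_right del: root_iter.simps root_majorant.simps) (meson add_mono norm_triangle_le order_trans)
  also have "\<dots> \<le> (1/2) * ((?z + ?y) * ((?z - ?y) * norm x))"
    using root_majorant_bounds Suc.IH by (intro mult_left_mono add_nonneg_nonneg) auto
  also have "\<dots> = (root_majorant (Suc (Suc n)) - ?z) * norm x"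
    unfolding root_majorant.simps(2)[of "Suc n"] by (simp only: root_majorant.simps(2)[of n]) (simp add: power2_eq_square field_simps)
  finally show ?case .
qed

lemma root_iter_tendsto: "(\<lambda>n. root_iter B n x) \<longlonglongrightarrow> root_lim B x"
proof -
  let ?Y = "\<lambda>n. root_iter B n x"
  have diff: "norm (?Y (n + k) - ?Y n) \<le> (root_majorant (n + k) - root_majorant n) * norm x" for n k
  proof (induction k)
    case (Suc k)
    have "norm (?Y (n + Suc k) - ?Y n) \<le> norm (?Y (Suc (n + k)) - ?Y (n + k)) + norm (?Y (n + k) - ?Y n)"
      using norm_triangle_ineq[of "?Y (Suc (n + k)) - ?Y (n + k)" "?Y (n + k) - ?Y n"] by simp
    also have "\<dots> \<le> (root_majorant (Suc (n + k)) - root_majorant (n + k)) * norm x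
        + (root_majorant (n + k) - root_majorant n) * norm x"
      by (intro add_mono root_iter_increment Suc.IH)
    finally show ?case by (simp add: algebra_simps)
  qed simp
  have "Cauchy ?Y"
  proof (rule metric_CauchyI)
    fix e :: real assume "e > 0"
    then have "e / (norm x + 1) > 0" by (simp add: add_nonneg_pos)
    then obtain M where M: "\<And>m n. m \<ge> M \<Longrightarrow> n \<ge> M \<Longrightarrow> dist (root_majorant m) (root_majorant n) < e / (norm x + 1)"
      using root_majorant_Cauchy unfolding Cauchy_def by blast
    have *: "dist (?Y m) (?Y n) < e" if "m \<ge> n" "n \<ge> M" for m n
    proof -
      have "dist (?Y m) (?Y n) \<le> (root_majorant m - root_majorant n) * norm x"
        using diff[of n "m - n"] that by (simp add: dist_norm)
      also have "\<dots> \<le> \<bar>root_majorant m - root_majorant n\<bar> * (norm x + 1)" by (intro mult_mono) auto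
      also have "\<dots> < e"
        using M[of m n] that by (simp add: dist_norm pos_less_divide_eq add_nonneg_pos)
      finally show ?thesis .
    qed
    have "dist (?Y m) (?Y n) < e" if "m \<ge> M" "n \<ge> M" for m n
      using *[of n m] *[of m n] that by (cases "m \<ge> n") (auto simp: dist_commute)
    then show "\<exists>M. \<forall>m\<ge>M. \<forall>n\<ge>M. dist (?Y m) (?Y n) < e" by blast
  qed
  then show ?thesis
    unfolding root_lim_def by (simp add: Cauchy_convergent_iff convergent_LIMSEQ_iff)
qed

lemma norm_root_lim: "norm (root_lim B x) \<le> norm x"
proof (rule LIMSEQ_le_const2[OF tendsto_norm[OF root_iter_tendsto]])
  have "norm (root_iter B n x) \<le> norm x" for n
    using norm_root_iter[of n x] mult_right_mono[OF root_majorant_bounds(2)[of n] norm_ge_zero[of x]] by simp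
  then show "\<exists>N. \<forall>n\<ge>N. norm (root_iter B n x) \<le> norm x" by blast
qed

lemma bclin_root_lim: "bclin (root_lim B)"
proof -
  note I = bclinD[OF bclin_root_iter]
  have "root_lim B (x + y) = root_lim B x + root_lim B y" for x y
    using root_iter_tendsto[of "x + y"] unfolding I
    by (rule LIMSEQ_unique) (intro tendsto_intros root_iter_tendsto)
  moreover have *: "root_lim B (c *\<^sub>C x) = c *\<^sub>C root_lim B x" for c x
    using root_iter_tendsto[of "c *\<^sub>C x"] unfolding I
    by (rule LIMSEQ_unique) (intro bounded_linear.tendsto[OF bounded_linear_scaleC] root_iter_tendsto)
  ultimately show ?thesis
    unfolding bclin_bounded_op by (auto simp: bounded_op_def intro!: exI[of _ 1] norm_root_lim)
qed

lemma root_lim_fixed: "2 *\<^sub>R root_lim B x = B x + root_lim B (root_lim B x)"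
proof -
  let ?Y = "root_iter B" and ?L = "root_lim B"
  have Y1: "norm (?Y n z) \<le> norm z" for n z
    using norm_root_iter[of n z] mult_right_mono[OF root_majorant_bounds(2)[of n] norm_ge_zero[of z]] by simp
  have "(\<lambda>n. ?Y n (?Y n x - ?L x)) \<longlonglongrightarrow> 0"
  proof (rule Lim_null_comparison)
    show "\<forall>\<^sub>F n in sequentially. norm (?Y n (?Y n x - ?L x)) \<le> norm (?Y n x - ?L x)" by (simp add: Y1)
    show "(\<lambda>n. norm (?Y n x - ?L x)) \<longlonglongrightarrow> 0"
      using tendsto_norm_zero[OF LIM_zero[OF root_iter_tendsto]] .
  qed
  then have "(\<lambda>n. ?Y n (?Y n x - ?L x) + ?Y n (?L x)) \<longlonglongrightarrow> 0 + ?L (?L x)"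
    by (intro tendsto_add root_iter_tendsto)
  then have "(\<lambda>n. ?Y n (?Y n x)) \<longlonglongrightarrow> ?L (?L x)" by (simp add: bclinD[OF bclin_root_iter])
  then have "(\<lambda>n. 2 *\<^sub>R ?Y (Suc n) x) \<longlonglongrightarrow> B x + ?L (?L x)"
    by (auto intro!: tendsto_intros)
  moreover have "(\<lambda>n. 2 *\<^sub>R ?Y (Suc n) x) \<longlonglongrightarrow> 2 *\<^sub>R ?L x"
    by (intro tendsto_intros LIMSEQ_Suc[OF root_iter_tendsto])
  ultimately show ?thesis using LIMSEQ_unique by blast
qed

end

lemma root_lim_intertwining:
  assumes "bclin B" "\<And>x. norm (B x) \<le> norm x" "bclin B'" "\<And>x. norm (B' x) \<le> norm x"
    and C: "bclin C" and CB: "\<And>x. C (B x) = B' (C x)"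
  shows "C (root_lim B x) = root_lim B' (C x)"
proof (rule LIMSEQ_unique)
  show "(\<lambda>n. C (root_iter B n x)) \<longlonglongrightarrow> C (root_lim B x)"
    using assms by (intro bclin_tendsto[OF C] root_iter_tendsto) auto
  show "(\<lambda>n. C (root_iter B n x)) \<longlonglongrightarrow> root_lim B' (C x)"
    unfolding root_iter_intertwining[of C B B', OF C CB] using assms by (intro root_iter_tendsto) auto
qed

definition symmetric_op :: "('a::real_inner \<Rightarrow> 'a) \<Rightarrow> bool" where
  "symmetric_op f \<longleftrightarrow> (\<forall>x y. inner (f x) y = inner x (f y))"

lemma cinner_symmetric_op:
  assumes "bclin f" "symmetric_op f"
  shows "cinner (f x) x = complex_of_real (inner (f x) x)"
proof -
  have "inner (\<i> *\<^sub>C f x) x = inner (\<i> *\<^sub>C x) (f x)"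
    using assms by (metis bclinD(7) symmetric_op_def)
  moreover have "inner (\<i> *\<^sub>C f x) x = - inner (\<i> *\<^sub>C x) (f x)"
    using inner_scaleC_cnj[of \<i> "f x" x] by (simp add: scaleC_minus_left inner_commute)
  ultimately show ?thesis by (simp add: cinner_eq_inner complex_eq_iff)
qed

text \<open>Polarization: a complex quadratic form with real values is symmetric.\<close>

lemma symmetric_op_of_positive_op:
  assumes "positive_op UNIV f"
  shows "symmetric_op f"
proof -
  have f: "bclin f" using assms by (simp add: positive_op_def bclin_bounded_op)
  have re: "Im (cinner (f x) x) = 0" for x
    using assms by (auto simp: positive_op_def complex_is_Real_iff)
  have "inner (f x) y = inner (f y) x" for x y
  proof -
    have "Im (cinner (f (\<i> *\<^sub>C x + y)) (\<i> *\<^sub>C x + y)) = 0" by (rule re)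
    then have "Im (\<i> * cinner (f x) y - \<i> * cinner (f y) x) = 0"
      using re[of x] re[of y]
      by (simp add: bclinD[OF f] cinner_add_left cinner_add_right cinner_scaleC_left cinner_scaleC_right)
    then show ?thesis by (simp add: Re_cinner)
  qed
  then show ?thesis by (simp add: symmetric_op_def inner_commute)
qed

text \<open>
  Otherwise the quadratic form would become negative on moving from \<open>y\<close> a little in the direction of
  \<open>- f y\<close>: the term of first order is a multiple of \<open>\<bar>f y\<bar>\<^sup>2\<close>.
\<close>

lemma positive_op_null:
  fixes f :: "'a::real_inner \<Rightarrow> 'a"
  assumes f: "linear f" "symmetric_op f" "\<And>x. 0 \<le> inner (f x) x" and y: "inner (f y) y = 0"
  shows "f y = 0"
proof (rule ccontr)
  assume "f y \<noteq> 0"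
  interpret linear f by fact
  define a b where "a = inner (f y) (f y)" and "b = inner (f (f y)) (f y)"
  have a: "a > 0" using \<open>f y \<noteq> 0\<close> by (simp add: a_def)
  have b: "b \<ge> 0" using f(3) by (simp add: b_def)
  \<comment> \<open>near the minimum of \<open>2 t a + t\<^sup>2 b\<close>; the added \<open>1\<close> covers \<open>b = 0\<close>\<close>
  define t where "t = - a / (b + 1)"
  have "inner (f (y + t *\<^sub>R f y)) (y + t *\<^sub>R f y) = 2 * t * a + t\<^sup>2 * b"
    using f(2) y by (simp add: add scale inner_add_left inner_add_right a_def b_def symmetric_op_def power2_eq_square algebra_simps)
  moreover have "2 * t * a + t\<^sup>2 * b < 0"
  proof -
    have "2 * t * a + t\<^sup>2 * b = - (a\<^sup>2 * (b + 2)) / (b + 1)\<^sup>2"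
      using b by (simp add: t_def divide_simps power2_eq_square) (simp add: algebra_simps)
    then show ?thesis using a b by (simp add: divide_neg_pos mult_pos_pos)
  qed
  ultimately show False using f(3)[of "y + t *\<^sub>R f y"] by linarith
qed

text \<open>
  Existence is the fixed point equation of the iteration. For uniqueness, another positive root \<open>S\<close>
  commutes with \<open>f\<close>, hence with the limit \<open>R\<close> of the iteration, so that \<open>(S + R) (S - R) = S\<^sup>2 - R\<^sup>2 = 0\<close>; by
  positivity both \<open>S\<close> and \<open>R\<close> vanish on the range of \<open>S - R\<close>, and then so does \<open>S - R\<close>.
\<close>

lemma sqrt_op_eq_root_lim:
  fixes f :: "'a::chilbert_space \<Rightarrow> 'a"
  assumes f: "bclin f" "symmetric_op f" and contr: "\<And>x. norm (x - f x) \<le> norm x"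
  shows "sqrt_op f = (\<lambda>x. x - root_lim (\<lambda>x. x - f x) x)"
    and "symmetric_op (sqrt_op f)"
proof -
  define B where "B = (\<lambda>x. x - f x)"
  define R where "R = (\<lambda>x. x - root_lim B x)"
  have B: "bclin B" "\<And>x. norm (B x) \<le> norm x" using f contr by (auto simp: B_def intro: bclin_diff)
  have R: "bclin R" unfolding R_def by (intro bclin_diff bclin_ident bclin_root_lim B)
  have Bsym: "inner (B x) y = inner x (B y)" for x y
    using f by (simp add: B_def symmetric_op_def inner_diff_left inner_diff_right)
  have "inner (root_iter B n x) y = inner x (root_iter B n y)" for n x y
    by (induction n arbitrary: x y) (simp_all add: inner_add_left inner_add_right Bsym)
  note iter_sym = this
  have "inner (root_lim B x) y = inner x (root_lim B y)" for x y
  proof (rule LIMSEQ_unique)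
    show "(\<lambda>n. inner (root_iter B n x) y) \<longlonglongrightarrow> inner (root_lim B x) y"
      by (intro tendsto_intros root_iter_tendsto B)
    show "(\<lambda>n. inner (root_iter B n x) y) \<longlonglongrightarrow> inner x (root_lim B y)"
      unfolding iter_sym by (intro tendsto_intros root_iter_tendsto B)
  qed
  then have Rsym: "symmetric_op R"
    by (simp add: symmetric_op_def R_def inner_diff_left inner_diff_right)
  have "0 \<le> inner (R x) x" for x
  proof -
    have "inner (root_lim B x) x \<le> norm x * norm x"
      by (rule order_trans[OF norm_cauchy_schwarz mult_right_mono[OF norm_root_lim[OF B]]]) simp
    then show ?thesis by (simp add: R_def inner_diff_left power2_norm_eq_inner[symmetric] power2_eq_square)
  qed
  note Rpos = this
  have RR: "R (R x) = f x" for x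
  proof -
    have "f x = x - B x" by (simp add: B_def)
    also have "B x = 2 *\<^sub>R root_lim B x - root_lim B (root_lim B x)"
      using root_lim_fixed[OF B, of x] by simp
    finally show ?thesis by (simp add: R_def bclinD[OF bclin_root_lim[OF B]] scaleR_2)
  qed
  have Rpo: "positive_op UNIV R"
    using R Rsym Rpos by (auto simp: positive_op_def bclin_bounded_op[symmetric] cinner_symmetric_op)
  have "S = R" if S: "positive_op UNIV S \<and> S \<circ> S = f" for S
  proof
    fix x
    have Sl: "bclin S" using S by (simp add: positive_op_def bclin_bounded_op)
    have SS: "S (S x) = f x" for x using S by (metis comp_apply)
    have Ssym: "symmetric_op S" using S symmetric_op_of_positive_op by blast
    have Spos: "0 \<le> inner (S x) x" for x using S by (auto simp: positive_op_def Re_cinner)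
    have SB: "S (B x) = B (S x)" for x by (simp add: B_def bclinD[OF Sl] flip: SS)
    have "S (root_lim B x) = root_lim B (S x)" by (rule root_lim_intertwining[OF B B Sl SB])
    then have com: "S (R x) = R (S x)" by (simp add: R_def bclinD[OF Sl])
    define y where "y = S x - R x"
    have "S y + R y = 0"
      using com by (simp add: y_def bclinD[OF Sl] bclinD[OF R] SS RR)
    then have "inner (S y) y + inner (R y) y = 0" by (simp flip: inner_add_left)
    then have "inner (S y) y = 0" "inner (R y) y = 0" using Spos[of y] Rpos[of y] by linarith+
    then have "S y = 0" "R y = 0"
      using positive_op_null[OF _ Ssym Spos] positive_op_null[OF _ Rsym Rpos] Sl R
      by (auto simp: bclin_def bounded_linear.linear)
    then have "inner y y = 0"
      by (metis Ssym Rsym symmetric_op_def y_def inner_diff_left inner_zero_right diff_self)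
    then show "S x = R x" by (simp add: y_def)
  qed
  then have "sqrt_op f = R"
    unfolding sqrt_op_def using Rpo RR by (intro the_equality) auto
  then show "sqrt_op f = (\<lambda>x. x - root_lim (\<lambda>x. x - f x) x)" "symmetric_op (sqrt_op f)"
    using Rsym by (simp_all add: R_def B_def)
qed

lemma sqrt_op_props:
  fixes f :: "'a::chilbert_space \<Rightarrow> 'a"
  assumes f: "bclin f" "symmetric_op f" and contr: "\<And>x. norm (x - f x) \<le> norm x"
  shows "bclin (sqrt_op f)" "sqrt_op f (sqrt_op f x) = f x"
    "inner (sqrt_op f x) y = inner x (sqrt_op f y)"
    "(norm (sqrt_op f x))\<^sup>2 = inner (f x) x"
proof -
  define B where "B = (\<lambda>x. x - f x)"
  have B: "bclin B" "\<And>x. norm (B x) \<le> norm x" using f contr by (auto simp: B_def intro: bclin_diff)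
  note eq = sqrt_op_eq_root_lim(1)[OF assms, folded B_def]
  show "bclin (sqrt_op f)" unfolding eq by (intro bclin_diff bclin_ident bclin_root_lim B)
  show *: "sqrt_op f (sqrt_op f x) = f x" for x
  proof -
    have "f x = x - B x" by (simp add: B_def)
    also have "B x = 2 *\<^sub>R root_lim B x - root_lim B (root_lim B x)"
      using root_lim_fixed[OF B, of x] by simp
    finally show ?thesis
      unfolding eq by (simp add: bclinD[OF bclin_root_lim[OF B]] scaleR_2)
  qed
  show sym: "inner (sqrt_op f x) y = inner x (sqrt_op f y)" for x y
    using sqrt_op_eq_root_lim(2)[OF assms] by (simp add: symmetric_op_def)
  show "(norm (sqrt_op f x))\<^sup>2 = inner (f x) x"
    by (metis "*" sym inner_commute power2_norm_eq_inner)
qed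

lemma sqrt_op_intertwining:
  assumes "bclin f" "symmetric_op f" "\<And>x. norm (x - f x) \<le> norm x"
    and "bclin g" "symmetric_op g" "\<And>x. norm (x - g x) \<le> norm x"
    and C: "bclin C" "\<And>x. C (f x) = g (C x)"
  shows "C (sqrt_op f x) = sqrt_op g (C x)"
proof -
  have "C (root_lim (\<lambda>x. x - f x) x) = root_lim (\<lambda>x. x - g x) (C x)"
    using assms by (intro root_lim_intertwining bclin_diff bclin_ident) (auto simp: bclinD)
  then show ?thesis
    using assms by (simp add: sqrt_op_eq_root_lim(1) bclinD)
qed

section \<open>Orthonormal expansions\<close>

definition orthonormal :: "'a::chilbert_space set \<Rightarrow> bool" where
  "orthonormal E \<longleftrightarrow> (\<forall>x\<in>E. \<forall>y\<in>E. cinner x y = (if x = y then 1 else 0))"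

text \<open>
  Membership in the span of a finite orthonormal set, in terms of Fourier coefficients.
\<close>

definition expands :: "'a::chilbert_space set \<Rightarrow> 'a \<Rightarrow> bool" where
  "expands E x \<longleftrightarrow> x = (\<Sum>e\<in>E. cinner x e *\<^sub>C e)"

lemma cinner_orthonormal_sum:
  assumes "finite E" "orthonormal E" "e \<in> E"
  shows "cinner (\<Sum>b\<in>E. f b *\<^sub>C b) e = f e"
proof -
  have "cinner (\<Sum>b\<in>E. f b *\<^sub>C b) e = (\<Sum>b\<in>E. if b = e then f b else 0)"
    unfolding cinner_sum_left
    using assms by (intro sum.cong) (auto simp: cinner_scaleC_left orthonormal_def)
  then show ?thesis using assms by simp
qed

lemma expandsI: "finite E \<Longrightarrow> orthonormal E \<Longrightarrow> x = (\<Sum>b\<in>E. f b *\<^sub>C b) \<Longrightarrow> expands E x"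
  unfolding expands_def by (auto simp: cinner_orthonormal_sum intro!: sum.cong)

lemma expands_mono:
  assumes "finite E'" "orthonormal E'" "E \<subseteq> E'" "expands E x"
  shows "expands E' x"
proof (rule expandsI[OF assms(1,2)])
  show "x = (\<Sum>b\<in>E'. (if b \<in> E then cinner x b else 0) *\<^sub>C b)"
    using assms sum.mono_neutral_left[OF assms(1,3), of "\<lambda>b. (if b \<in> E then cinner x b else 0) *\<^sub>C b"]
    by (simp add: expands_def)
qed

text \<open>One Gram-Schmidt step.\<close>

lemma orthonormal_extend:
  assumes E: "finite E" "orthonormal E" and x: "\<not> expands E x"
  shows "\<exists>e. e \<notin> E \<and> orthonormal (insert e E) \<and> expands (insert e E) x"
proof -
  define y where "y = x - (\<Sum>e\<in>E. cinner x e *\<^sub>C e)"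
  have y0: "y \<noteq> 0" using x by (simp add: y_def expands_def)
  have yE: "cinner y b = 0" if "b \<in> E" for b
    using that by (simp add: y_def cinner_diff_left cinner_orthonormal_sum[OF E])
  define e where "e = complex_of_real (inverse (norm y)) *\<^sub>C y"
  have eE: "cinner e b = 0" if "b \<in> E" for b
    using yE[OF that] by (simp add: e_def cinner_scaleC_left)
  have ee: "cinner e e = 1"
    using y0 by (simp add: cinner_self e_def norm_scaleC norm_inverse)
  have notin: "e \<notin> E" using eE ee by force
  have on: "orthonormal (insert e E)"
  proof -
    have "cinner b e = 0" if "b \<in> E" for b using eE[OF that] cinner_commute[of b e] by simp
    then show ?thesis using E(2) eE ee notin by (auto simp: orthonormal_def)
  qed
  have "x = (\<Sum>b\<in>insert e E. (if b = e then complex_of_real (norm y) else cinner x b) *\<^sub>C b)"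
  proof -
    have "(\<Sum>b\<in>E. (if b = e then complex_of_real (norm y) else cinner x b) *\<^sub>C b) = (\<Sum>b\<in>E. cinner x b *\<^sub>C b)"
      using notin by (intro sum.cong) auto
    moreover have "complex_of_real (norm y) *\<^sub>C e = y"
      using y0 by (simp add: e_def scaleC_scaleC)
    ultimately show ?thesis using E notin by (simp add: y_def)
  qed
  then have "expands (insert e E) x" using E on by (intro expandsI) auto
  with notin on show ?thesis by blast
qed

lemma orthonormal_basis_of_finite:
  fixes F :: "'a::chilbert_space set"
  assumes "finite F"
  shows "\<exists>E. finite E \<and> orthonormal E \<and> (\<forall>x\<in>F. expands E x)"
  using assms
proof (induction F)
  case empty
  have "orthonormal ({} :: 'a set)" by (simp add: orthonormal_def)
  then show ?case by (intro exI[of _ "{}"]) auto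
next
  case (insert x F)
  then obtain E where E: "finite E" "orthonormal E" "\<forall>x\<in>F. expands E x" by blast
  show ?case
  proof (cases "expands E x")
    case False
    then obtain e where "orthonormal (insert e E)" "expands (insert e E) x"
      using orthonormal_extend[OF E(1,2)] by blast
    then show ?thesis
      using E expands_mono[of "insert e E" E] by (intro exI[of _ "insert e E"]) auto
  qed (use E in auto)
qed


section \<open>Tensor products of operators\<close>

text \<open>
  The algebraic part of \<^const>\<open>hilbert_tensor\<close>. It is what the codomain of a tensor product of operators has to
  satisfy; in the domain the elementary tensors are dense in addition.
\<close>

definition tensor_map :: "('g::chilbert_space \<Rightarrow> 'h::chilbert_space \<Rightarrow> 'k::chilbert_space) \<Rightarrow> bool" where
  "tensor_map t \<longleftrightarrow>
     (\<forall>g g' h. t (g + g') h = t g h + t g' h) \<and>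
     (\<forall>g h h'. t g (h + h') = t g h + t g h') \<and>
     (\<forall>c g h. t (c *\<^sub>C g) h = c *\<^sub>C t g h \<and> t g (c *\<^sub>C h) = c *\<^sub>C t g h) \<and>
     (\<forall>g g' h h'. cinner (t g h) (t g' h') = cinner g g' * cinner h h')"

lemma hilbert_tensor_alt:
  "hilbert_tensor t \<longleftrightarrow> tensor_map t \<and> closed_cspan {t g h | g h. True} = UNIV"
  by (auto simp: hilbert_tensor_def tensor_map_def)

lemma hilbert_tensorD: "hilbert_tensor t \<Longrightarrow> tensor_map t"
  by (simp add: hilbert_tensor_alt)

lemma norm_tensor:
  assumes "tensor_map t"
  shows "norm (t g h) = norm g * norm h"
proof -
  have "cinner (t g h) (t g h) = cinner g g * cinner h h"
    using assms by (simp add: tensor_map_def)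
  then have "complex_of_real ((norm (t g h))\<^sup>2) = complex_of_real ((norm g * norm h)\<^sup>2)"
    unfolding cinner_self by (simp add: power_mult_distrib)
  then show ?thesis by (simp only: of_real_eq_iff) (simp add: power2_eq_iff_nonneg)
qed

lemma bclin_tensor:
  assumes "tensor_map t"
  shows "bclin (\<lambda>g. t g h)" "bclin (t g)"
proof -
  have "norm (t g h) \<le> norm h * norm g" "norm (t g h) \<le> norm g * norm h" for g h
    by (simp_all add: norm_tensor[OF assms] mult.commute)
  then show "bclin (\<lambda>g. t g h)" "bclin (t g)"
    using assms unfolding bclin_bounded_op bounded_op_def tensor_map_def by blast+
qed

lemma tensor_map_swap: "tensor_map t \<Longrightarrow> tensor_map (\<lambda>h g. t g h)"
  by (auto simp: tensor_map_def)

lemma hilbert_tensor_swap: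
  assumes "hilbert_tensor t"
  shows "hilbert_tensor (\<lambda>h g. t g h)"
proof -
  have "{t g h | h g. True} = {t g h | g h. True}" by blast
  then show ?thesis using assms by (simp add: hilbert_tensor_alt tensor_map_swap)
qed

lemma closed_cspan_minimal: "closed_csubspace R \<Longrightarrow> A \<subseteq> R \<Longrightarrow> closed_cspan A \<subseteq> R"
  unfolding closed_cspan_def closed_csubspace_def
  by (intro closure_minimal hull_minimal) auto

lemma closed_cspan_superset: "A \<subseteq> closed_cspan A"
  unfolding closed_cspan_def by (meson closure_subset hull_subset subset_trans)

lemma subspace_closure:
  fixes S :: "'a::real_normed_vector set"
  assumes S: "subspace S" shows "subspace (closure S)"
  unfolding subspace_def
proof (intro conjI ballI allI)
  show "0 \<in> closure S" using subspace_0[OF S] closure_subset by blast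
next
  fix x y assume "x \<in> closure S" "y \<in> closure S"
  then obtain f g where "\<And>n. f n \<in> S" "f \<longlonglongrightarrow> x" "\<And>n. g n \<in> S" "g \<longlonglongrightarrow> y"
    by (auto simp: closure_sequential)
  then show "x + y \<in> closure S"
    using S by (auto simp: closure_sequential intro!: exI[of _ "\<lambda>n. f n + g n"] tendsto_intros subspace_add)
next
  fix c x assume "x \<in> closure S"
  then obtain f where "\<And>n. f n \<in> S" "f \<longlonglongrightarrow> x" by (auto simp: closure_sequential)
  then show "c *\<^sub>R x \<in> closure S"
    using S by (auto simp: closure_sequential intro!: exI[of _ "\<lambda>n. c *\<^sub>R f n"] tendsto_intros subspace_scale)
qed

lemma csubspace_closure:
  assumes "csubspace S" shows "csubspace (closure S)"
proof (rule csubspaceI)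
  show "subspace (closure S)" using assms by (intro subspace_closure csubspace_subspace)
  fix c x assume "x \<in> closure S"
  then have "c *\<^sub>C x \<in> closure ((\<lambda>x. c *\<^sub>C x) ` S)"
    using closure_bounded_linear_image_subset[OF bounded_linear_scaleC[of c]] by blast
  moreover have "closure ((\<lambda>x. c *\<^sub>C x) ` S) \<subseteq> closure S"
    using assms by (intro closure_mono) (auto simp: csubspace_scaleC)
  ultimately show "c *\<^sub>C x \<in> closure S" by blast
qed

lemma closed_csubspace_closed_cspan: "closed_csubspace (closed_cspan A)"
proof -
  have "csubspace (csubspace hull A)"
    by (rule hull_in) (auto simp: csubspace_def)
  then show ?thesis by (simp add: closed_cspan_def closed_csubspace_def csubspace_closure)
qed

text \<open>
  A scalar can be absorbed into one factor of an elementary tensor, so that results on real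
  spans apply to complex spans of elementary tensors.
\<close>

lemma csubspace_hull_eq_span:
  assumes "\<And>c x. x \<in> A \<Longrightarrow> c *\<^sub>C x \<in> A"
  shows "csubspace hull A = span A"
proof (rule hull_unique)
  show "A \<subseteq> span A" by (rule span_superset)
  show "csubspace (span A)"
  proof (rule csubspaceI[OF subspace_span])
    fix c x assume "x \<in> span A"
    then show "c *\<^sub>C x \<in> span A"
    proof (induction rule: span_induct_alt)
      case (step r x y)
      then show ?case
        by (simp add: scaleC_add_right scaleC_scaleR) (rule span_add[OF span_scale[OF span_base[OF assms]]])
    qed (simp add: span_zero)
  qed
  show "span A \<subseteq> S'" if "A \<subseteq> S'" "csubspace S'" for S'
    using that by (intro span_minimal csubspace_subspace)
qed

lemma closed_csubspace_tensor_space: "closed_csubspace (tensor_space t G D)"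
  unfolding tensor_space_def by (rule closed_csubspace_closed_cspan)

lemma tensor_in_tensor_space: "g \<in> G \<Longrightarrow> d \<in> D \<Longrightarrow> t g d \<in> tensor_space t G D"
  unfolding tensor_space_def using closed_cspan_superset by fastforce

lemma tensor_space_minimal:
  "closed_csubspace R \<Longrightarrow> (\<And>g d. g \<in> G \<Longrightarrow> d \<in> D \<Longrightarrow> t g d \<in> R) \<Longrightarrow> tensor_space t G D \<subseteq> R"
  unfolding tensor_space_def by (rule closed_cspan_minimal) auto

lemma tensor_space_UNIV: "hilbert_tensor t \<Longrightarrow> tensor_space t UNIV UNIV = UNIV"
  by (simp add: tensor_space_def hilbert_tensor_alt)

lemma closed_csubspace_vimage:
  assumes f: "bclin f" and R: "closed_csubspace R"
  shows "closed_csubspace {x. f x \<in> R}"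
proof -
  have "closed (f -` R)"
    using R by (intro closed_vimage bclin_continuous_on f) (simp add: closed_csubspace_def)
  then show ?thesis
    using R by (auto simp: closed_csubspace_def vimage_def csubspace_def bclinD[OF f])
qed

lemma closed_csubspace_zero: "closed_csubspace {0}"
  by (auto simp: closed_csubspace_def csubspace_def)

lemma bclin_eq_on_tensor_space:
  assumes "bclin F" "bclin F'" "\<And>g d. g \<in> G \<Longrightarrow> d \<in> D \<Longrightarrow> F (t g d) = F' (t g d)"
    and "z \<in> tensor_space t G D"
  shows "F z = F' z"
proof -
  have "tensor_space t G D \<subseteq> {x. F x - F' x \<in> {0}}"
    using assms by (intro tensor_space_minimal closed_csubspace_vimage bclin_diff closed_csubspace_zero) auto
  then show ?thesis using assms(4) by auto
qed

lemma bclin_eq_on_tensors: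
  assumes "hilbert_tensor t" "bclin F" "bclin F'" "\<And>g d. F (t g d) = F' (t g d)"
  shows "F = F'"
  using bclin_eq_on_tensor_space[of F F' UNIV UNIV t] assms by (auto simp: tensor_space_UNIV)

lemma tensor_map_vec: "tensor_map t \<Longrightarrow> tensor_map (tensor_vec t :: _ \<Rightarrow> _^'n::finite \<Rightarrow> _)"
  by (simp add: tensor_map_def tensor_vec_def vec_eq_iff cinner_vec_def scaleC_vec_def sum_distrib_left)

text \<open>
  Here the copies are made of the left factor, whereas \<^const>\<open>tensor_vec\<close> makes them of the right factor. Seen
  this way, the row of the operators \<open>X\<^sub>i \<otimes> I\<close> is a single operator \<open>A \<otimes> I\<close>, with \<open>A\<close> the row of the \<open>X\<^sub>i\<close>.
\<close>

definition vec_tensor :: "('g \<Rightarrow> 'h \<Rightarrow> 'k) \<Rightarrow> 'g ^ 'n::finite \<Rightarrow> 'h \<Rightarrow> 'k ^ 'n" where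
  "vec_tensor t x h = (\<chi> i. t (x $ i) h)"

lemma tensor_map_vec_tensor: "tensor_map t \<Longrightarrow> tensor_map (vec_tensor t :: _^'n::finite \<Rightarrow> _ \<Rightarrow> _)"
  by (simp add: tensor_map_def vec_tensor_def vec_eq_iff cinner_vec_def scaleC_vec_def sum_distrib_right)

lemma closed_csubspace_axis_tensors:
  assumes t: "hilbert_tensor t" and R: "closed_csubspace R"
    and ax: "\<And>i g h. axis i (t g h) \<in> R"
  shows "R = (UNIV :: ('k::chilbert_space ^ 'n::finite) set)"
proof -
  have "axis i k \<in> R" for i k
  proof -
    have "tensor_space t UNIV UNIV \<subseteq> {k. axis i k \<in> R}"
      by (intro tensor_space_minimal closed_csubspace_vimage bclin_axis R) (simp add: ax)
    then show ?thesis using t by (auto simp: tensor_space_UNIV)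
  qed
  then have "(\<Sum>i\<in>UNIV. axis i (z $ i)) \<in> R" for z
    using closed_csubspaceD[OF R] by (intro subspace_sum) auto
  then show ?thesis by (auto simp flip: axis_eq_sum)
qed

lemma hilbert_tensor_vec:
  assumes t: "hilbert_tensor t"
  shows "hilbert_tensor (tensor_vec t :: _ \<Rightarrow> _^'n::finite \<Rightarrow> _)"
  unfolding hilbert_tensor_alt
proof
  note tm = hilbert_tensorD[OF t]
  show "tensor_map (tensor_vec t :: _ \<Rightarrow> _^'n \<Rightarrow> _)" by (rule tensor_map_vec[OF tm])
  have "axis i (t g h) = tensor_vec t g (axis i h :: _^'n)" for i g h
    by (simp add: tensor_vec_def vec_eq_iff axis_def bclinD[OF bclin_tensor(2)[OF tm]])
  then have "axis i (t g h) \<in> closed_cspan {tensor_vec t g h | g (h :: _^'n). True}" for i g h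
    by (metis (mono_tags, lifting) closed_cspan_superset mem_Collect_eq subsetD)
  then show "closed_cspan {tensor_vec t g h | g (h :: _^'n). True} = UNIV"
    by (intro closed_csubspace_axis_tensors[OF t] closed_csubspace_closed_cspan)
qed

lemma hilbert_tensor_vec_tensor:
  assumes t: "hilbert_tensor t"
  shows "hilbert_tensor (vec_tensor t :: _^'n::finite \<Rightarrow> _ \<Rightarrow> _)"
  unfolding hilbert_tensor_alt
proof
  note tm = hilbert_tensorD[OF t]
  show "tensor_map (vec_tensor t :: _^'n \<Rightarrow> _ \<Rightarrow> _)" by (rule tensor_map_vec_tensor[OF tm])
  have "axis i (t g h) = vec_tensor t (axis i g :: _^'n) h" for i g h
    by (simp add: vec_tensor_def vec_eq_iff axis_def bclinD[OF bclin_tensor(1)[OF tm]])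
  then have "axis i (t g h) \<in> closed_cspan {vec_tensor t (g :: _^'n) h | g h. True}" for i g h
    by (metis (mono_tags, lifting) closed_cspan_superset mem_Collect_eq subsetD)
  then show "closed_cspan {vec_tensor t (g :: _^'n) h | g h. True} = UNIV"
    by (intro closed_csubspace_axis_tensors[OF t] closed_csubspace_closed_cspan)
qed

lemma norm_sum_orthonormal_tensors:
  assumes u: "tensor_map u" and E: "finite E" "orthonormal E"
  shows "(norm (\<Sum>e\<in>E. u e (v e)))\<^sup>2 = (\<Sum>e\<in>E. (norm (v e))\<^sup>2)"
proof -
  have "cinner (\<Sum>e\<in>E. u e (v e)) (\<Sum>e\<in>E. u e (v e)) = (\<Sum>e\<in>E. \<Sum>e'\<in>E. if e' = e then cinner (v e) (v e') else 0)"
    unfolding cinner_sum_left cinner_sum_right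
    using u E by (intro sum.cong) (auto simp: tensor_map_def orthonormal_def)
  also have "\<dots> = complex_of_real (\<Sum>e\<in>E. (norm (v e))\<^sup>2)"
    using E by (simp add: cinner_self)
  finally show ?thesis unfolding cinner_self of_real_eq_iff .
qed

lemma sum_list_tensors_expand:
  assumes u: "tensor_map u" and B: "bclin B" and E: "finite E"
    and "\<forall>(g, d)\<in>set xs. expands E g"
  shows "(\<Sum>(g, d)\<leftarrow>xs. u g (B d)) = (\<Sum>e\<in>E. u e (B (\<Sum>(g, d)\<leftarrow>xs. cinner g e *\<^sub>C d)))"
  using assms(4)
proof (induction xs)
  case Nil
  show ?case by (simp add: bclinD[OF B] bclinD[OF bclin_tensor(2)[OF u]])
next
  case (Cons p xs)
  obtain g d where p: "p = (g, d)" by (cases p)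
  have g: "g = (\<Sum>e\<in>E. cinner g e *\<^sub>C e)" using Cons.prems by (simp add: p expands_def)
  have "u g (B d) = (\<Sum>e\<in>E. u (cinner g e *\<^sub>C e) (B d))"
    by (subst g) (simp add: bclinD[OF bclin_tensor(1)[OF u]])
  then show ?case
    using Cons by (simp add: p bclinD[OF B] bclinD[OF bclin_tensor(2)[OF u]] bclinD[OF bclin_tensor(1)[OF u]] sum.distrib)
qed

text \<open>
  Along an orthonormal expansion of the left factors the norm of a finite sum of elementary tensors
  is an \<open>l\<^sup>2\<close> sum of norms of vectors in the right factor, on each of which \<open>B\<close> acts separately.
\<close>

lemma norm_sum_list_tensors_le:
  assumes t: "tensor_map t" and u: "tensor_map u" and B: "bclin B"
    and K: "0 \<le> K" "\<And>d. norm (B d) \<le> K * norm d"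
  shows "norm (\<Sum>(g, d)\<leftarrow>xs. u g (B d)) \<le> K * norm (\<Sum>(g, d)\<leftarrow>xs. t g d)"
proof -
  obtain E where E: "finite E" "orthonormal E" "\<forall>g\<in>fst ` set xs. expands E g"
    using orthonormal_basis_of_finite[of "fst ` set xs"] by auto
  then have ex: "\<forall>(g, d)\<in>set xs. expands E g" by force
  let ?v = "\<lambda>e. \<Sum>(g, d)\<leftarrow>xs. cinner g e *\<^sub>C d"
  have "(norm (\<Sum>(g, d)\<leftarrow>xs. u g (B d)))\<^sup>2 = (\<Sum>e\<in>E. (norm (B (?v e)))\<^sup>2)"
    unfolding sum_list_tensors_expand[OF u B E(1) ex] by (rule norm_sum_orthonormal_tensors[OF u E(1,2)])
  also have "\<dots> \<le> (\<Sum>e\<in>E. (K * norm (?v e))\<^sup>2)"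
    using K by (intro sum_mono power_mono) auto
  also have "\<dots> = K\<^sup>2 * (norm (\<Sum>(g, d)\<leftarrow>xs. t g d))\<^sup>2"
    unfolding sum_list_tensors_expand[OF t bclin_ident(1) E(1) ex] norm_sum_orthonormal_tensors[OF t E(1,2)]
    by (simp add: power_mult_distrib sum_distrib_left)
  finally have "(norm (\<Sum>(g, d)\<leftarrow>xs. u g (B d)))\<^sup>2 \<le> (K * norm (\<Sum>(g, d)\<leftarrow>xs. t g d))\<^sup>2"
    by (simp add: power_mult_distrib)
  then show ?thesis using K(1) by (intro power2_le_imp_le[of "norm (\<Sum>(g, d)\<leftarrow>xs. u g (B d))"]) simp_all
qed

text \<open>
  The graph of the extension is the closure of the span of the given pairs.
\<close>

lemma bounded_extension:
  fixes p :: "'i \<Rightarrow> 'k::chilbert_space" and q :: "'i \<Rightarrow> 'l::chilbert_space"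
  assumes bd: "\<And>w. w \<in> span (range (\<lambda>i. (p i, q i))) \<Longrightarrow> norm (snd w) \<le> K * norm (fst w)"
    and sc: "\<And>c i. \<exists>j. p j = c *\<^sub>C p i \<and> q j = c *\<^sub>C q i"
    and dense: "closed_cspan (range p) = UNIV"
  shows "\<exists>F. bclin F \<and> (\<forall>i. F (p i) = q i) \<and> (\<forall>x. norm (F x) \<le> K * norm x)"
proof -
  define \<Gamma> where "\<Gamma> = closure (span (range (\<lambda>i. (p i, q i))))"
  have sub: "subspace \<Gamma>" unfolding \<Gamma>_def by (intro subspace_closure subspace_span)
  have clo: "closed \<Gamma>" by (simp add: \<Gamma>_def)
  have gen: "(p i, q i) \<in> \<Gamma>" for i
    unfolding \<Gamma>_def using closure_subset span_superset by (metis (no_types, lifting) rangeI subsetD)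
  have bound: "norm (snd w) \<le> K * norm (fst w)" if "w \<in> \<Gamma>" for w
  proof -
    have "closed {w :: 'k \<times> 'l. norm (snd w) \<le> K * norm (fst w)}"
      by (intro closed_Collect_le continuous_intros)
    then have "\<Gamma> \<subseteq> {w. norm (snd w) \<le> K * norm (fst w)}"
      unfolding \<Gamma>_def using bd by (intro closure_minimal) auto
    then show ?thesis using that by auto
  qed
  have hull: "csubspace hull (range p) = span (range p)"
  proof (rule csubspace_hull_eq_span)
    show "c *\<^sub>C x \<in> range p" if "x \<in> range p" for c x
      using that sc by (metis rangeE rangeI)
  qed
  have ex0: "\<exists>y. (x, y) \<in> \<Gamma>" if "x \<in> span (range p)" for x
    using that
  proof (induction rule: span_induct_alt)
    case base
    show ?case using subspace_0[OF sub] by (auto simp: zero_prod_def)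
  next
    case (step c x y)
    then obtain i z where "x = p i" "(y, z) \<in> \<Gamma>" by blast
    then have "c *\<^sub>R (p i, q i) + (y, z) \<in> \<Gamma>" using sub gen by (intro subspace_add subspace_scale)
    then show ?case using \<open>x = p i\<close> by auto
  qed
  have diff: "norm (y - y') \<le> K * norm (x - x')" if "(x, y) \<in> \<Gamma>" "(x', y') \<in> \<Gamma>" for x y x' y'
    using bound[OF subspace_diff[OF sub that]] by simp
  have "\<exists>y. (x, y) \<in> \<Gamma>" for x
  proof -
    have "x \<in> closure (span (range p))" using dense by (simp add: closed_cspan_def hull)
    then obtain s where s: "\<And>n. s n \<in> span (range p)" "s \<longlonglongrightarrow> x" by (auto simp: closure_sequential)
    obtain y where y: "(s n, y n) \<in> \<Gamma>" for n using ex0[OF s(1)] by metis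
    have "Cauchy y"
    proof (rule metric_CauchyI)
      fix e :: real assume "e > 0"
      then have "e / (\<bar>K\<bar> + 1) > 0" by simp
      then obtain M where M: "\<And>m n. m \<ge> M \<Longrightarrow> n \<ge> M \<Longrightarrow> dist (s m) (s n) < e / (\<bar>K\<bar> + 1)"
        using LIMSEQ_imp_Cauchy[OF s(2)] unfolding Cauchy_def by blast
      have "dist (y m) (y n) < e" if "m \<ge> M" "n \<ge> M" for m n
      proof -
        have "dist (y m) (y n) \<le> K * dist (s m) (s n)" using diff[OF y y] by (simp add: dist_norm)
        also have "\<dots> \<le> (\<bar>K\<bar> + 1) * dist (s m) (s n)" by (intro mult_right_mono) auto
        also have "\<dots> < e" using M[OF that] by (simp add: pos_less_divide_eq mult.commute)
        finally show ?thesis .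
      qed
      then show "\<exists>M. \<forall>m\<ge>M. \<forall>n\<ge>M. dist (y m) (y n) < e" by blast
    qed
    then obtain l where "y \<longlonglongrightarrow> l" using Cauchy_convergent convergent_def by blast
    then have "(\<lambda>n. (s n, y n)) \<longlonglongrightarrow> (x, l)" using s(2) by (intro tendsto_Pair)
    then show ?thesis using closed_sequentially[OF clo, of "\<lambda>n. (s n, y n)"] y by blast
  qed
  then obtain F where F: "(x, F x) \<in> \<Gamma>" for x by metis
  have uniq: "y = F x" if "(x, y) \<in> \<Gamma>" for x y using diff[OF that F[of x]] by simp
  have FK: "norm (F x) \<le> K * norm x" for x using bound[OF F] by simp
  have Fp: "F (p i) = q i" for i using uniq[OF gen] by simp
  have bl: "bounded_linear F"
  proof (rule bounded_linear_intro[where K=K])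
    show "F (x + y) = F x + F y" for x y
      using subspace_add[OF sub F[of x] F[of y]] uniq[of "x + y" "F x + F y"] by simp
    show "F (r *\<^sub>R x) = r *\<^sub>R F x" for r x
      using subspace_scale[OF sub F[of x], of r] uniq[of "r *\<^sub>R x" "r *\<^sub>R F x"] by simp
    show "norm (F x) \<le> norm x * K" for x using FK by (simp add: mult.commute)
  qed
  have "F (c *\<^sub>C x) = c *\<^sub>C F x" for c x
  proof -
    define L where "L = (\<lambda>x. F (c *\<^sub>C x) - c *\<^sub>C F x)"
    have bls: "bounded_linear L"
      unfolding L_def
      by (intro bounded_linear_sub bounded_linear_compose[OF bl bounded_linear_scaleC]
          bounded_linear_compose[OF bounded_linear_scaleC bl])
    have "closed (L -` {0})"
      by (rule closed_vimage[OF closed_singleton linear_continuous_on[OF bls]])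
    moreover have "subspace (L -` {0})"
      using linear_subspace_vimage[OF bounded_linear.linear[OF bls] subspace_single_0] .
    moreover have "L (p i) = 0" for i
    proof -
      obtain j where "p j = c *\<^sub>C p i" "q j = c *\<^sub>C q i" using sc by blast
      then have "F (c *\<^sub>C p i) = c *\<^sub>C q i" using Fp[of j] by simp
      then show ?thesis by (simp add: L_def Fp)
    qed
    ultimately have "closure (span (range p)) \<subseteq> L -` {0}"
      by (intro closure_minimal span_minimal) auto
    then have "L x = 0" using dense by (auto simp: closed_cspan_def hull)
    then show ?thesis by (simp add: L_def)
  qed
  then show ?thesis using bl FK Fp by (auto simp: bclin_def)
qed

lemma tensor_right_exists:
  assumes t: "hilbert_tensor t" and u: "tensor_map u" and B: "bclin B"
    and K: "0 \<le> K" "\<And>d. norm (B d) \<le> K * norm d"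
  shows "\<exists>F. bclin F \<and> (\<forall>g d. F (t g d) = u g (B d)) \<and> (\<forall>x. norm (F x) \<le> K * norm x)"
proof -
  note tm = hilbert_tensorD[OF t]
  define p q where "p = (\<lambda>(g, d). t g d)" and "q = (\<lambda>(g, d). u g (B d))"
  have "\<exists>xs. w = (\<Sum>(g, d)\<leftarrow>xs. (t g d, u g (B d)))" if "w \<in> span (range (\<lambda>i. (p i, q i)))" for w
    using that
  proof (induction rule: span_induct_alt)
    case base
    show ?case by (intro exI[of _ "[]"]) simp
  next
    case (step c x y)
    then obtain g d xs where *: "x = (t g d, u g (B d))" "y = (\<Sum>(g, d)\<leftarrow>xs. (t g d, u g (B d)))"
      by (auto simp: p_def q_def)
    show ?case
      by (intro exI[of _ "(c *\<^sub>R g, d) # xs"])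
         (simp add: * bclinD[OF bclin_tensor(1)[OF tm]] bclinD[OF bclin_tensor(1)[OF u]])
  qed
  moreover have "fst (\<Sum>(g, d)\<leftarrow>xs. (t g d, u g (B d))) = (\<Sum>(g, d)\<leftarrow>xs. t g d)"
    "snd (\<Sum>(g, d)\<leftarrow>xs. (t g d, u g (B d))) = (\<Sum>(g, d)\<leftarrow>xs. u g (B d))" for xs
    by (induction xs) auto
  ultimately have "norm (snd w) \<le> K * norm (fst w)" if "w \<in> span (range (\<lambda>i. (p i, q i)))" for w
    using norm_sum_list_tensors_le[OF tm u B K] that by fastforce
  moreover have "\<exists>j. p j = c *\<^sub>C p i \<and> q j = c *\<^sub>C q i" for c i
    by (cases i) (auto simp: p_def q_def bclinD[OF bclin_tensor(1)[OF tm]] bclinD[OF bclin_tensor(1)[OF u]]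
        intro!: exI[of _ "c *\<^sub>C fst i"] exI[of _ "snd i"])
  moreover have "range p = {t g h | g h. True}" by (auto simp: p_def image_def)
  ultimately obtain F where "bclin F" "\<forall>i. F (p i) = q i" "\<forall>x. norm (F x) \<le> K * norm x"
    using bounded_extension[of p q K] t by (auto simp: hilbert_tensor_alt)
  then show ?thesis by (auto simp: p_def q_def)
qed

lemma tensor_left_exists:
  assumes t: "hilbert_tensor t" and u: "tensor_map u" and A: "bclin A"
    and K: "0 \<le> K" "\<And>d. norm (A d) \<le> K * norm d"
  shows "\<exists>F. bclin F \<and> (\<forall>g d. F (t g d) = u (A g) d) \<and> (\<forall>x. norm (F x) \<le> K * norm x)"
  using tensor_right_exists[OF hilbert_tensor_swap[OF t] tensor_map_swap[OF u] A K] by blast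

lemma bclin_bound: "bclin A \<Longrightarrow> \<exists>K\<ge>0. \<forall>x. norm (A x) \<le> K * norm x"
  using bounded_linear.nonneg_bounded[OF bclinD(1)] by (metis mult.commute)

text \<open>
  Acting on one factor at a time, as \<open>(A \<otimes> I) (I \<otimes> B)\<close>.
\<close>

lemma tensor_exists:
  fixes t :: "'g::chilbert_space \<Rightarrow> 'a::chilbert_space \<Rightarrow> 'k::chilbert_space"
    and u :: "'g \<Rightarrow> 'b::chilbert_space \<Rightarrow> 'l::chilbert_space"
  assumes t: "hilbert_tensor t" and u: "hilbert_tensor u" and A: "bclin A" and B: "bclin B"
  shows "\<exists>F. bclin F \<and> (\<forall>g d. F (t g d) = u (A g) (B d))"
proof -
  obtain K where K: "K \<ge> 0" "\<And>x. norm (A x) \<le> K * norm x" using bclin_bound[OF A] by blast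
  obtain L where L: "L \<ge> 0" "\<And>x. norm (B x) \<le> L * norm x" using bclin_bound[OF B] by blast
  obtain F where F: "bclin F" "\<And>g d. F (t g d) = u g (B d)"
    using tensor_right_exists[OF t hilbert_tensorD[OF u] B L] by blast
  obtain F' where F': "bclin F'" "\<And>g d. F' (u g d) = u (A g) d"
    using tensor_left_exists[OF u hilbert_tensorD[OF u] A K] by blast
  show ?thesis by (intro exI[of _ "\<lambda>x. F' (F x)"]) (auto simp: F F' bclin_compose)
qed

text \<open>
  The operator \<open>A \<otimes> B\<close> of which \<^const>\<open>tensor_op\<close> is a restriction when \<open>A\<close> and \<open>B\<close> are restrictions.
\<close>

definition gtensor ::
  "('g::chilbert_space \<Rightarrow> 'a::chilbert_space \<Rightarrow> 'k::chilbert_space) \<Rightarrow>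
   ('g \<Rightarrow> 'b::chilbert_space \<Rightarrow> 'l::chilbert_space) \<Rightarrow> ('g \<Rightarrow> 'g) \<Rightarrow> ('a \<Rightarrow> 'b) \<Rightarrow> 'k \<Rightarrow> 'l" where
  "gtensor t u A B = (SOME F. bclin F \<and> (\<forall>g d. F (t g d) = u (A g) (B d)))"

lemma gtensor_spec:
  assumes "hilbert_tensor t" "hilbert_tensor u" "bclin A" "bclin B"
  shows "bclin (gtensor t u A B)" "gtensor t u A B (t g d) = u (A g) (B d)"
  using someI_ex[OF tensor_exists[OF assms]] by (auto simp: gtensor_def)

lemma tensor_op_eq_gtensor:
  assumes t: "hilbert_tensor t" and u: "hilbert_tensor u"
    and A': "bclin A'" "\<And>g. g \<in> G \<Longrightarrow> A' g = A g" and B': "bclin B'" "\<And>d. d \<in> D \<Longrightarrow> B' d = B d"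
    and z: "z \<in> tensor_space t G D"
  shows "tensor_op t u G D A B z = gtensor t u A' B' z"
proof -
  let ?S = "tensor_space t G D" and ?F = "tensor_op t u G D A B"
  note S = closed_csubspace_tensor_space[of t G D]
  note g = gtensor_spec[OF t u A'(1) B'(1)]
  have "bounded_op ?S UNIV (gtensor t u A' B')"
    using g(1) unfolding bclin_bounded_op by (auto simp: bounded_op_def)
  then have "\<exists>F. bounded_op ?S UNIV F \<and> (\<forall>g\<in>G. \<forall>d\<in>D. F (t g d) = u (A g) (B d))"
    using g(2) A' B' by (intro exI[of _ "gtensor t u A' B'"]) simp
  from someI_ex[OF this] have F: "bounded_op ?S UNIV ?F" "\<forall>g\<in>G. \<forall>d\<in>D. ?F (t g d) = u (A g) (B d)"
    by (simp_all add: tensor_op_def)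
  have pr: "proj ?S y = y" if "y \<in> ?S" for y using that closed_csubspaceD[OF S] by (intro proj_id)
  have "?F (proj ?S z) = gtensor t u A' B' z"
    by (rule bclin_eq_on_tensor_space[OF bclin_extend[OF S F(1)] g(1) _ z])
       (simp add: F(2) g(2) A' B' pr tensor_in_tensor_space)
  then show ?thesis using pr[OF z] by simp
qed

section \<open>Row contractions and their defect operators\<close>

lemma word_op_Nil [simp]: "word_op X [] = id"
  by (simp add: word_op_def)

lemma word_op_Cons [simp]: "word_op X (i # \<alpha>) h = X i (word_op X \<alpha> h)"
  by (simp add: word_op_def)

lemma word_op_append: "word_op X (\<alpha> @ \<beta>) h = word_op X \<alpha> (word_op X \<beta> h)"
  by (induction \<alpha>) auto

lemma bclin_word_op: "(\<And>i. bclin (X i)) \<Longrightarrow> bclin (word_op X \<alpha>)"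
proof (induction \<alpha>)
  case (Cons i \<alpha>)
  have "bclin (\<lambda>h. X i (word_op X \<alpha> h))" by (rule bclin_compose[OF Cons.prems Cons.IH[OF Cons.prems]])
  moreover have "word_op X (i # \<alpha>) = (\<lambda>h. X i (word_op X \<alpha> h))" by (rule ext) simp
  ultimately show ?case by simp
qed simp

lemma finite_words [simp]: "finite {\<alpha> :: 'n::finite list. length \<alpha> = k}"
  using finite_lists_length_eq[of "UNIV :: 'n set" k] by simp

lemma sum_words_Suc:
  "(\<Sum>\<alpha> | length (\<alpha> :: 'n::finite list) = Suc k. f \<alpha>) = (\<Sum>i\<in>UNIV. \<Sum>\<beta> | length \<beta> = k. f (i # \<beta>))"
proof -
  have "(\<Sum>\<alpha> | length \<alpha> = Suc k. f \<alpha>) = (\<Sum>(i, \<beta>)\<in>UNIV \<times> {\<beta>. length \<beta> = k}. f (i # \<beta>))"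
    by (rule sum.reindex_bij_witness[of _ "\<lambda>(i, \<beta>). i # \<beta>" "\<lambda>\<alpha>. (hd \<alpha>, tl \<alpha>)"])
       (auto simp: length_Suc_conv)
  then show ?thesis by (simp add: sum.cartesian_product)
qed

lemma sum_words_Suc_snoc:
  "(\<Sum>\<alpha> | length (\<alpha> :: 'n::finite list) = Suc k. f \<alpha>) = (\<Sum>j\<in>UNIV. \<Sum>\<beta> | length \<beta> = k. f (\<beta> @ [j]))"
proof -
  have "(\<Sum>\<alpha> | length \<alpha> = Suc k. f \<alpha>) = (\<Sum>(j, \<beta>)\<in>UNIV \<times> {\<beta>. length \<beta> = k}. f (\<beta> @ [j]))"
    by (rule sum.reindex_bij_witness[of _ "\<lambda>(j, \<beta>). \<beta> @ [j]" "\<lambda>\<alpha>. (last \<alpha>, butlast \<alpha>)"])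
       (auto simp: length_Suc_conv_rev)
  then show ?thesis by (simp add: sum.cartesian_product)
qed

lemma norm_vec_squared: "(norm (x :: 'a::real_inner ^ 'n::finite))\<^sup>2 = (\<Sum>i\<in>UNIV. (norm (x $ i))\<^sup>2)"
  by (simp add: power2_norm_eq_inner inner_vec_def)

lemma inner_row_defect:
  assumes S: "closed_csubspace S" and X: "\<And>i. bounded_op S S (X i)"
  shows "inner (\<Sum>i\<in>UNIV. X i (adj S (X i) h)) h = (\<Sum>i\<in>(UNIV::'n::finite set). (norm (adj S (X i) h))\<^sup>2)"
  unfolding inner_sum_left
  using adj_spec[OF S X] by (intro sum.cong) (auto simp: power2_norm_eq_inner)

text \<open>
  In the square of the norm of \<open>y = \<Sum> X\<^sub>i x\<^sub>i\<close> the operators can be moved to the other factor \<open>y\<close>, where the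
  hypothesis bounds the column of adjoints.
\<close>

lemma norm_row_le:
  fixes X :: "'n::finite \<Rightarrow> 'a::chilbert_space \<Rightarrow> 'a"
  assumes S: "closed_csubspace S" and X: "\<And>i. bounded_op S S (X i)"
    and c: "0 \<le> c" "\<And>h. h \<in> S \<Longrightarrow> (\<Sum>i\<in>UNIV. (norm (adj S (X i) h))\<^sup>2) \<le> c\<^sup>2 * (norm h)\<^sup>2"
    and x: "\<And>i. x $ i \<in> S"
  shows "norm (\<Sum>i\<in>UNIV. X i (x $ i)) \<le> c * norm x"
proof -
  let ?y = "\<Sum>i\<in>UNIV. X i (x $ i)"
  let ?z = "(\<chi> i. adj S (X i) ?y) :: 'a ^ 'n"
  have y: "?y \<in> S"
    using X x closed_csubspaceD(1)[OF S] by (intro subspace_sum) (auto simp: bounded_op_def)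
  have "norm ?z \<le> c * norm ?y"
  proof (rule power2_le_imp_le)
    show "(norm ?z)\<^sup>2 \<le> (c * norm ?y)\<^sup>2"
      using c(2)[OF y] by (simp add: norm_vec_squared power_mult_distrib)
  qed (use c in simp)
  then have *: "norm x * norm ?z \<le> norm x * (c * norm ?y)" by (intro mult_left_mono) auto
  have "norm ?y * norm ?y = inner ?y ?y" by (simp add: power2_norm_eq_inner[symmetric] power2_eq_square)
  also have "\<dots> = (\<Sum>i\<in>UNIV. inner (X i (x $ i)) ?y)" by (simp add: inner_sum_left)
  also have "\<dots> = inner x ?z"
    using adj_spec(2)[OF S X x] by (simp add: inner_vec_def)
  also have "\<dots> \<le> norm x * norm ?z" by (rule norm_cauchy_schwarz)
  finally have "norm ?y * norm ?y \<le> norm ?y * (c * norm x)" using * by (simp add: mult_ac)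
  then show ?thesis
    using c(1) by (cases "norm ?y = 0") (auto simp: mult_le_cancel_left)
qed

lemma bounded_op_cong:
  assumes f: "bclin f" and S: "csubspace S"
    and eq: "\<And>x. x \<in> S \<Longrightarrow> f x = f' x" and R: "\<And>x. x \<in> S \<Longrightarrow> f' x \<in> R"
  shows "bounded_op S R f'"
proof -
  obtain K where "\<And>x. norm (f x) \<le> K * norm x" using bclin_bound[OF f] by blast
  then have "\<exists>K. \<forall>x\<in>S. norm (f' x) \<le> K * norm x" using eq by (intro exI[of _ K]) (simp flip: eq)
  moreover have "f' (x + y) = f' x + f' y" if "x \<in> S" "y \<in> S" for x y
    using that S by (simp add: csubspace_def bclinD(2)[OF f] flip: eq)
  moreover have "f' (c *\<^sub>C x) = c *\<^sub>C f' x" if "x \<in> S" for c x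
    using that S by (simp add: csubspace_def bclinD(7)[OF f] flip: eq)
  ultimately show ?thesis using R by (simp add: bounded_op_def)
qed

lemma row_contractionI:
  fixes X :: "'n::finite \<Rightarrow> 'a::chilbert_space \<Rightarrow> 'a"
  assumes S: "closed_csubspace S" and X: "\<And>i. bounded_op S S (X i)"
    and le: "\<And>h. h \<in> S \<Longrightarrow> (\<Sum>i\<in>UNIV. (norm (adj S (X i) h))\<^sup>2) \<le> (norm h)\<^sup>2"
  shows "row_contraction S X"
proof -
  note D = closed_csubspaceD[OF S]
  have adjS: "adj S (X i) h \<in> S" for i h by (rule adj_spec(1)[OF S X])
  have "bclin (\<lambda>h. proj S h - (\<Sum>i\<in>UNIV. X i (proj S (adj S (X i) h))))"
    by (intro bclin_diff bclin_proj S bclin_sum bclin_compose[OF bclin_extend[OF S X]] bclin_adj[OF S X])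
  moreover note D(3)
  moreover have "proj S h - (\<Sum>i\<in>UNIV. X i (proj S (adj S (X i) h))) = h - (\<Sum>i\<in>UNIV. X i (adj S (X i) h))"
    if "h \<in> S" for h using that adjS by (simp add: proj_id[OF D(1,2)])
  moreover have "h - (\<Sum>i\<in>UNIV. X i (adj S (X i) h)) \<in> S" if "h \<in> S" for h
    using that adjS X D(1) by (intro subspace_diff subspace_sum) (auto simp: bounded_op_def)
  ultimately have b: "bounded_op S S (\<lambda>h. h - (\<Sum>i\<in>UNIV. X i (adj S (X i) h)))"
    by (rule bounded_op_cong)
  have "cinner (h - (\<Sum>i\<in>UNIV. X i (adj S (X i) h))) h
      = complex_of_real ((norm h)\<^sup>2 - (\<Sum>i\<in>UNIV. (norm (adj S (X i) h))\<^sup>2))" if "h \<in> S" for h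
    using adj_cinner[OF S X adjS] by (simp add: cinner_diff_left cinner_sum_left cinner_self)
  with b show ?thesis
    using X le unfolding row_contraction_def positive_op_def by simp
qed

lemma row_contractionD:
  assumes S: "closed_csubspace S" and X: "row_contraction S X" and h: "h \<in> S"
  shows "(\<Sum>i\<in>UNIV. (norm (adj S (X i) h))\<^sup>2) \<le> (norm h)\<^sup>2"
proof -
  have b: "bounded_op S S (X i)" for i using X by (simp add: row_contraction_def)
  have "0 \<le> inner (h - (\<Sum>i\<in>UNIV. X i (adj S (X i) h))) h"
    using X h by (simp add: row_contraction_def positive_op_def Re_cinner)
  then show ?thesis
    by (simp add: inner_diff_left inner_row_defect[OF S b] power2_norm_eq_inner)
qed

locale row_contraction_tuple =
  fixes T :: "'n::finite \<Rightarrow> 'h::chilbert_space \<Rightarrow> 'h"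
  assumes row_contraction: "row_contraction UNIV T"
begin

abbreviation Ts where "Ts i \<equiv> adj UNIV (T i)"
abbreviation \<Delta> where "\<Delta> \<equiv> defect_op T"
abbreviation \<Delta>s where "\<Delta>s \<equiv> defect_op_star T"

lemma bounded_T: "bounded_op UNIV UNIV (T i)"
  using row_contraction by (simp add: row_contraction_def)

lemma bclin_T: "bclin (T i)"
  using bounded_T by (simp add: bclin_bounded_op)

lemmas inner_T = adj_UNIV(1)[OF bclin_T]
lemmas inner_T' = adj_UNIV(2)[OF bclin_T]
lemmas bclin_Ts = adj_UNIV(3)[OF bclin_T]

lemma bclin_row: "bclin (row_op T)"
  by (intro bclin_row_op bclin_T)

lemma sum_norm_Ts_le: "(\<Sum>i\<in>UNIV. (norm (Ts i h))\<^sup>2) \<le> (norm h)\<^sup>2"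
  by (rule row_contractionD[OF closed_csubspace_UNIV row_contraction UNIV_I])

lemma norm_row_T_le: "norm (row_op T x) \<le> norm x"
  using norm_row_le[OF closed_csubspace_UNIV bounded_T, where c=1 and x=x] sum_norm_Ts_le by (simp add: row_op_def)

lemma norm_column_le: "norm ((\<chi> i. Ts i h) :: 'h ^ 'n) \<le> norm h"
  by (rule power2_le_imp_le) (simp_all add: norm_vec_squared sum_norm_Ts_le)

lemma adj_row: "adj UNIV (row_op T) h = (\<chi> i. Ts i h)"
  by (rule adj_UNIV_eqI[OF bclin_row]) (simp add: row_op_def inner_sum_left inner_vec_def inner_T)

lemma bclin_column: "bclin (\<lambda>h. (\<chi> i. Ts i h) :: 'h ^ 'n)"
  by (intro bclin_vec_lambda bclin_Ts)

lemma defect_argument: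
  "bclin (\<lambda>h. h - (\<Sum>i\<in>UNIV. T i (Ts i h)))"
  "symmetric_op (\<lambda>h. h - (\<Sum>i\<in>UNIV. T i (Ts i h)))"
  "norm (h - (h - (\<Sum>i\<in>UNIV. T i (Ts i h)))) \<le> norm h"
proof -
  show "bclin (\<lambda>h. h - (\<Sum>i\<in>UNIV. T i (Ts i h)))"
    by (intro bclin_diff bclin_ident bclin_sum bclin_compose[OF bclin_T bclin_Ts])
  show "symmetric_op (\<lambda>h. h - (\<Sum>i\<in>UNIV. T i (Ts i h)))"
    by (simp add: symmetric_op_def inner_diff_left inner_diff_right inner_sum_left inner_sum_right inner_T inner_T')
  have "norm (row_op T (\<chi> i. Ts i h)) \<le> norm h"
    using norm_row_T_le norm_column_le order_trans by blast
  then show "norm (h - (h - (\<Sum>i\<in>UNIV. T i (Ts i h)))) \<le> norm h" by (simp add: row_op_def)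
qed

lemma defect_star_argument:
  "bclin (\<lambda>x. x - adj UNIV (row_op T) (row_op T x))"
  "symmetric_op (\<lambda>x. x - adj UNIV (row_op T) (row_op T x))"
  "norm (x - (x - adj UNIV (row_op T) (row_op T x))) \<le> norm x"
proof -
  show "bclin (\<lambda>x. x - adj UNIV (row_op T) (row_op T x))"
    unfolding adj_row by (intro bclin_diff bclin_ident bclin_compose[OF bclin_column bclin_row])
  show "symmetric_op (\<lambda>x. x - adj UNIV (row_op T) (row_op T x))"
    by (simp add: symmetric_op_def inner_diff_left inner_diff_right adj_UNIV(1,2)[OF bclin_row, symmetric] inner_commute)
  show "norm (x - (x - adj UNIV (row_op T) (row_op T x))) \<le> norm x"
    unfolding adj_row using norm_row_T_le norm_column_le order_trans by simp blast
qed

lemma bclin_\<Delta>: "bclin \<Delta>"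
  unfolding defect_op_def by (rule sqrt_op_props(1)[OF defect_argument])

lemma \<Delta>_\<Delta>: "\<Delta> (\<Delta> h) = h - (\<Sum>i\<in>UNIV. T i (Ts i h))"
  unfolding defect_op_def by (rule sqrt_op_props(2)[OF defect_argument])

lemma norm_\<Delta>: "(norm (\<Delta> h))\<^sup>2 = (norm h)\<^sup>2 - (\<Sum>i\<in>UNIV. (norm (Ts i h))\<^sup>2)"
  unfolding defect_op_def sqrt_op_props(4)[OF defect_argument] inner_diff_left
    inner_row_defect[OF closed_csubspace_UNIV bounded_T]
  by (simp add: power2_norm_eq_inner)

lemma bclin_\<Delta>s: "bclin \<Delta>s"
  unfolding defect_op_star_def by (rule sqrt_op_props(1)[OF defect_star_argument])

lemma \<Delta>s_\<Delta>s: "\<Delta>s (\<Delta>s x) = x - (\<chi> i. Ts i (row_op T x))"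
  unfolding defect_op_star_def sqrt_op_props(2)[OF defect_star_argument] unfolding adj_row ..

lemma inner_\<Delta>s: "inner (\<Delta>s x) y = inner x (\<Delta>s y)"
  unfolding defect_op_star_def by (rule sqrt_op_props(3)[OF defect_star_argument])

lemma norm_\<Delta>s: "(norm (\<Delta>s x))\<^sup>2 = (norm x)\<^sup>2 - (norm (row_op T x))\<^sup>2"
  unfolding defect_op_star_def sqrt_op_props(4)[OF defect_star_argument] inner_diff_left
    adj_UNIV(2)[OF bclin_row, symmetric]
  by (simp add: power2_norm_eq_inner)

lemma row_\<Delta>s: "row_op T (\<Delta>s x) = \<Delta> (row_op T x)"
  unfolding defect_op_def defect_op_star_def
  by (rule sqrt_op_intertwining[OF defect_star_argument defect_argument bclin_row])
     (simp add: bclinD[OF bclin_row] adj_row, simp add: row_op_def)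

lemma closed_csubspace_closure_range: "bclin f \<Longrightarrow> closed_csubspace (closure (range f))"
  unfolding closed_csubspace_def
  by (intro conjI csubspace_closure closed_closure)
     (auto simp: csubspace_def image_iff; metis bclinD(2,4,7))

lemma closed_csubspace_defect_space_star: "closed_csubspace (defect_space_star T)"
  unfolding defect_space_star_def by (intro closed_csubspace_closure_range bclin_\<Delta>s)

text \<open>
  By \<open>T \<Delta>\<^bsub>T*\<^esub> = \<Delta>\<^sub>T T\<close>. This makes the constant coefficient an operator between the defect spaces.
\<close>

lemma row_maps_defect_space: "x \<in> defect_space_star T \<Longrightarrow> row_op T x \<in> defect_space T"
proof -
  assume "x \<in> defect_space_star T"
  then have "row_op T x \<in> closure (row_op T ` range \<Delta>s)"
    using closure_bounded_linear_image_subset[OF bclinD(1)[OF bclin_row], of "range \<Delta>s"]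
    by (auto simp: defect_space_star_def)
  moreover have "closure (row_op T ` range \<Delta>s) \<subseteq> closure (range \<Delta>)"
    by (intro closure_mono) (auto simp: row_\<Delta>s)
  ultimately show ?thesis by (auto simp: defect_space_def)
qed

end


section \<open>The coefficients of the characteristic function\<close>

text \<open>
  The resolvent in the characteristic function is the geometric series of \<open>\<Sum> X\<^sub>i \<otimes> T\<^sub>i\<^sup>*\<close>. Its part of degree \<open>k\<close> is
  the sum over the words \<open>\<beta>\<close> of length \<open>k\<close> of \<open>X\<^sub>\<beta>\<close> tensored with the product of the \<open>T\<^sub>i\<^sup>*\<close> along \<open>\<beta>\<close>, and the row
  \<open>X\<^sub>j \<otimes> I\<close> that follows appends a letter \<open>j\<close>. The coefficient of \<open>\<beta> j\<close> is therefore \<open>\<Delta>\<^sub>T\<close> times that product times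
  the \<open>j\<close>-th component of \<open>\<Delta>\<^bsub>T*\<^esub>\<close>.
\<close>

definition char_coeff :: "('n::finite \<Rightarrow> 'h::chilbert_space \<Rightarrow> 'h) \<Rightarrow> 'n list \<Rightarrow> 'h ^ 'n \<Rightarrow> 'h" where
  "char_coeff T \<alpha> x = (if \<alpha> = [] then - row_op T x
     else defect_op T (word_op (\<lambda>i. adj UNIV (T i)) (butlast \<alpha>) (defect_op_star T x $ last \<alpha>)))"

lemma (in row_contraction_tuple) bclin_char_coeff: "bclin (char_coeff T \<alpha>)"
proof (cases "\<alpha> = []")
  case True
  then have "char_coeff T \<alpha> = (\<lambda>x. - row_op T x)" by (simp add: char_coeff_def[abs_def])
  then show ?thesis by (simp add: bclin_minus bclin_row)
next
  case False
  then have "char_coeff T \<alpha> = (\<lambda>x. \<Delta> (word_op Ts (butlast \<alpha>) (\<Delta>s x $ last \<alpha>)))"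
    by (simp add: char_coeff_def[abs_def])
  then show ?thesis
    by (simp, intro bclin_compose[OF bclin_\<Delta>] bclin_compose[OF bclin_word_op]
        bclin_compose[OF bclin_vec_nth] bclin_\<Delta>s bclin_Ts)
qed

text \<open>
  A supremum of an unbounded set of reals is an arbitrary number, whence the bound \<open>c\<close> in all three parts.
\<close>

lemma op_norm_bounds:
  assumes S: "0 \<in> S" and b: "\<And>x. x \<in> S \<Longrightarrow> norm (f x) \<le> c * norm x" and c: "0 \<le> c"
  shows "0 \<le> op_norm S f" "op_norm S f \<le> c" "x \<in> S \<Longrightarrow> norm (f x) \<le> op_norm S f * norm x"
proof -
  have le: "norm (f x) / norm x \<le> c" if "x \<in> S" for x
    using b[OF that] c by (cases "x = 0") (auto simp: divide_le_eq)
  have bdd: "bdd_above ((\<lambda>x. norm (f x) / norm x) ` S)" using le by (intro bdd_aboveI2)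
  have ge: "norm (f x) / norm x \<le> op_norm S f" if "x \<in> S" for x
    unfolding op_norm_def by (rule cSUP_upper[OF that bdd])
  show "0 \<le> op_norm S f" using ge[OF S] by simp
  show "op_norm S f \<le> c" unfolding op_norm_def using S le by (intro cSUP_least) auto
  show "norm (f x) \<le> op_norm S f * norm x" if "x \<in> S"
    using ge[OF that] b[OF that] by (cases "x = 0") (auto simp: divide_le_eq)
qed

locale char_fun_at = row_contraction_tuple T
  for T :: "'n::finite \<Rightarrow> 'h::chilbert_space \<Rightarrow> 'h" +
  fixes t :: "'g::chilbert_space \<Rightarrow> 'h \<Rightarrow> 'k::chilbert_space"
    and G :: "'g set" and X :: "'n \<Rightarrow> 'g \<Rightarrow> 'g"
  assumes t: "hilbert_tensor t" and G: "closed_csubspace G" and X: "strict_row_contraction G X"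
begin

abbreviation D where "D \<equiv> defect_space_star T"
abbreviation S where "S \<equiv> tensor_space t G UNIV"

text \<open>
  The ingredients of the characteristic function as operators on whole spaces: \<open>Q\<close> is \<open>\<Sum> X\<^sub>i \<otimes> T\<^sub>i\<^sup>*\<close>, \<open>R\<close> is the
  row of the \<open>X\<^sub>i \<otimes> I\<close>, \<open>E\<close> is \<open>I \<otimes> \<Delta>\<^bsub>T*\<^esub>\<close>, \<open>F\<close> is \<open>I \<otimes> \<Delta>\<^sub>T\<close> and \<open>J\<close> is \<open>I \<otimes> T\<close>. The tuple \<open>X\<close> is extended
  by zero on the orthogonal complement of \<open>G\<close>.
\<close>

definition X' where "X' i = (\<lambda>g. X i (proj G g))"

definition Q where "Q z = (\<Sum>i\<in>UNIV. gtensor t t (X' i) (Ts i) z)"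
definition R where "R = row_op (\<lambda>i. gtensor t t (X' i) (\<lambda>x. x))"
definition E where "E = gtensor (tensor_vec t) (tensor_vec t) (\<lambda>x. x) \<Delta>s"
definition F where "F = gtensor t t (\<lambda>x. x) \<Delta>"
definition J where "J = gtensor (tensor_vec t) t (\<lambda>x. x) (row_op T)"

lemmas tm = hilbert_tensorD[OF t]

lemma tv: "hilbert_tensor (tensor_vec t :: 'g \<Rightarrow> 'h ^ 'n \<Rightarrow> 'k ^ 'n)"
  by (rule hilbert_tensor_vec[OF t])

lemmas linear_t = bclinD[OF bclin_tensor(1)[OF tm]] bclinD[OF bclin_tensor(2)[OF tm]]

lemma bounded_X: "bounded_op G G (X i)"
  using X by (simp add: strict_row_contraction_def)

lemma bclin_X': "bclin (X' i)"
  unfolding X'_def by (rule bclin_extend[OF G bounded_X])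

lemma proj_G: "proj G g \<in> G" "g \<in> G \<Longrightarrow> proj G g = g"
  using closed_csubspaceD[OF G] by (auto intro: proj_spec proj_id)

lemma X'_in_G: "X' i g \<in> G"
  using bounded_X[of i] proj_G(1)[of g] by (auto simp: X'_def bounded_op_def)

lemma X'_eq: "g \<in> G \<Longrightarrow> X' i g = X i g"
  by (simp add: X'_def proj_G)

lemma word_X'_eq: "g \<in> G \<Longrightarrow> word_op X' \<alpha> g = word_op X \<alpha> g \<and> word_op X \<alpha> g \<in> G"
  by (induction \<alpha>) (use bounded_X in \<open>auto simp: X'_eq bounded_op_def\<close>)

lemma bclin_ops: "bclin Q" "bclin R" "bclin E" "bclin F" "bclin J"
proof -
  show "bclin Q" unfolding Q_def[abs_def] by (intro bclin_sum gtensor_spec t bclin_X' bclin_Ts)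
  show "bclin R" unfolding R_def by (intro bclin_row_op gtensor_spec t bclin_X' bclin_ident)
  show "bclin E" "bclin F" "bclin J" unfolding E_def F_def J_def
    by (intro gtensor_spec t tv bclin_ident bclin_\<Delta>s bclin_\<Delta> bclin_row)+
qed

lemma Q_tensor: "Q (t g h) = (\<Sum>i\<in>UNIV. t (X' i g) (Ts i h))"
  unfolding Q_def by (simp add: gtensor_spec(2)[OF t t bclin_X' bclin_Ts])

lemma R_tensor: "R (tensor_vec t g x) = (\<Sum>i\<in>UNIV. t (X' i g) (x $ i))"
  unfolding R_def row_op_def tensor_vec_def by (simp add: gtensor_spec(2)[OF t t bclin_X' bclin_ident(1)])

lemma E_tensor: "E (tensor_vec t g x) = tensor_vec t g (\<Delta>s x)"
  unfolding E_def by (rule gtensor_spec(2)[OF tv tv bclin_ident(1) bclin_\<Delta>s])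

lemma F_tensor: "F (t g h) = t g (\<Delta> h)"
  unfolding F_def by (rule gtensor_spec(2)[OF t t bclin_ident(1) bclin_\<Delta>])

text \<open>
  The square of the norm of the row is the norm of \<open>\<Sum> X\<^sub>i X\<^sub>i\<^sup>*\<close>.
\<close>

lemma X'_row_bound:
  obtains r where "0 \<le> r" "r < 1" "\<And>x. norm (row_op X' x) \<le> r * norm x"
proof -
  let ?P = "\<lambda>h. \<Sum>i\<in>UNIV. X i (adj G (X i) h)"
  note a = adj_spec[OF G bounded_X]
  have adjG: "X' i (adj G (X i) h) = X i (adj G (X i) h)" for i h by (simp add: X'_eq a(1))
  have "bclin (\<lambda>h. \<Sum>i\<in>UNIV. X' i (adj G (X i) h))"
    by (intro bclin_sum bclin_compose[OF bclin_X'] bclin_adj[OF G bounded_X])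
  then obtain K where K: "K \<ge> 0" "\<And>h. norm (?P h) \<le> K * norm h"
    using bclin_bound unfolding adjG by blast
  define \<rho> where "\<rho> = op_norm G ?P"
  have \<rho>: "0 \<le> \<rho>" "\<rho> < 1" and le: "\<And>h. h \<in> G \<Longrightarrow> norm (?P h) \<le> \<rho> * norm h"
    using op_norm_bounds[of G ?P K] closed_csubspaceD(4)[OF G] K X by (auto simp: \<rho>_def strict_row_contraction_def)
  have "(\<Sum>i\<in>UNIV. (norm (adj G (X i) h))\<^sup>2) \<le> (sqrt \<rho>)\<^sup>2 * (norm h)\<^sup>2" if "h \<in> G" for h
  proof -
    have "(\<Sum>i\<in>UNIV. (norm (adj G (X i) h))\<^sup>2) = inner (?P h) h"
      by (rule inner_row_defect[OF G bounded_X, symmetric])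
    also have "\<dots> \<le> norm (?P h) * norm h" by (rule norm_cauchy_schwarz)
    also have "\<dots> \<le> (\<rho> * norm h) * norm h" using le[OF that] by (intro mult_right_mono) auto
    finally show ?thesis using \<rho> by (simp add: power2_eq_square mult_ac)
  qed
  note row = norm_row_le[OF G bounded_X real_sqrt_ge_zero[OF \<rho>(1)] this]
  have "norm (row_op X' x) \<le> sqrt \<rho> * norm x" for x :: "'g ^ 'n"
  proof -
    have "norm (row_op X' x) = norm (\<Sum>i\<in>UNIV. X i ((\<chi> i. proj G (x $ i)) $ i))"
      by (simp add: row_op_def X'_def)
    also have "\<dots> \<le> sqrt \<rho> * norm (\<chi> i. proj G (x $ i))"
    proof (rule row)
      show "(\<chi> i. proj G (x $ i)) $ i \<in> G" for i by (simp add: proj_G(1))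
    qed
    also have "norm (\<chi> i. proj G (x $ i)) \<le> norm x"
      unfolding norm_vec_def using closed_csubspaceD[OF G]
      by (intro L2_set_mono) (auto simp: norm_proj_le)
    finally show ?thesis using \<rho> by (simp add: mult_left_mono)
  qed
  moreover have "sqrt \<rho> < 1" "0 \<le> sqrt \<rho>" using \<rho> by auto
  ultimately show ?thesis using that by blast
qed

text \<open>
  \<open>\<Sum> X\<^sub>i \<otimes> T\<^sub>i\<^sup>*\<close> factors as the strictly contractive row of the \<open>X\<^sub>i \<otimes> I\<close> after the contractive
  column of the \<open>I \<otimes> T\<^sub>i\<^sup>*\<close>.
\<close>

lemma norm_Q_R:
  obtains r where "0 \<le> r" "r < 1" "\<And>z. norm (Q z) \<le> r * norm z" "\<And>w. norm (R w) \<le> r * norm w"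
proof -
  obtain r where r: "0 \<le> r" "r < 1" "\<And>x. norm (row_op X' x) \<le> r * norm x" by (rule X'_row_bound) blast
  have row: "bclin (row_op X')" by (intro bclin_row_op bclin_X')
  obtain R' where R': "bclin R'" "\<And>x h. R' (vec_tensor t x h) = t (row_op X' x) h" "\<And>w. norm (R' w) \<le> r * norm w"
    using tensor_left_exists[OF hilbert_tensor_vec_tensor[OF t] tm row r(1,3)] by blast
  have "R' (vec_tensor t x h) = R (vec_tensor t x h)" for x :: "'g ^ 'n" and h
    unfolding R'(2) by (simp add: R_def row_op_def vec_tensor_def linear_t gtensor_spec(2)[OF t t bclin_X' bclin_ident(1)])
  then have "R' = R" by (rule bclin_eq_on_tensors[OF hilbert_tensor_vec_tensor[OF t] R'(1) bclin_ops(2)])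
  then have R: "norm (R w) \<le> r * norm w" for w using R'(3) by simp
  obtain C where C: "bclin C" "\<And>g h. C (t g h) = tensor_vec t g (\<chi> i. Ts i h)" "\<And>z. norm (C z) \<le> 1 * norm z"
    using tensor_right_exists[OF t hilbert_tensorD[OF tv] bclin_column, of 1] norm_column_le by auto
  have "Q = (\<lambda>z. R (C z))"
    by (rule bclin_eq_on_tensors[OF t]) (auto simp: bclin_ops bclin_compose C(1) C(2) R_tensor Q_tensor)
  then have "norm (Q z) \<le> r * norm z" for z
    using order_trans[OF R mult_left_mono[OF C(3) r(1)]] by simp
  with R r that show ?thesis by blast
qed

lemma closed_csubspace_S: "closed_csubspace S"
  by (rule closed_csubspace_tensor_space)

lemma Q_in_S: "Q z \<in> S"
proof -
  have "tensor_space t UNIV UNIV \<subseteq> {z. Q z \<in> S}"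
    using closed_csubspaceD(1)[OF closed_csubspace_S]
    by (intro tensor_space_minimal closed_csubspace_vimage bclin_ops closed_csubspace_S)
       (auto simp: Q_tensor X'_in_G intro!: subspace_sum tensor_in_tensor_space)
  then show ?thesis using t by (auto simp: tensor_space_UNIV)
qed

lemma R_in_S: "R w \<in> S"
proof -
  have "tensor_space (tensor_vec t) UNIV (UNIV :: ('h ^ 'n) set) \<subseteq> {w. R w \<in> S}"
    using closed_csubspaceD(1)[OF closed_csubspace_S]
    by (intro tensor_space_minimal closed_csubspace_vimage bclin_ops closed_csubspace_S)
       (auto simp: R_tensor X'_in_G intro!: subspace_sum tensor_in_tensor_space)
  then show ?thesis using tv by (auto simp: tensor_space_UNIV)
qed

lemma E_in_S:
  assumes "x \<in> tensor_space (tensor_vec t) G D"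
  shows "E x $ i \<in> S"
proof -
  have "E (tensor_vec t g d) $ i = t g (\<Delta>s d $ i)" for g d
    unfolding E_tensor by (simp add: tensor_vec_def)
  then have "tensor_space (tensor_vec t) G D \<subseteq> {x. E x $ i \<in> S}"
    by (intro tensor_space_minimal closed_csubspace_vimage bclin_compose[OF bclin_vec_nth] bclin_ops closed_csubspace_S)
       (simp add: tensor_in_tensor_space)
  then show ?thesis using assms by auto
qed

lemma tensor_op_Q: "z \<in> S \<Longrightarrow> (\<Sum>i\<in>UNIV. tensor_op t t G UNIV (X i) (Ts i) z) = Q z"
  unfolding Q_def
  by (intro sum.cong refl tensor_op_eq_gtensor[OF t t bclin_X' _ bclin_Ts]) (auto simp: X'_eq)

text \<open>
  A solution is a fixed point of the contraction \<open>z \<mapsto> y + Q z\<close> of \<open>S\<close>.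
\<close>

lemma resolvent_exists:
  assumes y: "y \<in> S"
  shows "\<exists>z\<in>S. z - Q z = y"
proof -
  obtain r where r: "0 \<le> r" "r < 1" "\<And>z. norm (Q z) \<le> r * norm z" using norm_Q_R by metis
  have "\<exists>!z\<in>S. y + Q z = z"
  proof (rule Banach_fix[where c=r])
    show "complete S" using closed_csubspace_S by (simp add: closed_csubspace_def complete_eq_closed)
    show "S \<noteq> {}" using y by auto
    show "(\<lambda>z. y + Q z) ` S \<subseteq> S"
      using y Q_in_S closed_csubspaceD(5)[OF closed_csubspace_S] by auto
    show "dist (y + Q u) (y + Q v) \<le> r * dist u v" if "u \<in> S" "v \<in> S" for u v
      using r(3)[of "u - v"] by (simp add: dist_norm bclinD[OF bclin_ops(1)])
  qed (use r in auto)
  then obtain z where "z \<in> S" "y + Q z = z" by blast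
  then show ?thesis by (intro bexI[of _ z]) (simp_all add: diff_eq_eq)
qed

lemma char_fun_eq:
  assumes x: "x \<in> tensor_space (tensor_vec t) G D"
  obtains z where "z - Q z = R (E x)" "char_fun t T G X x = - J x + F z"
proof -
  obtain z where z: "z \<in> S" "z - Q z = R (E x)" using resolvent_exists[OF R_in_S] by blast
  obtain r where r: "0 \<le> r" "r < 1" "\<And>z. norm (Q z) \<le> r * norm z" using norm_Q_R by metis
  have e1: "tensor_op (tensor_vec t) t G D id (row_op T) x = J x"
    unfolding J_def by (rule tensor_op_eq_gtensor[OF tv t bclin_ident(1) _ bclin_row _ x]) auto
  have e2: "tensor_op (tensor_vec t) (tensor_vec t) G D id \<Delta>s x = E x"
    unfolding E_def by (rule tensor_op_eq_gtensor[OF tv tv bclin_ident(1) _ bclin_\<Delta>s _ x]) auto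
  have e3: "row_op (\<lambda>i. tensor_op t t G UNIV (X i) id) (E x) = R (E x)"
    unfolding R_def row_op_def
    by (intro sum.cong refl tensor_op_eq_gtensor[OF t t bclin_X' _ bclin_ident(1) _ E_in_S[OF x]]) (auto simp: X'_eq)
  have e4: "inv_into S (\<lambda>z. z - (\<Sum>i\<in>UNIV. tensor_op t t G UNIV (X i) (Ts i) z)) (R (E x)) = z"
  proof (rule inv_into_f_eq)
    show "inj_on (\<lambda>z. z - (\<Sum>i\<in>UNIV. tensor_op t t G UNIV (X i) (Ts i) z)) S"
    proof (rule inj_onI)
      fix u v assume uv: "u \<in> S" "v \<in> S"
        and "u - (\<Sum>i\<in>UNIV. tensor_op t t G UNIV (X i) (Ts i) u) = v - (\<Sum>i\<in>UNIV. tensor_op t t G UNIV (X i) (Ts i) v)"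
      then have "u - v = Q (u - v)" by (simp add: tensor_op_Q bclinD[OF bclin_ops(1)] algebra_simps)
      then have "norm (u - v) \<le> r * norm (u - v)" using r(3)[of "u - v"] by simp
      then have "(1 - r) * norm (u - v) \<le> 0" by (simp add: algebra_simps)
      then show "u = v" using r(2) by (simp add: mult_le_0_iff)
    qed
  qed (simp_all add: z tensor_op_Q)
  have e5: "tensor_op t t G UNIV id \<Delta> z = F z"
    unfolding F_def by (rule tensor_op_eq_gtensor[OF t t bclin_ident(1) _ bclin_\<Delta> _ z(1)]) auto
  have "char_fun t T G X x = - J x + F z"
    unfolding char_fun_def Let_def e1 e2 e3 e4 e5 ..
  with z show ?thesis using that by blast
qed

lemma Q_power_tensor:
  "(Q ^^ k) (t g h) = (\<Sum>\<beta> | length \<beta> = k. t (word_op X' \<beta> g) (word_op Ts \<beta> h))"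
proof (induction k)
  case 0
  show ?case by simp
next
  case (Suc k)
  have "(Q ^^ Suc k) (t g h) = (\<Sum>\<beta> | length \<beta> = k. Q (t (word_op X' \<beta> g) (word_op Ts \<beta> h)))"
    by (simp add: Suc bclinD[OF bclin_ops(1)])
  also have "\<dots> = (\<Sum>\<beta> | length \<beta> = k. \<Sum>i\<in>UNIV. t (word_op X' (i # \<beta>) g) (word_op Ts (i # \<beta>) h))"
    by (simp add: Q_tensor)
  also have "\<dots> = (\<Sum>i\<in>UNIV. \<Sum>\<beta> | length \<beta> = k. t (word_op X' (i # \<beta>) g) (word_op Ts (i # \<beta>) h))"
    by (rule sum.swap)
  finally show ?case by (simp add: sum_words_Suc)
qed

lemma bclin_Q_power: "bclin (Q ^^ k)"
proof (induction k)
  case (Suc k)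
  then show ?case using bclin_compose[OF bclin_ops(1) Suc] by (simp add: comp_def)
qed (simp add: id_def[symmetric])

text \<open>
  Both sides are operators, and on an elementary tensor the left side is the sum over words \<open>\<beta> j\<close> that
  the right side becomes by expanding \<open>Q\<^sup>k\<close> and the row \<open>R\<close>.
\<close>

lemma homogeneous_part:
  "(\<Sum>\<alpha> | length \<alpha> = Suc k. gtensor (tensor_vec t) t (word_op X' \<alpha>) (char_coeff T \<alpha>) x)
    = F ((Q ^^ k) (R (E x)))"
proof -
  note gs = gtensor_spec[OF tv t bclin_word_op[of X', OF bclin_X'] bclin_char_coeff]
  have "(\<lambda>x. \<Sum>\<alpha> | length \<alpha> = Suc k. gtensor (tensor_vec t) t (word_op X' \<alpha>) (char_coeff T \<alpha>) x)
      = (\<lambda>x. F ((Q ^^ k) (R (E x))))"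
  proof (rule bclin_eq_on_tensors[OF tv])
    show "bclin (\<lambda>x. F ((Q ^^ k) (R (E x))))"
      by (intro bclin_compose[OF bclin_ops(4)] bclin_compose[OF bclin_Q_power] bclin_compose[OF bclin_ops(2)] bclin_ops)
    show "bclin (\<lambda>x. \<Sum>\<alpha> | length \<alpha> = Suc k. gtensor (tensor_vec t) t (word_op X' \<alpha>) (char_coeff T \<alpha>) x)"
      by (intro bclin_sum gs(1))
    fix g and d :: "'h ^ 'n"
    have "F ((Q ^^ k) (R (E (tensor_vec t g d))))
        = (\<Sum>j\<in>UNIV. \<Sum>\<beta> | length \<beta> = k. t (word_op X' \<beta> (X' j g)) (\<Delta> (word_op Ts \<beta> (\<Delta>s d $ j))))"
      by (simp add: E_tensor R_tensor bclinD[OF bclin_Q_power] Q_power_tensor bclinD[OF bclin_ops(4)] F_tensor)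
    then show "(\<Sum>\<alpha> | length \<alpha> = Suc k. gtensor (tensor_vec t) t (word_op X' \<alpha>) (char_coeff T \<alpha>) (tensor_vec t g d))
        = F ((Q ^^ k) (R (E (tensor_vec t g d))))"
      by (simp add: gs(2) sum_words_Suc_snoc char_coeff_def word_op_append)
  qed
  then show ?thesis by meson
qed

lemma constant_part:
  "gtensor (tensor_vec t) t (word_op X' []) (char_coeff T []) x = - J x"
proof -
  note gs = gtensor_spec[OF tv t bclin_word_op[of X', OF bclin_X'] bclin_char_coeff]
  have "gtensor (tensor_vec t) t (word_op X' []) (char_coeff T []) = (\<lambda>x. - J x)"
  proof (rule bclin_eq_on_tensors[OF tv gs(1) bclin_minus[OF bclin_ops(5)]])
    show "gtensor (tensor_vec t) t (word_op X' []) (char_coeff T []) (tensor_vec t g d) = - J (tensor_vec t g d)" for g d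
      by (simp add: gs(2)[of "[]", simplified] char_coeff_def J_def gtensor_spec(2)[OF tv t bclin_ident(1) bclin_row] linear_t)
  qed
  then show ?thesis by meson
qed

lemma partial_sum_eq:
  assumes x: "x \<in> tensor_space (tensor_vec t) G D"
  shows "(\<Sum>k<Suc N. \<Sum>\<alpha> | length \<alpha> = k. tensor_op (tensor_vec t) t G D (word_op X \<alpha>) (char_coeff T \<alpha>) x)
    = - J x + F (\<Sum>k<N. (Q ^^ k) (R (E x)))"
proof -
  have "tensor_op (tensor_vec t) t G D (word_op X \<alpha>) (char_coeff T \<alpha>) x
      = gtensor (tensor_vec t) t (word_op X' \<alpha>) (char_coeff T \<alpha>) x" for \<alpha>
    by (rule tensor_op_eq_gtensor[OF tv t bclin_word_op[of X', OF bclin_X'] _ bclin_char_coeff _ x])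
       (auto simp: word_X'_eq)
  then show ?thesis
    unfolding sum.lessThan_Suc_shift
    by (simp add: homogeneous_part constant_part bclinD[OF bclin_ops(4)] del: word_op_Nil)
qed

text \<open>
  From \<open>z = y + Q z\<close> it follows that \<open>z = y + Q y + \<dots> + Q\<^bsup>N-1\<^esup> y + Q\<^sup>N z\<close>. Summing the degrees up to \<open>N\<close> of
  the expansion accounts for all but the last term, whose norm decays geometrically.
\<close>

lemma char_fun_remainder:
  obtains K r where "0 \<le> K" "0 \<le> r" "r < 1"
    "\<And>x N. x \<in> tensor_space (tensor_vec t) G D \<Longrightarrow>
      norm (char_fun t T G X x - (\<Sum>k<Suc N. \<Sum>\<alpha> | length \<alpha> = k.
        tensor_op (tensor_vec t) t G D (word_op X \<alpha>) (char_coeff T \<alpha>) x)) \<le> K * r ^ N * norm x"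
proof -
  obtain r where r: "0 \<le> r" "r < 1" "\<And>z. norm (Q z) \<le> r * norm z" using norm_Q_R by metis
  obtain K where K: "K \<ge> 0" "\<And>x. norm (F x) \<le> K * norm x" using bclin_bound[OF bclin_ops(4)] by blast
  obtain L where L: "L \<ge> 0" "\<And>x. norm (R (E x)) \<le> L * norm x"
    using bclin_bound[OF bclin_compose[OF bclin_ops(2,3)]] by blast
  have Qp: "norm ((Q ^^ N) z) \<le> r ^ N * norm z" for N z
  proof (induction N)
    case (Suc N)
    have "norm (Q ((Q ^^ N) z)) \<le> r * (r ^ N * norm z)"
      by (rule order_trans[OF r(3) mult_left_mono[OF Suc r(1)]])
    then show ?case by (simp add: mult.assoc)
  qed simp
  have "norm (char_fun t T G X x - (\<Sum>k<Suc N. \<Sum>\<alpha> | length \<alpha> = k.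
        tensor_op (tensor_vec t) t G D (word_op X \<alpha>) (char_coeff T \<alpha>) x)) \<le> (K * (L / (1 - r))) * r ^ N * norm x"
    if x: "x \<in> tensor_space (tensor_vec t) G D" for x N
  proof -
    obtain z where z: "z - Q z = R (E x)" "char_fun t T G X x = - J x + F z" by (rule char_fun_eq[OF x])
    have zN: "z = (\<Sum>k<N. (Q ^^ k) (R (E x))) + (Q ^^ N) z"
    proof (induction N)
      case (Suc N)
      have "(Q ^^ N) z = (Q ^^ N) (R (E x)) + (Q ^^ Suc N) z"
        by (simp add: z(1)[symmetric] bclinD[OF bclin_Q_power] funpow_swap1)
      then have eq: "(\<Sum>k<Suc N. (Q ^^ k) (R (E x))) + (Q ^^ Suc N) z = (\<Sum>k<N. (Q ^^ k) (R (E x))) + (Q ^^ N) z"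
        by (simp add: add.assoc)
      show ?case by (rule Suc.IH[THEN trans, OF eq[symmetric]])
    qed simp
    have "norm z \<le> norm (R (E x)) + norm (Q z)"
      using norm_triangle_ineq[of "z - Q z" "Q z"] unfolding diff_add_cancel unfolding z(1) .
    then have "(1 - r) * norm z \<le> L * norm x" using r(3)[of z] L(2)[of x] by (simp add: algebra_simps)
    then have nz: "norm z \<le> L / (1 - r) * norm x" using r(2) by (simp add: pos_le_divide_eq mult.commute)
    have "F z - F (\<Sum>k<N. (Q ^^ k) (R (E x))) = F ((Q ^^ N) z)"
      unfolding bclinD(3)[OF bclin_ops(4), symmetric] diff_eq_eq[THEN iffD2, OF zN[THEN trans, OF add.commute]] ..
    then have "norm (char_fun t T G X x - (\<Sum>k<Suc N. \<Sum>\<alpha> | length \<alpha> = k.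
        tensor_op (tensor_vec t) t G D (word_op X \<alpha>) (char_coeff T \<alpha>) x)) = norm (F ((Q ^^ N) z))"
      unfolding partial_sum_eq[OF x] z(2) by simp
    also have "\<dots> \<le> K * (r ^ N * (L / (1 - r) * norm x))"
      using r(1) K(1) by (intro order_trans[OF K(2)] mult_left_mono order_trans[OF Qp] nz) auto
    finally show ?thesis by (simp add: mult_ac)
  qed
  moreover have "0 \<le> K * (L / (1 - r))" using K L r by simp
  ultimately show ?thesis using r that by blast
qed

text \<open>
  Needed to draw pointwise conclusions from convergence of an expansion in \<^const>\<open>op_norm\<close>.
\<close>

lemma char_fun_bounded:
  obtains K where "0 \<le> K" "\<And>x. x \<in> tensor_space (tensor_vec t) G D \<Longrightarrow> norm (char_fun t T G X x) \<le> K * norm x"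
proof -
  obtain K r where K: "0 \<le> K" "\<And>x N. x \<in> tensor_space (tensor_vec t) G D \<Longrightarrow>
      norm (char_fun t T G X x - (\<Sum>k<Suc N. \<Sum>\<alpha> | length \<alpha> = k.
        tensor_op (tensor_vec t) t G D (word_op X \<alpha>) (char_coeff T \<alpha>) x)) \<le> K * r ^ N * norm x"
    by (rule char_fun_remainder) blast
  obtain L where L: "L \<ge> 0" "\<And>x. norm (J x) \<le> L * norm x" using bclin_bound[OF bclin_ops(5)] by blast
  have "norm (char_fun t T G X x) \<le> (K + L) * norm x" if x: "x \<in> tensor_space (tensor_vec t) G D" for x
  proof -
    have "norm (char_fun t T G X x + J x) \<le> K * norm x"
      using K(2)[OF x, of 0] unfolding partial_sum_eq[OF x] by (simp add: bclinD[OF bclin_ops(4)])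
    then show ?thesis
      using norm_triangle_ineq4[of "char_fun t T G X x + J x" "J x"] L(2)[of x] by (simp add: distrib_right)
  qed
  then show ?thesis using K L that[of "K + L"] by simp
qed

end

theorem char_fun_expansion_char_coeff:
  fixes T :: "'n::finite \<Rightarrow> 'h::chilbert_space \<Rightarrow> 'h"
    and t :: "'g::chilbert_space \<Rightarrow> 'h \<Rightarrow> 'k::chilbert_space"
  assumes T: "row_contraction UNIV T" and t: "hilbert_tensor t"
  shows "char_fun_expansion t T (char_coeff T)"
  unfolding char_fun_expansion_def
proof (intro conjI allI impI)
  interpret row_contraction_tuple T by unfold_locales (rule T)
  fix \<alpha>
  have "char_coeff T \<alpha> x \<in> defect_space T" if "x \<in> defect_space_star T" for x
  proof (cases "\<alpha> = []")
    case True
    then show ?thesis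
      using row_maps_defect_space[OF that] closed_csubspaceD(1)[OF closed_csubspace_closure_range[OF bclin_\<Delta>]]
      by (simp add: char_coeff_def defect_space_def subspace_neg)
  next
    case False
    then have "char_coeff T \<alpha> x \<in> range \<Delta>" by (simp add: char_coeff_def)
    then show ?thesis unfolding defect_space_def by (rule subsetD[OF closure_subset])
  qed
  then show "bounded_op (defect_space_star T) (defect_space T) (char_coeff T \<alpha>)"
    by (rule bounded_op_cong[OF bclin_char_coeff[of \<alpha>] closed_csubspaceD(3)[OF closed_csubspace_defect_space_star] refl])
next
  fix G and X :: "'n \<Rightarrow> 'g \<Rightarrow> 'g"
  assume "closed_csubspace G \<and> strict_row_contraction G X"
  then interpret char_fun_at T t G X by unfold_locales (auto simp: T t)
  let ?S = "tensor_space (tensor_vec t) G D"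
  let ?f = "\<lambda>N x. char_fun t T G X x - (\<Sum>k<N. \<Sum>\<alpha> | length \<alpha> = k.
        tensor_op (tensor_vec t) t G D (word_op X \<alpha>) (char_coeff T \<alpha>) x)"
  obtain K r where K: "0 \<le> K" "0 \<le> r" "r < 1" "\<And>x N. x \<in> ?S \<Longrightarrow> norm (?f (Suc N) x) \<le> K * r ^ N * norm x"
    by (rule char_fun_remainder) blast
  have S0: "0 \<in> ?S" using closed_csubspaceD(4)[OF closed_csubspace_tensor_space] .
  have b: "0 \<le> op_norm ?S (?f (Suc N)) \<and> op_norm ?S (?f (Suc N)) \<le> K * r ^ N" for N
  proof
    have K0: "0 \<le> K * r ^ N" using K by simp
    show "0 \<le> op_norm ?S (?f (Suc N))" by (rule op_norm_bounds(1)[OF S0 _ K0]) (rule K(4))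
    show "op_norm ?S (?f (Suc N)) \<le> K * r ^ N" by (rule op_norm_bounds(2)[OF S0 _ K0]) (rule K(4))
  qed
  have le: "norm (op_norm ?S (?f (Suc N))) \<le> K * r ^ N" for N
    unfolding real_norm_def abs_of_nonneg[OF conjunct1[OF b]] by (rule conjunct2[OF b])
  have "(\<lambda>N. K * r ^ N) \<longlonglongrightarrow> K * 0"
    using K by (intro tendsto_mult tendsto_const LIMSEQ_power_zero) auto
  then have Kr: "(\<lambda>N. K * r ^ N) \<longlonglongrightarrow> 0" by simp
  have "(\<lambda>N. op_norm ?S (?f (Suc N))) \<longlonglongrightarrow> 0"
    by (rule Lim_null_comparison[OF _ Kr]) (rule always_eventually, rule allI, rule le)
  then show "(\<lambda>N. op_norm ?S (?f N)) \<longlonglongrightarrow> 0" by (rule LIMSEQ_imp_Suc)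
qed

section \<open>Uniqueness of the coefficients\<close>

lemma cmod_cinner_le: "cmod (cinner x y) \<le> norm x * norm (y :: 'a::chilbert_space)"
proof (cases "cinner x y = 0")
  case False
  \<comment> \<open>a phase that makes the complex inner product real and nonnegative\<close>
  define c where "c = cnj (cinner x y) / complex_of_real (cmod (cinner x y))"
  have c: "cmod c = 1" using False by (simp add: c_def norm_divide)
  have "c * cinner x y = complex_of_real (cmod (cinner x y))"
    using False by (simp add: c_def mult.commute[of "cnj _"] complex_norm_square[symmetric] power2_eq_square)
  then have "cmod (cinner x y) = inner (c *\<^sub>C x) y" by (simp add: inner_scaleC_left)
  also have "\<dots> \<le> norm (c *\<^sub>C x) * norm y" by (rule norm_cauchy_schwarz)
  finally show ?thesis by (simp add: norm_scaleC c)
qed simp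

lemma bclin_rank_one: "bclin (\<lambda>x. cinner x a *\<^sub>C b)" for a :: "'a::chilbert_space" and b :: "'b::chilbert_space"
  unfolding bclin_bounded_op bounded_op_def
proof (intro conjI exI[of _ "norm a * norm b"] ballI allI)
  fix x :: 'a
  show "norm (cinner x a *\<^sub>C b) \<le> norm a * norm b * norm x"
    using mult_right_mono[OF cmod_cinner_le[of x a] norm_ge_zero[of b]] by (simp add: norm_scaleC mult_ac)
qed (auto simp: cinner_add_left scaleC_add_left cinner_scaleC_left scaleC_scaleC)

lemma orthonormal_sequence:
  assumes "infinite_dimensional TYPE('g::chilbert_space)"
  obtains e :: "nat \<Rightarrow> 'g::chilbert_space" where "\<And>i j. cinner (e i) (e j) = (if i = j then 1 else 0)"
proof -
  have ext: "\<exists>x. x \<notin> E \<and> orthonormal (insert x E)" if E: "finite E" "orthonormal E" for E :: "'g set"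
  proof -
    obtain x where x: "x \<notin> csubspace hull E"
      using assms E(1) by (auto simp: infinite_dimensional_def)
    have "\<not> expands E x"
    proof
      assume "expands E x"
      then have "x = (\<Sum>b\<in>E. cinner x b *\<^sub>C b)" by (simp add: expands_def)
      moreover have "csubspace (csubspace hull E)" by (rule hull_in) (auto simp: csubspace_def)
      then have "(\<Sum>b\<in>E. cinner x b *\<^sub>C b) \<in> csubspace hull E"
        by (intro subspace_sum csubspace_subspace csubspace_scaleC hull_inc)
      ultimately show False using x by simp
    qed
    then show ?thesis using orthonormal_extend[OF E] by blast
  qed
  define next_vec where "next_vec E = (SOME x. x \<notin> E \<and> orthonormal (insert x E))" for E :: "'g set"
  have nv: "next_vec E \<notin> E" "orthonormal (insert (next_vec E) E)" if "finite E" "orthonormal E" for E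
    using someI_ex[OF ext[OF that]] by (auto simp: next_vec_def)
  define B where "B = rec_nat {} (\<lambda>_ E. insert (next_vec E) E)"
  have B0: "B 0 = {}" and BS: "B (Suc n) = insert (next_vec (B n)) (B n)" for n by (auto simp: B_def)
  have B: "finite (B n) \<and> orthonormal (B n)" for n
  proof (induction n)
    case 0
    show ?case by (simp add: B0 orthonormal_def)
  next
    case (Suc n)
    then show ?case using nv(2)[of "B n"] by (simp add: BS)
  qed
  define e where "e n = next_vec (B n)" for n
  have eB: "e i \<in> B j" if "i < j" for i j
    using that by (induction j) (auto simp: BS e_def less_Suc_eq)
  have ne: "e i \<noteq> e j" if "i < j" for i j
    using eB[OF that] nv(1)[of "B j"] B by (auto simp: e_def)
  have "cinner (e i) (e j) = (if i = j then 1 else 0)" for i j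
  proof -
    have "e i \<in> B (Suc (max i j))" "e j \<in> B (Suc (max i j))" by (auto intro!: eB)
    moreover have "e i = e j \<longleftrightarrow> i = j" using ne[of i j] ne[of j i] by (cases i j rule: linorder_cases) auto
    ultimately show ?thesis using B[of "Suc (max i j)"] by (auto simp: orthonormal_def)
  qed
  then show ?thesis using that by blast
qed

text \<open>
  For a word \<open>\<alpha>\<close> of length \<open>k\<close>, the tuple of weighted partial shifts along \<open>e\<^sub>0, \<dots>, e\<^sub>k\<close> that reads the
  letters of \<open>\<alpha>\<close> from right to left. A word takes \<open>e\<^sub>0\<close> to a multiple of \<open>e\<^sub>k\<close> other than zero only if it is \<open>\<alpha>\<close>.
\<close>

locale word_shift =
  fixes e :: "nat \<Rightarrow> 'g::chilbert_space" and \<alpha> :: "'n::finite list"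
  assumes e: "\<And>i j. cinner (e i) (e j) = (if i = j then 1 else 0)"
begin

abbreviation k where "k \<equiv> length \<alpha>"

text \<open>
  The weight only has to make the tuple strictly contractive, and is small enough to allow bounding the norm
  of \<open>\<Sum> Y\<^sub>i Y\<^sub>i\<^sup>*\<close> by the triangle inequality over its \<open>k\<close> summands of rank one.
\<close>

definition w :: real where "w = 1 / (real k + 1)"

definition positions :: "'n \<Rightarrow> nat set" where "positions i = {j. j < k \<and> rev \<alpha> ! j = i}"

definition Y :: "'n \<Rightarrow> 'g \<Rightarrow> 'g" where
  "Y i g = w *\<^sub>R (\<Sum>j\<in>positions i. cinner g (e j) *\<^sub>C e (Suc j))"

definition Ys :: "'n \<Rightarrow> 'g \<Rightarrow> 'g" where
  "Ys i g = w *\<^sub>R (\<Sum>j\<in>positions i. cinner g (e (Suc j)) *\<^sub>C e j)"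

definition shift_space :: "'g set" where "shift_space = closed_cspan (e ` {..k})"

lemma finite_positions [simp]: "finite (positions i)"
  by (simp add: positions_def)

lemma w: "0 < w" "w\<^sup>2 * real k < 1"
proof -
  show "0 < w" by (simp add: w_def)
  have "real k < (real k + 1)\<^sup>2" by (simp add: power2_eq_square algebra_simps add_strict_increasing)
  then show "w\<^sup>2 * real k < 1" by (simp add: w_def power_divide divide_less_eq)
qed

lemma norm_e: "norm (e j) = 1"
proof -
  have "complex_of_real ((norm (e j))\<^sup>2) = 1" using e[of j j] unfolding cinner_self by simp
  then have "(norm (e j))\<^sup>2 = 1" by (simp only: of_real_eq_1_iff)
  then show ?thesis using norm_ge_zero[of "e j"] by (auto simp: power2_eq_1_iff)
qed

lemma closed_csubspace_shift_space: "closed_csubspace shift_space"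
  unfolding shift_space_def by (rule closed_csubspace_closed_cspan)

lemma e_in_shift_space: "j \<le> k \<Longrightarrow> e j \<in> shift_space"
  unfolding shift_space_def using closed_cspan_superset by fastforce

lemma bclin_Y: "bclin (Y i)"
  unfolding Y_def by (intro bclin_scaleR bclin_sum bclin_rank_one)

lemma Y_in_shift_space: "Y i g \<in> shift_space" "Ys i g \<in> shift_space"
  unfolding Y_def Ys_def using closed_csubspaceD[OF closed_csubspace_shift_space]
  by (auto intro!: subspace_scale subspace_sum csubspace_scaleC e_in_shift_space simp: positions_def)

lemma bounded_Y: "bounded_op shift_space shift_space (Y i)"
  by (rule bounded_op_cong[OF bclin_Y closed_csubspaceD(3)[OF closed_csubspace_shift_space] refl Y_in_shift_space(1)])

lemma adj_Y: "adj shift_space (Y i) g = Ys i g"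
proof (rule adj_eqI[OF closed_csubspaceD(3)[OF closed_csubspace_shift_space] bounded_Y Y_in_shift_space(2)])
  fix x assume "x \<in> shift_space"
  have "inner (cinner x (e j) *\<^sub>C e (Suc j)) g = inner x (cinner g (e (Suc j)) *\<^sub>C e j)" for j
    by (simp add: inner_scaleC_left inner_commute[of x] cinner_commute[of "e (Suc j)" g] cinner_commute[of "e j" x] mult.commute)
  then show "inner (Y i x) g = inner x (Ys i g)"
    by (simp add: Y_def Ys_def inner_sum_left inner_sum_right)
qed

lemma cinner_e_sum:
  "finite I \<Longrightarrow> cinner (\<Sum>j\<in>I. f j *\<^sub>C e j) (e l) = (if l \<in> I then f l else 0)"
proof -
  assume I: "finite I"
  have "cinner (\<Sum>j\<in>I. f j *\<^sub>C e j) (e l) = (\<Sum>j\<in>I. if j = l then f j else 0)"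
    unfolding cinner_sum_left by (intro sum.cong) (auto simp: cinner_scaleC_left e)
  then show ?thesis using I by simp
qed

lemma strict_Y: "strict_row_contraction shift_space Y"
proof -
  have Y_Ys: "Y i (Ys i g) = w\<^sup>2 *\<^sub>R (\<Sum>j\<in>positions i. cinner g (e (Suc j)) *\<^sub>C e (Suc j))" for i g
  proof -
    have "cinner (Ys i g) (e j) = complex_of_real w * cinner g (e (Suc j))" if "j \<in> positions i" for j
      using that by (simp add: Ys_def scaleR_scaleC cinner_scaleC_left cinner_e_sum)
    then have "(\<Sum>j\<in>positions i. cinner (Ys i g) (e j) *\<^sub>C e (Suc j))
        = (\<Sum>j\<in>positions i. w *\<^sub>R (cinner g (e (Suc j)) *\<^sub>C e (Suc j)))"
      by (intro sum.cong) (auto simp: scaleR_scaleC scaleC_scaleC)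
    then show ?thesis
      by (simp add: Y_def power2_eq_square flip: scaleR_sum_right)
  qed
  have "(\<Sum>i\<in>UNIV. Y i (Ys i g)) = w\<^sup>2 *\<^sub>R (\<Sum>j<k. cinner g (e (Suc j)) *\<^sub>C e (Suc j))" for g
  proof -
    have "(\<Sum>j<k. cinner g (e (Suc j)) *\<^sub>C e (Suc j))
        = (\<Sum>i\<in>UNIV. \<Sum>j | j \<in> {..<k} \<and> rev \<alpha> ! j = i. cinner g (e (Suc j)) *\<^sub>C e (Suc j))"
      by (intro sum.group[symmetric]) auto
    then show ?thesis by (simp add: Y_Ys positions_def flip: scaleR_sum_right)
  qed
  note sum_eq = this
  have "norm (\<Sum>i\<in>UNIV. Y i (Ys i g)) \<le> w\<^sup>2 * real k * norm g" for g
  proof -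
    have "norm (cinner g (e (Suc j)) *\<^sub>C e (Suc j)) \<le> norm g" for j
      using cmod_cinner_le[of g "e (Suc j)"] by (simp add: norm_scaleC norm_e)
    then have "norm (\<Sum>j<k. cinner g (e (Suc j)) *\<^sub>C e (Suc j)) \<le> (\<Sum>j<k. norm g)"
      by (intro sum_norm_le)
    then have "w\<^sup>2 * norm (\<Sum>j<k. cinner g (e (Suc j)) *\<^sub>C e (Suc j)) \<le> w\<^sup>2 * (real k * norm g)"
      by (intro mult_left_mono) auto
    then show ?thesis unfolding sum_eq by (simp add: mult.assoc)
  qed
  then have "op_norm shift_space (\<lambda>g. \<Sum>i\<in>UNIV. Y i (Ys i g)) \<le> w\<^sup>2 * real k"
    by (intro op_norm_bounds(2) closed_csubspaceD(4)[OF closed_csubspace_shift_space]) auto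
  then show ?thesis using w(2) by (simp add: strict_row_contraction_def bounded_Y adj_Y)
qed

lemma word_Y:
  "word_op Y \<gamma> (e 0) = (if length \<gamma> \<le> k \<and> rev \<gamma> = take (length \<gamma>) (rev \<alpha>) then w ^ length \<gamma> *\<^sub>R e (length \<gamma>) else 0)"
proof (induction \<gamma>)
  case (Cons i \<gamma>)
  have Ye: "Y i (e l) = (if l < k \<and> rev \<alpha> ! l = i then w *\<^sub>R e (Suc l) else 0)" for l
  proof -
    have "(\<Sum>j\<in>positions i. cinner (e l) (e j) *\<^sub>C e (Suc j)) = (\<Sum>j\<in>positions i. if l = j then e (Suc j) else 0)"
      by (intro sum.cong) (auto simp: e)
    then show ?thesis by (simp add: Y_def positions_def)
  qed
  let ?l = "length \<gamma>"
  have *: "rev (i # \<gamma>) = take (Suc ?l) (rev \<alpha>) \<longleftrightarrow> rev \<gamma> = take ?l (rev \<alpha>) \<and> rev \<alpha> ! ?l = i" if "?l < k"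
    using that by (auto simp: take_Suc_conv_app_nth)
  show ?case
    using Cons * by (auto simp: Ye bclinD[OF bclin_Y] Suc_le_eq simp del: rev.simps)
qed simp

lemma cinner_word_Y: "cinner (word_op Y \<gamma> (e 0)) (e k) = (if \<gamma> = \<alpha> then complex_of_real (w ^ k) else 0)"
proof -
  have "length \<gamma> = k \<and> rev \<gamma> = take (length \<gamma>) (rev \<alpha>) \<longleftrightarrow> \<gamma> = \<alpha>"
    by (auto simp: rev_swap)
  then show ?thesis by (auto simp: word_Y scaleR_scaleC cinner_scaleC_left e)
qed

end

text \<open>
  On the shift tuple of \<open>\<alpha>\<close> all words longer than \<open>\<alpha>\<close> vanish at \<open>e\<^sub>0\<close>, so that the value of the characteristic
  function at \<open>e\<^sub>0 \<otimes> d\<close> is a finite sum in any expansion. Its component along \<open>e\<^sub>k\<close> involves the coefficient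
  of \<open>\<alpha>\<close> alone.
\<close>

lemma expansion_coeff_unique:
  fixes T :: "'n::finite \<Rightarrow> 'h::chilbert_space \<Rightarrow> 'h"
    and t :: "'g::chilbert_space \<Rightarrow> 'h \<Rightarrow> 'k::chilbert_space"
  assumes T: "row_contraction UNIV T" and t: "hilbert_tensor t"
    and inf: "infinite_dimensional TYPE('g)"
    and A: "char_fun_expansion t T A" and B: "char_fun_expansion t T B"
    and d: "d \<in> defect_space_star T"
  shows "A \<alpha> d = B \<alpha> d"
proof -
  obtain e :: "nat \<Rightarrow> 'g" where e: "\<And>i j. cinner (e i) (e j) = (if i = j then 1 else 0)"
    by (rule orthonormal_sequence[OF inf]) blast
  interpret word_shift e \<alpha> by unfold_locales (rule e)
  interpret char_fun_at T t shift_space Y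
    by unfold_locales (auto simp: T t closed_csubspace_shift_space strict_Y)
  define x where "x = tensor_vec t (e 0) d"
  let ?S = "tensor_space (tensor_vec t) shift_space D"
  have x: "x \<in> ?S" unfolding x_def by (intro tensor_in_tensor_space e_in_shift_space d) simp
  have S0: "0 \<in> ?S" by (rule closed_csubspaceD(4)[OF closed_csubspace_tensor_space])
  have key: "(\<lambda>N. \<Sum>l<N. \<Sum>\<gamma> | length \<gamma> = l. t (word_op Y \<gamma> (e 0)) (C \<gamma> d)) \<longlonglongrightarrow> char_fun t T shift_space Y x"
    if C: "char_fun_expansion t T C" for C
  proof -
    let ?p = "\<lambda>\<gamma> x. tensor_op (tensor_vec t) t shift_space D (word_op Y \<gamma>) (C \<gamma>) x"
    define f where "f N x = char_fun t T shift_space Y x - (\<Sum>l<N. \<Sum>\<gamma> | length \<gamma> = l. ?p \<gamma> x)" for N x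
    have bC: "bounded_op D (defect_space T) (C \<gamma>)" for \<gamma> using C by (simp add: char_fun_expansion_def)
    let ?C = "\<lambda>\<gamma> x. C \<gamma> (proj D x)"
    note bCp = bclin_extend[OF closed_csubspace_defect_space_star bC]
    note prD = proj_id[OF closed_csubspaceD(1,2)[OF closed_csubspace_defect_space_star]]
    have p: "?p \<gamma> z = gtensor (tensor_vec t) t (word_op Y \<gamma>) (?C \<gamma>) z" if "z \<in> ?S" for \<gamma> z
      by (rule tensor_op_eq_gtensor[OF tv t bclin_word_op[of Y, OF bclin_Y] refl bCp _ that]) (simp add: prD)
    have px: "?p \<gamma> x = t (word_op Y \<gamma> (e 0)) (C \<gamma> d)" for \<gamma>
      unfolding p[OF x] unfolding x_def gtensor_spec(2)[OF tv t bclin_word_op[of Y, OF bclin_Y] bCp]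
      by (simp add: prD[OF d])
    have "norm (f N x) \<le> op_norm ?S (f N) * norm x" for N
    proof -
      obtain K where K: "0 \<le> K" "\<And>x. x \<in> ?S \<Longrightarrow> norm (char_fun t T shift_space Y x) \<le> K * norm x"
        by (rule char_fun_bounded) blast
      let ?g = "\<lambda>x. \<Sum>l<N. \<Sum>\<gamma> | length \<gamma> = l. gtensor (tensor_vec t) t (word_op Y \<gamma>) (?C \<gamma>) x"
      have "bclin ?g" by (intro bclin_sum gtensor_spec(1)[OF tv t bclin_word_op[of Y, OF bclin_Y] bCp])
      then obtain L where L: "0 \<le> L" "\<And>x. norm (?g x) \<le> L * norm x" using bclin_bound by blast
      have "norm (f N z) \<le> (K + L) * norm z" if "z \<in> ?S" for z
      proof -
        have "norm (char_fun t T shift_space Y z - ?g z) \<le> K * norm z + L * norm z"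
          by (rule order_trans[OF norm_triangle_ineq4 add_mono[OF K(2)[OF that] L(2)]])
        then show ?thesis by (simp add: f_def p[OF that] distrib_right)
      qed
      note bound = this
      have KL: "0 \<le> K + L" using K(1) L(1) by simp
      show ?thesis by (rule op_norm_bounds(3)[OF S0 bound KL x])
    qed
    moreover have "(\<lambda>N. op_norm ?S (f N) * norm x) \<longlonglongrightarrow> 0 * norm x"
      using C closed_csubspace_shift_space strict_Y unfolding char_fun_expansion_def f_def
      by (intro tendsto_mult tendsto_const) blast
    then have "(\<lambda>N. op_norm ?S (f N) * norm x) \<longlonglongrightarrow> 0" by simp
    ultimately have "(\<lambda>N. f N x) \<longlonglongrightarrow> 0"
      by (rule Lim_null_comparison[OF always_eventually[OF allI]])
    then have "(\<lambda>N. char_fun t T shift_space Y x - f N x) \<longlonglongrightarrow> char_fun t T shift_space Y x - 0"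
      by (intro tendsto_diff tendsto_const)
    then show ?thesis by (simp add: f_def px)
  qed
  have coeff: "(\<lambda>N. cinner (\<Sum>l<N. \<Sum>\<gamma> | length \<gamma> = l. t (word_op Y \<gamma> (e 0)) (C \<gamma> d)) (t (e k) v))
      \<longlonglongrightarrow> complex_of_real (w ^ k) * cinner (C \<alpha> d) v" for C v
  proof (rule tendsto_eventually, rule eventually_sequentiallyI)
    fix N assume "Suc k \<le> N"
    have "cinner (\<Sum>l<N. \<Sum>\<gamma> | length \<gamma> = l. t (word_op Y \<gamma> (e 0)) (C \<gamma> d)) (t (e k) v)
        = (\<Sum>l<N. \<Sum>\<gamma> | length \<gamma> = l. if \<gamma> = \<alpha> then complex_of_real (w ^ k) * cinner (C \<alpha> d) v else 0)"
      unfolding cinner_sum_left using tm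
      by (intro sum.cong refl) (simp add: tensor_map_def cinner_word_Y)
    also have "\<dots> = (\<Sum>l<N. if l = k then complex_of_real (w ^ k) * cinner (C \<alpha> d) v else 0)"
      by (intro sum.cong refl) auto
    finally show "cinner (\<Sum>l<N. \<Sum>\<gamma> | length \<gamma> = l. t (word_op Y \<gamma> (e 0)) (C \<gamma> d)) (t (e k) v)
        = complex_of_real (w ^ k) * cinner (C \<alpha> d) v"
      using \<open>Suc k \<le> N\<close> by simp
  qed
  have eq: "complex_of_real (w ^ k) * cinner (C \<alpha> d) v = cinner (char_fun t T shift_space Y x) (t (e k) v)"
    if C: "char_fun_expansion t T C" for C v
  proof (rule LIMSEQ_unique[OF coeff])
    have "(\<lambda>N. cinner (z N) y) \<longlonglongrightarrow> cinner z' y" if "z \<longlonglongrightarrow> z'" for z z' and y :: 'k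
      unfolding cinner_eq_inner
      by (intro tendsto_Complex tendsto_intros bounded_linear.tendsto[OF bounded_linear_scaleC] that)
    then show "(\<lambda>N. cinner (\<Sum>l<N. \<Sum>\<gamma> | length \<gamma> = l. t (word_op Y \<gamma> (e 0)) (C \<gamma> d)) (t (e k) v))
        \<longlonglongrightarrow> cinner (char_fun t T shift_space Y x) (t (e k) v)"
      using key[OF C] by blast
  qed
  have "cinner (A \<alpha> d) (A \<alpha> d - B \<alpha> d) = cinner (B \<alpha> d) (A \<alpha> d - B \<alpha> d)"
  proof -
    have "complex_of_real (w ^ k) * cinner (A \<alpha> d) (A \<alpha> d - B \<alpha> d)
        = complex_of_real (w ^ k) * cinner (B \<alpha> d) (A \<alpha> d - B \<alpha> d)"
      unfolding eq[OF A] eq[OF B] ..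
    then show ?thesis using w(1) by (simp only: mult_cancel_left) simp
  qed
  then have "cinner (A \<alpha> d - B \<alpha> d) (A \<alpha> d - B \<alpha> d) = 0" by (simp add: cinner_diff_left)
  then show ?thesis by (simp add: cinner_self)
qed

section \<open>From a triangular representation to a polynomial\<close>

lemma bounded_op_zero: "bounded_op S R f \<Longrightarrow> 0 \<in> S \<Longrightarrow> f 0 = 0"
  unfolding bounded_op_def by (metis add_cancel_right_right)

text \<open>
  Modulo the invariant subspace \<open>H0\<close> the tuple \<open>T\<close> acts on \<open>H1\<close> as \<open>N\<close>, and hence so do the words in \<open>T\<close>.
\<close>

lemma word_op_compression:
  assumes H0: "subspace H0" "\<And>i x. x \<in> H0 \<Longrightarrow> T i x \<in> H0"
    and lin: "\<And>i. linear (T i)"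
    and N: "\<And>i y. y \<in> H1 \<Longrightarrow> N i y \<in> H1" "\<And>i y. y \<in> H1 \<Longrightarrow> T i y - N i y \<in> H0"
    and y: "y \<in> H1"
  shows "word_op N \<alpha> y \<in> H1 \<and> word_op T \<alpha> y - word_op N \<alpha> y \<in> H0"
proof (induction \<alpha>)
  case Nil
  show ?case using y subspace_0[OF H0(1)] by simp
next
  case (Cons i \<alpha>)
  have "T i (word_op T \<alpha> y - word_op N \<alpha> y) + (T i (word_op N \<alpha> y) - N i (word_op N \<alpha> y)) \<in> H0"
    using Cons by (intro subspace_add H0 N) auto
  then show ?case using Cons N(1) by (simp add: linear_diff[OF lin])
qed

lemma word_op_invariant: "(\<And>i x. x \<in> S \<Longrightarrow> T i x \<in> S) \<Longrightarrow> x \<in> S \<Longrightarrow> word_op T \<alpha> x \<in> S"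
  by (induction \<alpha>) auto

context row_contraction_tuple
begin

lemma linear_T: "linear (T i)"
  by (rule bounded_linear.linear[OF bclinD(1)[OF bclin_T]])

lemma inner_word_Ts: "inner (word_op Ts \<beta> h) x = inner h (word_op T (rev \<beta>) x)"
  by (induction \<beta> arbitrary: x) (simp_all add: word_op_append flip: inner_T')

lemma char_coeff_snoc: "char_coeff T (\<beta> @ [j]) x = \<Delta> (word_op Ts \<beta> (\<Delta>s x $ j))"
  by (simp add: char_coeff_def)

text \<open>
  Since \<open>V\<close> is isometric, the components of the range of \<open>\<Delta>\<^bsub>T*\<^esub>\<close> are orthogonal to \<open>H0\<close>. Words of length \<open>m\<close> in \<open>T\<close>
  map \<open>H0 \<oplus> H1\<close> into \<open>H0\<close>, as \<open>N\<close> is nilpotent; dually, words of length \<open>m\<close> in the adjoints map the orthogonal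
  complement of \<open>H0\<close> into \<open>H2\<close>. Finally \<open>H2\<close> is invariant under the adjoints, and \<open>\<Delta>\<^sub>T\<close> vanishes on it because \<open>W\<close> is a
  coisometry.
\<close>

lemma char_coeff_eq_0_of_representation:
  assumes rep: "has_representation_of_order T m" and len: "m < length \<alpha>"
  shows "char_coeff T \<alpha> x = 0"
proof -
  obtain H0 H1 H2 V N W where H: "closed_csubspace H0" "closed_csubspace H1" "closed_csubspace H2"
    and orth: "orthogonal_sum3 H0 H1 H2" and utr: "upper_triangular_representation T H0 H1 H2 V N W"
    and V: "row_contraction H0 V" "row_isometry H0 V"
    and N: "row_contraction H1 N" "nilpotent_of_order H1 N m"
    and W: "row_contraction H2 W" "row_coisometry H2 W"
    using rep by (auto simp: has_representation_of_order_def)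
  obtain A B C where ABC: "\<And>i. bounded_op H1 H0 (A i)" "\<And>i. bounded_op H2 H0 (B i)" "\<And>i. bounded_op H2 H1 (C i)"
    and T_eq: "\<And>i x y z. x \<in> H0 \<Longrightarrow> y \<in> H1 \<Longrightarrow> z \<in> H2 \<Longrightarrow>
      T i (x + y + z) = (V i x + A i y + B i z) + (N i y + C i z) + W i z"
    using utr unfolding upper_triangular_representation_def by blast
  have bV: "bounded_op H0 H0 (V i)" and bN: "bounded_op H1 H1 (N i)" and bW: "bounded_op H2 H2 (W i)" for i
    using V N W by (auto simp: row_contraction_def)
  note zero = closed_csubspaceD(4)[OF H(1)] closed_csubspaceD(4)[OF H(2)] closed_csubspaceD(4)[OF H(3)]
  note sub = closed_csubspaceD(1)[OF H(1)] closed_csubspaceD(1)[OF H(2)]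
  have o01: "inner x y = 0" if "x \<in> H0" "y \<in> H1" for x y
    using orth that Re_cinner[of x y] by (simp add: orthogonal_sum3_def)
  have o02: "inner x z = 0" if "x \<in> H0" "z \<in> H2" for x z
    using orth that Re_cinner[of x z] by (simp add: orthogonal_sum3_def)
  have o12: "inner y z = 0" if "y \<in> H1" "z \<in> H2" for y z
    using orth that Re_cinner[of y z] by (simp add: orthogonal_sum3_def)
  have decomp: "\<exists>x\<in>H0. \<exists>y\<in>H1. \<exists>z\<in>H2. h = x + y + z" for h
    using orth by (simp add: orthogonal_sum3_def)
  have T0: "T i x = V i x" if "x \<in> H0" for i x
    using T_eq[OF that zero(2,3), of i] bounded_op_zero[OF ABC(1) zero(2), of i] bounded_op_zero[OF ABC(2) zero(3), of i]
      bounded_op_zero[OF ABC(3) zero(3), of i] bounded_op_zero[OF bN zero(2), of i] bounded_op_zero[OF bW zero(3), of i] by simp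
  have T1: "T i y = A i y + N i y" if "y \<in> H1" for i y
    using T_eq[OF zero(1) that zero(3), of i] bounded_op_zero[OF bV zero(1), of i] bounded_op_zero[OF ABC(2) zero(3), of i]
      bounded_op_zero[OF ABC(3) zero(3), of i] bounded_op_zero[OF bW zero(3), of i] by simp
  have inv0: "T i x \<in> H0" if "x \<in> H0" for i x
    using T0[OF that] bV that by (simp add: bounded_op_def)
  have word1: "word_op T \<gamma> y \<in> H0" if "y \<in> H1" "length \<gamma> = m" for \<gamma> y
  proof -
    have "word_op T \<gamma> y - word_op N \<gamma> y \<in> H0"
    proof (rule conjunct2[OF word_op_compression[OF sub(1) inv0 linear_T, where y = y and \<alpha> = \<gamma>]])
      fix i v assume "v \<in> H1"
      then show "N i v \<in> H1" "T i v - N i v \<in> H0"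
        using bN ABC(1) by (auto simp: T1 bounded_op_def)
    qed (use that in auto)
    then show ?thesis using N(2) that by (simp add: nilpotent_of_order_def)
  qed
  \<comment> \<open>The first block column is isometric, so the defect operator of the adjoint vanishes on it.\<close>
  have iso: "\<Delta>s v = 0" if v: "\<And>i. v $ i \<in> H0" for v
  proof -
    have "(norm (row_op T v))\<^sup>2 = (\<Sum>i\<in>UNIV. \<Sum>j\<in>UNIV. inner (V i (v $ i)) (V j (v $ j)))"
      unfolding power2_norm_eq_inner row_op_def inner_sum_left inner_sum_right by (simp add: T0 v) (rule sum.swap)
    also have "\<dots> = (\<Sum>i\<in>UNIV. \<Sum>j\<in>UNIV. inner (v $ i) (if i = j then v $ j else 0))"
      using V(2) v by (intro sum.cong refl) (simp add: adj_spec(2)[OF H(1) bV] row_isometry_def)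
    also have "\<dots> = (\<Sum>i\<in>UNIV. \<Sum>j\<in>UNIV. if j = i then inner (v $ i) (v $ i) else 0)"
      by (intro sum.cong refl) auto
    also have "\<dots> = (norm v)\<^sup>2" by (simp add: norm_vec_squared power2_norm_eq_inner)
    finally show ?thesis using norm_\<Delta>s[of v] by simp
  qed
  have range: "inner x (\<Delta>s v $ j) = 0" if "x \<in> H0" for x v j
  proof -
    have "inner (axis j x) (\<Delta>s v) = inner (\<Delta>s (axis j x)) v" by (simp add: inner_\<Delta>s)
    also have "\<Delta>s (axis j x) = 0"
      using that zero(1) by (intro iso) (simp add: axis_def)
    finally show ?thesis by (simp add: inner_axis')
  qed
  have Ts2: "Ts i z = adj H2 (W i) z" if z: "z \<in> H2" for i z
  proof (rule adj_UNIV_eqI[OF bclin_T])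
    fix h
    obtain x y w where h: "x \<in> H0" "y \<in> H1" "w \<in> H2" "h = x + y + w" using decomp by blast
    note a = adj_spec[OF H(3) bW]
    have "inner (T i h) z = inner (W i w) z"
      unfolding h(4) T_eq[OF h(1-3)] using bV bN ABC h z o02 o12
      by (simp add: inner_add_left bounded_op_def)
    also have "\<dots> = inner h (adj H2 (W i) z)"
      unfolding h(4) using a o02[OF h(1) a(1)] o12[OF h(2) a(1)] h(3) by (simp add: inner_add_left)
    finally show "inner (T i h) z = inner h (adj H2 (W i) z)" .
  qed
  have inv2: "Ts i z \<in> H2" if "z \<in> H2" for i z
    unfolding Ts2[OF that] by (rule adj_spec(1)[OF H(3) bW])
  have null2: "\<Delta> z = 0" if z: "z \<in> H2" for z
  proof -
    have "(\<Sum>i\<in>UNIV. (norm (Ts i z))\<^sup>2) = (norm z)\<^sup>2"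
      unfolding Ts2[OF z] inner_row_defect[OF H(3) bW, symmetric]
      using W(2) z by (simp add: row_coisometry_def power2_norm_eq_inner)
    then show ?thesis using norm_\<Delta>[of z] by simp
  qed
  have last: "word_op Ts \<beta> u \<in> H2" if u: "\<And>x. x \<in> H0 \<Longrightarrow> inner x u = 0" and \<beta>: "length \<beta> = m" for \<beta> u
  proof -
    obtain x y z where d: "x \<in> H0" "y \<in> H1" "z \<in> H2" "word_op Ts \<beta> u = x + y + z" using decomp by blast
    have "inner (word_op Ts \<beta> u) x = 0"
      unfolding inner_word_Ts using u[OF word_op_invariant[OF inv0 d(1)]] by (simp add: inner_commute)
    moreover have "inner (word_op Ts \<beta> u) y = 0"
      unfolding inner_word_Ts using u[OF word1[OF d(2)]] \<beta> by (simp add: inner_commute)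
    moreover have "inner y x = 0" "inner z x = 0" "inner z y = 0"
      using o01[OF d(1,2)] o02[OF d(1,3)] o12[OF d(2,3)] by (metis inner_commute)+
    ultimately have "x = 0" "y = 0"
      using o01[OF d(1,2)] unfolding d(4) by (simp_all add: inner_add_left)
    then show ?thesis using d(3,4) by simp
  qed
  from len have "\<alpha> \<noteq> []" by auto
  then obtain \<beta> j where \<alpha>: "\<alpha> = \<beta> @ [j]" using rev_exhaust by blast
  \<comment> \<open>the last \<open>m\<close> letters of \<open>\<beta>\<close> lead into \<open>H2\<close>, and the others stay there\<close>
  define \<gamma> \<delta> where "\<gamma> = take (length \<beta> - m) \<beta>" and "\<delta> = drop (length \<beta> - m) \<beta>"
  have "\<beta> = \<gamma> @ \<delta>" "length \<delta> = m" using len by (auto simp: \<alpha> \<gamma>_def \<delta>_def)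
  then show ?thesis
    unfolding \<alpha> char_coeff_snoc
    using null2[OF word_op_invariant[OF inv2 last[OF range]]] by (simp add: word_op_append)
qed

end


section \<open>From a polynomial to a triangular representation\<close>

lemma closed_csubspace_Collect_all:
  assumes "\<And>i. P i \<Longrightarrow> closed_csubspace {h. h \<in> S i}"
  shows "closed_csubspace {h. \<forall>i. P i \<longrightarrow> h \<in> S i}"
proof -
  have "closed (\<Inter>i\<in>{i. P i}. S i)" using assms by (intro closed_INT) (auto simp: closed_csubspace_def)
  moreover have "{h. \<forall>i. P i \<longrightarrow> h \<in> S i} = (\<Inter>i\<in>{i. P i}. S i)" by auto
  ultimately show ?thesis using assms by (auto simp: closed_csubspace_def csubspace_def)
qed

lemma sum_words_rev: "(\<Sum>\<alpha> | length \<alpha> = k. f (rev \<alpha>)) = (\<Sum>\<alpha> | length \<alpha> = k. f \<alpha>)"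
  by (rule sum.reindex_bij_witness[of _ rev rev]) auto

context row_contraction_tuple
begin

definition compression :: "'h set \<Rightarrow> 'n \<Rightarrow> 'h \<Rightarrow> 'h" where
  "compression S i h = proj S (T i h)"

lemma bounded_proj_T:
  assumes "closed_csubspace S" "closed_csubspace R"
  shows "bounded_op R S (\<lambda>h. proj S (T i h))"
  by (rule bounded_op_cong[OF bclin_compose[OF bclin_proj[OF assms(1)] bclin_T[of i]] closed_csubspaceD(3)[OF assms(2)] refl])
     (rule proj_spec(1)[OF closed_csubspaceD(1,2)[OF assms(1)]])

lemma bounded_compression: "closed_csubspace S \<Longrightarrow> bounded_op S S (compression S i)"
  using bounded_proj_T[of S S i] by (simp add: compression_def[abs_def])

lemma adj_compression:
  assumes S: "closed_csubspace S" and y: "y \<in> S"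
  shows "adj S (compression S i) y = proj S (Ts i y)"
proof (rule adj_eqI[OF closed_csubspaceD(3)[OF S] bounded_compression[OF S]])
  note P = closed_csubspaceD(1,2)[OF S]
  show "proj S (Ts i y) \<in> S" by (rule proj_spec(1)[OF P])
  fix x assume "x \<in> S"
  then show "inner (compression S i x) y = inner x (proj S (Ts i y))"
    using inner_proj[OF P y, of "T i x"] inner_proj[OF P, of x "Ts i y"]
    by (simp add: compression_def inner_commute[of _ y] inner_T')  (simp add: inner_commute)
qed

lemma row_contraction_compression:
  assumes S: "closed_csubspace S"
  shows "row_contraction S (compression S)"
proof (rule row_contractionI[OF S bounded_compression[OF S]])
  fix h assume h: "h \<in> S"
  have "(\<Sum>i\<in>UNIV. (norm (adj S (compression S i) h))\<^sup>2) \<le> (\<Sum>i\<in>UNIV. (norm (Ts i h))\<^sup>2)"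
    unfolding adj_compression[OF S h]
    by (intro sum_mono power_mono norm_proj_le closed_csubspaceD(1,2)[OF S] norm_ge_zero)
  then show "(\<Sum>i\<in>UNIV. (norm (adj S (compression S i) h))\<^sup>2) \<le> (norm h)\<^sup>2"
    using sum_norm_Ts_le order_trans by blast
qed

lemma orthogonal_comp_invariant:
  assumes "\<And>i s. s \<in> S \<Longrightarrow> Ts i s \<in> S" and x: "x \<in> S\<^sup>\<bottom>"
  shows "T i x \<in> S\<^sup>\<bottom>"
  using assms by (intro orthogonal_compI) (simp add: inner_T' orthogonal_compD)

text \<open>
  The largest subspace that is invariant under the adjoints and on which \<open>\<Delta>\<^sub>T\<close> vanishes. The last summand of a
  triangular representation is always contained in it; taking all of it leaves no room for a coisometric
  part in the isometry on \<open>H0\<close>.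
\<close>

definition coiso_part :: "'h set" where
  "coiso_part = {h. \<forall>\<beta>. \<Delta> (word_op Ts \<beta> h) = 0}"

lemma closed_csubspace_coiso_part: "closed_csubspace coiso_part"
proof -
  have "closed_csubspace {h. h \<in> {h. \<Delta> (word_op Ts \<beta> h) \<in> {0}}}" for \<beta>
    unfolding mem_Collect_eq
    by (rule closed_csubspace_vimage[OF bclin_compose[OF bclin_\<Delta> bclin_word_op[of Ts, OF bclin_Ts]] closed_csubspace_zero])
  then have "closed_csubspace {h. \<forall>\<beta>. True \<longrightarrow> h \<in> {h. \<Delta> (word_op Ts \<beta> h) \<in> {0}}}"
    by (rule closed_csubspace_Collect_all)
  then show ?thesis by (simp add: coiso_part_def)
qed

lemma Ts_coiso_part: "h \<in> coiso_part \<Longrightarrow> Ts i h \<in> coiso_part"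
proof -
  assume h: "h \<in> coiso_part"
  have "\<Delta> (word_op Ts (\<beta> @ [i]) h) = 0" for \<beta> using h unfolding coiso_part_def by blast
  then show ?thesis by (simp add: coiso_part_def word_op_append)
qed

text \<open>
  The sums on the right start at \<open>\<bar>h\<bar>\<^sup>2\<close> for \<open>k = 0\<close> and decrease in each step by the sum of the
  \<open>\<bar>\<Delta>\<^sub>T T\<^sub>\<beta>\<^sup>* h\<bar>\<^sup>2\<close> over words of length \<open>k\<close>.
\<close>

lemma coiso_partI:
  assumes "\<And>k. (norm h)\<^sup>2 \<le> (\<Sum>\<beta> | length \<beta> = k. (norm (word_op Ts \<beta> h))\<^sup>2)"
  shows "h \<in> coiso_part"
proof -
  let ?b = "\<lambda>k. \<Sum>\<beta> | length \<beta> = k. (norm (word_op Ts \<beta> h))\<^sup>2"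
  let ?d = "\<lambda>k. \<Sum>\<beta> | length \<beta> = k. (norm (\<Delta> (word_op Ts \<beta> h)))\<^sup>2"
  have step: "?b (Suc k) = ?b k - ?d k" for k
  proof -
    have "?b (Suc k) = (\<Sum>\<beta> | length \<beta> = k. \<Sum>i\<in>UNIV. (norm (Ts i (word_op Ts \<beta> h)))\<^sup>2)"
      unfolding sum_words_Suc by (subst sum.swap) simp
    then show ?thesis by (simp add: norm_\<Delta> sum_subtractf)
  qed
  have d0: "0 \<le> ?d k" for k by (intro sum_nonneg) auto
  have b_le: "?b k \<le> (norm h)\<^sup>2" for k
  proof (induction k)
    case (Suc k)
    then show ?case using step[of k] d0[of k] by linarith
  qed simp
  have "?d k \<le> 0" for k using assms[of "Suc k"] step[of k] b_le[of k] by linarith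
  then have "?d k = 0" for k using d0[of k] by (intro antisym)
  then have "\<Delta> (word_op Ts \<beta> h) = 0" for \<beta>
    using sum_nonneg_eq_0_iff[of "{\<gamma>. length \<gamma> = length \<beta>}" "\<lambda>\<gamma>. (norm (\<Delta> (word_op Ts \<gamma> h)))\<^sup>2"] by auto
  then show ?thesis by (simp add: coiso_part_def)
qed

text \<open>
  On an invariant subspace on which \<open>T\<close> is isometric, the final projections \<open>\<Sum> V\<^sub>\<alpha> V\<^sub>\<alpha>\<^sup>*\<close> over words
  of length \<open>k\<close> decrease. A vector in the range of their limit is fixed by all of them, and is
  therefore in \<^const>\<open>coiso_part\<close>.
\<close>

lemma isometric_part_pure:
  assumes H: "closed_csubspace H" and inv: "\<And>i x. x \<in> H \<Longrightarrow> T i x \<in> H"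
    and iso: "\<And>i j x. x \<in> H \<Longrightarrow> Ts i (T j x) = (if i = j then x else 0)"
    and disj: "\<And>x. x \<in> H \<Longrightarrow> x \<in> coiso_part \<Longrightarrow> x = 0"
    and h: "h \<in> H"
  shows "(\<lambda>k. \<Sum>\<alpha> | length \<alpha> = k. (norm (proj H (word_op Ts (rev \<alpha>) h)))\<^sup>2) \<longlonglongrightarrow> 0"
proof -
  note P = closed_csubspaceD(1,2)[OF H]
  \<comment> \<open>\<open>U \<alpha>\<close> is the adjoint \<open>V\<^sub>\<alpha>\<^sup>*\<close> of the word \<open>\<alpha>\<close> in the restriction \<open>V\<close> of \<open>T\<close> to \<open>H\<close>, and \<open>E k\<close> is the final projection\<close>
  define U where "U \<alpha> x = proj H (word_op Ts (rev \<alpha>) x)" for \<alpha> x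
  define E where "E k x = (\<Sum>\<alpha> | length \<alpha> = k. word_op T \<alpha> (U \<alpha> x))" for k x
  define a where "a k x = (\<Sum>\<alpha> | length \<alpha> = k. (norm (U \<alpha> x))\<^sup>2)" for k x
  have UH: "U \<alpha> x \<in> H" for \<alpha> x unfolding U_def by (rule proj_spec(1)[OF P])
  have blU: "bclin (U \<alpha>)" for \<alpha>
    unfolding U_def[abs_def] by (rule bclin_compose[OF bclin_proj[OF H] bclin_word_op[of Ts, OF bclin_Ts]])
  have blE: "bclin (E k)" for k
    unfolding E_def[abs_def] by (rule bclin_sum) (rule bclin_compose[OF bclin_word_op[of T, OF bclin_T] blU])
  have TH: "word_op T \<alpha> x \<in> H" if "x \<in> H" for \<alpha> x using that inv by (intro word_op_invariant)
  have EH: "E k x \<in> H" for k x unfolding E_def by (intro subspace_sum P TH UH)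
  have words: "word_op Ts (rev \<alpha>) (word_op T \<beta> v) = (if \<alpha> = \<beta> then v else 0)"
    if "length \<alpha> = length \<beta>" "v \<in> H" for \<alpha> \<beta> v
    using that
  proof (induction \<alpha> \<beta> rule: list_induct2)
    case (Cons i \<alpha> j \<beta>)
    then show ?case
      using iso[OF TH[OF Cons.prems], of i j \<beta>] bclinD(4)[OF bclin_word_op[of Ts, OF bclin_Ts], of "rev \<alpha>"]
      by (auto simp: word_op_append)
  qed simp
  have E_word: "E l (word_op T \<alpha> v) = word_op T \<alpha> v" if "l \<le> length \<alpha>" "v \<in> H" for l \<alpha> v
  proof -
    define \<beta> \<gamma> where "\<beta> = take l \<alpha>" and "\<gamma> = drop l \<alpha>"
    have \<alpha>: "\<alpha> = \<beta> @ \<gamma>" "length \<beta> = l" using that by (auto simp: \<beta>_def \<gamma>_def)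
    let ?v = "word_op T \<gamma> v"
    have "U \<delta> (word_op T \<beta> ?v) = (if \<delta> = \<beta> then ?v else 0)" if "length \<delta> = l" for \<delta>
      using words[of \<delta> \<beta> ?v] that TH[OF \<open>v \<in> H\<close>] \<alpha>(2) bclinD(4)[OF bclin_proj[OF H]] by (simp add: U_def proj_id[OF P])
    then have "E l (word_op T \<beta> ?v) = (\<Sum>\<delta> | length \<delta> = l. if \<delta> = \<beta> then word_op T \<beta> ?v else 0)"
      unfolding E_def by (intro sum.cong refl) (auto simp: bclinD(4)[OF bclin_word_op[of T, OF bclin_T]])
    also have "\<dots> = word_op T \<beta> ?v" using \<alpha>(2) by simp
    finally show ?thesis by (simp add: \<alpha>(1) word_op_append)
  qed
  have EE: "E l (E k x) = E k x" if "l \<le> k" for l k x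
    unfolding E_def[of k] bclinD(8)[OF blE] using that by (intro sum.cong refl E_word UH) auto
  have E_inner: "inner (E k x) y = (\<Sum>\<alpha> | length \<alpha> = k. inner (U \<alpha> x) (U \<alpha> y))" for k x y
    unfolding E_def inner_sum_left
  proof (intro sum.cong refl)
    fix \<alpha> :: "'n list"
    have "inner (word_op T \<alpha> (U \<alpha> x)) y = inner (U \<alpha> x) (word_op Ts (rev \<alpha>) y)"
      using inner_word_Ts[of "rev \<alpha>" y "U \<alpha> x"] by (simp add: inner_commute)
    then show "inner (word_op T \<alpha> (U \<alpha> x)) y = inner (U \<alpha> x) (U \<alpha> y)"
      using inner_proj[OF P UH, of \<alpha> x "word_op Ts (rev \<alpha>) y"] by (simp add: U_def[of \<alpha> y])
  qed
  have E_sym: "inner (E k x) y = inner x (E k y)" for k x y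
    unfolding inner_commute[of x] E_inner by (simp add: inner_commute)
  have a_eq: "a k x = inner (E k x) x" for k x
    by (simp add: E_inner a_def power2_norm_eq_inner)
  have dist2: "(norm (E l h - E k h))\<^sup>2 = a l h - a k h" if "l \<le> k" for l k
  proof -
    have "inner (E l h) (E l h) = a l h" unfolding E_sym a_eq EE[OF order_refl] by (simp add: inner_commute)
    moreover have "inner (E k h) (E k h) = a k h" unfolding E_sym a_eq EE[OF order_refl] by (simp add: inner_commute)
    moreover have "inner (E l h) (E k h) = a k h" unfolding E_sym a_eq EE[OF that] by (simp add: inner_commute)
    ultimately show ?thesis
      by (simp add: power2_norm_eq_inner inner_diff_left inner_diff_right inner_commute[of "E k h" "E l h"])
  qed
  have a_dec: "a k h \<le> a l h" if "l \<le> k" for l k using dist2[OF that] by (metis diff_ge_0_iff_ge zero_le_power2)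
  have a0: "0 \<le> a k h" for k unfolding a_def by (intro sum_nonneg) auto
  have "\<exists>L. (\<lambda>k. a k h) \<longlonglongrightarrow> L"
    using decseq_convergent[of "\<lambda>k. a k h" 0] a_dec a0 by (metis decseq_def)
  then have aC: "Cauchy (\<lambda>k. a k h)" using LIMSEQ_imp_Cauchy by blast
  have "Cauchy (\<lambda>k. E k h)"
  proof (rule metric_CauchyI)
    fix \<epsilon> :: real assume \<epsilon>: "\<epsilon> > 0"
    then obtain M where M: "\<And>m n. m \<ge> M \<Longrightarrow> n \<ge> M \<Longrightarrow> dist (a m h) (a n h) < \<epsilon>\<^sup>2"
      using aC unfolding Cauchy_def by (meson zero_less_power)
    have *: "dist (E l h) (E k h) < \<epsilon>" if "l \<le> k" "M \<le> l" for l k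
    proof -
      have "(dist (E l h) (E k h))\<^sup>2 < \<epsilon>\<^sup>2"
        using dist2[OF that(1)] M[of l k] that by (simp add: dist_norm)
      then show ?thesis using \<epsilon> by (simp add: power_less_imp_less_base)
    qed
    have "dist (E m h) (E n h) < \<epsilon>" if "m \<ge> M" "n \<ge> M" for m n
      using *[of m n] *[of n m] that by (cases "m \<le> n") (auto simp: dist_commute)
    then show "\<exists>M. \<forall>m\<ge>M. \<forall>n\<ge>M. dist (E m h) (E n h) < \<epsilon>" by blast
  qed
  then obtain x where x: "(\<lambda>k. E k h) \<longlonglongrightarrow> x" using Cauchy_convergent convergent_def by blast
  have xH: "x \<in> H" by (rule closed_sequentially[OF P(2) EH x])
  have fixed: "E l x = x" for l
  proof (rule LIMSEQ_unique)
    show "(\<lambda>k. E l (E k h)) \<longlonglongrightarrow> E l x" by (rule bclin_tendsto[OF blE x])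
    have "\<forall>\<^sub>F k in sequentially. E k h = E l (E k h)"
      using EE by (intro eventually_sequentiallyI[of l]) simp
    then show "(\<lambda>k. E l (E k h)) \<longlonglongrightarrow> x" by (rule Lim_transform_eventually[OF x])
  qed
  have "x \<in> coiso_part"
  proof (rule coiso_partI)
    fix k
    have "(norm x)\<^sup>2 = a k x" by (simp add: a_eq fixed power2_norm_eq_inner)
    also have "\<dots> \<le> (\<Sum>\<alpha> | length \<alpha> = k. (norm (word_op Ts (rev \<alpha>) x))\<^sup>2)"
      unfolding a_def U_def by (intro sum_mono power_mono norm_proj_le P norm_ge_zero)
    also have "\<dots> = (\<Sum>\<alpha> | length \<alpha> = k. (norm (word_op Ts \<alpha> x))\<^sup>2)" by (rule sum_words_rev)
    finally show "(norm x)\<^sup>2 \<le> (\<Sum>\<alpha> | length \<alpha> = k. (norm (word_op Ts \<alpha> x))\<^sup>2)" .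
  qed
  then have "x = 0" using disj xH by blast
  then have "(\<lambda>k. inner (E k h) h) \<longlonglongrightarrow> inner 0 h" using x by (intro tendsto_inner tendsto_const) simp
  then show ?thesis by (simp add: a_eq[symmetric] a_def U_def)
qed

text \<open>
  With \<open>H2\<close> as large as possible, let \<open>K\<close> consist of the vectors that all words of length \<open>m\<close> in the adjoints take
  into \<open>H2\<close>, and let \<open>H0\<close> be its orthogonal complement. The hypothesis places the components of
  \<open>\<Delta>\<^bsub>T*\<^esub> \<Delta>\<^bsub>T*\<^esub> x\<close> in \<open>K\<close>, which makes \<open>T\<close> isometric on \<open>H0\<close>. By the choice of \<open>K\<close>, words of length \<open>m\<close> in \<open>T\<close> map
  the orthogonal complement of \<open>H2\<close> into \<open>H0\<close>, which makes the middle compression nilpotent.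
\<close>

lemma representation_of_vanishing_coeffs:
  assumes van: "\<And>\<alpha> x. m < length \<alpha> \<Longrightarrow> x \<in> defect_space_star T \<Longrightarrow> char_coeff T \<alpha> x = 0"
  shows "\<exists>k\<le>m. has_representation_of_order T k"
proof -
  define H2 where "H2 = coiso_part"
  define K where "K = {h. \<forall>\<beta>. length \<beta> = m \<longrightarrow> h \<in> {h. word_op Ts \<beta> h \<in> H2}}"
  define H0 where "H0 = K\<^sup>\<bottom>"
  define H1 where "H1 = K \<inter> H2\<^sup>\<bottom>"
  have cH2: "closed_csubspace H2" unfolding H2_def by (rule closed_csubspace_coiso_part)
  have cK: "closed_csubspace K"
    unfolding K_def
  proof (rule closed_csubspace_Collect_all)
    show "closed_csubspace {h. h \<in> {h. word_op Ts \<beta> h \<in> H2}}" for \<beta>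
      unfolding mem_Collect_eq by (rule closed_csubspace_vimage[OF bclin_word_op[of Ts, OF bclin_Ts] cH2])
  qed
  have cH0: "closed_csubspace H0" unfolding H0_def by (rule closed_csubspace_orthogonal_comp[OF cK])
  have cH1: "closed_csubspace H1"
    unfolding H1_def by (rule closed_csubspace_Int[OF cK closed_csubspace_orthogonal_comp[OF cH2]])
  note P0 = closed_csubspaceD(1,2)[OF cH0] and P1 = closed_csubspaceD(1,2)[OF cH1]
    and P2 = closed_csubspaceD(1,2)[OF cH2] and PK = closed_csubspaceD(1,2)[OF cK]
  have inv2: "Ts i h \<in> H2" if "h \<in> H2" for i h using that Ts_coiso_part by (simp add: H2_def)
  have H2K: "h \<in> K" if "h \<in> H2" for h using word_op_invariant[of H2 Ts, OF inv2 that] by (simp add: K_def)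
  have invK: "Ts i h \<in> K" if h: "h \<in> K" for i h
    unfolding K_def
  proof (intro CollectI allI impI)
    fix \<beta> :: "'n list" assume \<beta>: "length \<beta> = m"
    obtain j \<gamma> where \<gamma>: "\<beta> @ [i] = j # \<gamma>" by (cases "\<beta> @ [i]") auto
    then have "length \<gamma> = m" using \<beta> by (metis length_append_singleton length_Cons nat.inject)
    then have "Ts j (word_op Ts \<gamma> h) \<in> H2" using h by (intro inv2) (simp add: K_def)
    moreover have "word_op Ts \<beta> (Ts i h) = word_op Ts (\<beta> @ [i]) h" by (simp add: word_op_append)
    ultimately show "word_op Ts \<beta> (Ts i h) \<in> H2" unfolding \<gamma> by simp
  qed
  have inv0: "T i x \<in> H0" if "x \<in> H0" for i x
    using that invK unfolding H0_def by (rule orthogonal_comp_invariant[rotated])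
  have inv2c: "T i x \<in> H2\<^sup>\<bottom>" if "x \<in> H2\<^sup>\<bottom>" for i x
    using that inv2 by (rule orthogonal_comp_invariant[rotated])
  have o0K: "inner x y = 0" if "x \<in> H0" "y \<in> K" for x y
    using orthogonal_compD[of x K y] that by (simp add: H0_def inner_commute)
  have o01: "inner x y = 0" if "x \<in> H0" "y \<in> H1" for x y using o0K that by (simp add: H1_def)
  have o02: "inner x z = 0" if "x \<in> H0" "z \<in> H2" for x z using o0K H2K that by simp
  have o12: "inner y z = 0" if "y \<in> H1" "z \<in> H2" for y z
    using orthogonal_compD[of y H2 z] that by (simp add: H1_def inner_commute)
  have decomp: "\<exists>x\<in>H0. \<exists>y\<in>H1. \<exists>z\<in>H2. h = x + y + z" for h
  proof (intro bexI)
    show "h = (h - proj K h) + (proj K h - proj H2 (proj K h)) + proj H2 (proj K h)" by simp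
    show "h - proj K h \<in> H0" unfolding H0_def by (rule proj_orthogonal_comp[OF PK])
    show "proj H2 (proj K h) \<in> H2" by (rule proj_spec(1)[OF P2])
    then show "proj K h - proj H2 (proj K h) \<in> H1"
      unfolding H1_def using proj_orthogonal_comp[OF P2] proj_spec(1)[OF PK] H2K subspace_diff[OF PK(1)] by blast
  qed
  have split: "h = proj H0 h + proj H1 h + proj H2 h" for h
  proof -
    obtain x y z where d: "x \<in> H0" "y \<in> H1" "z \<in> H2" "h = x + y + z" using decomp by blast
    have "proj H0 h = x" by (rule proj_eqI[OF P0 d(1)]) (use d o01 o02 in \<open>simp add: inner_add_right\<close>)
    moreover have "proj H1 h = y"
      by (rule proj_eqI[OF P1 d(2)]) (use d o01[OF d(1)] o12 in \<open>simp add: inner_add_right inner_commute[of _ x]\<close>)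
    moreover have "proj H2 h = z"
      by (rule proj_eqI[OF P2 d(3)])
         (use d o02[OF d(1)] o12[OF d(2)] in \<open>simp add: inner_add_right inner_commute[of _ x] inner_commute[of _ y]\<close>)
    ultimately show ?thesis using d(4) by simp
  qed
  have p2: "proj H2 h = 0" if "h \<in> H2\<^sup>\<bottom>" for h
    using that closed_csubspaceD(4)[OF cH2] by (intro proj_eqI[OF P2]) (auto simp: orthogonal_compD)
  have H0c: "x \<in> H2\<^sup>\<bottom>" if "x \<in> H0" for x
    using o02[OF that] by (intro orthogonal_compI) (simp add: inner_commute)
  have T0: "compression H0 i x = T i x" if "x \<in> H0" for i x
    unfolding compression_def by (rule proj_id[OF P0 inv0[OF that]])
  have T1: "T i y = proj H0 (T i y) + compression H1 i y" if "y \<in> H1" for i y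
    using split[of "T i y"] p2[OF inv2c[of y i]] that by (simp add: H1_def compression_def)
  have T2: "T i z = proj H0 (T i z) + proj H1 (T i z) + compression H2 i z" for i z
    using split[of "T i z"] by (simp add: compression_def)
  \<comment> \<open>The coefficients of large degree vanish, which says that the defect operator of the adjoint maps the defect space into \<open>K\<close> componentwise.\<close>
  have defect_K: "\<Delta>s v $ j \<in> K" if "v \<in> defect_space_star T" for v j
    unfolding K_def H2_def coiso_part_def
  proof (intro CollectI allI impI)
    fix \<beta> \<gamma> :: "'n list" assume "length \<beta> = m"
    then have "char_coeff T ((\<gamma> @ \<beta>) @ [j]) v = 0" using that by (intro van) auto
    then show "\<Delta> (word_op Ts \<gamma> (word_op Ts \<beta> (\<Delta>s v $ j))) = 0"
      unfolding char_coeff_snoc by (simp add: word_op_append)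
  qed
  have iso: "Ts i (T j x) = (if i = j then x else 0)" if x: "x \<in> H0" for i j x
  proof -
    let ?v = "axis j x :: 'h ^ 'n"
    have "\<Delta>s ?v \<in> defect_space_star T" unfolding defect_space_star_def by (rule subsetD[OF closure_subset rangeI])
    then have "inner x (\<Delta>s (\<Delta>s ?v) $ j) = 0" using defect_K o0K x by blast
    then have "inner (\<Delta>s ?v) (\<Delta>s ?v) = 0" by (simp add: inner_\<Delta>s inner_axis')
    then have "\<Delta>s (\<Delta>s ?v) = 0" by (simp add: bclinD(4)[OF bclin_\<Delta>s])
    then have "?v $ i = Ts i (row_op T ?v)" unfolding \<Delta>s_\<Delta>s by (simp add: vec_eq_iff)
    moreover have "row_op T ?v = (\<Sum>l\<in>UNIV. if l = j then T j x else 0)"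
      unfolding row_op_def by (intro sum.cong refl) (auto simp: axis_def bclinD(4)[OF bclin_T])
    ultimately show ?thesis by (auto simp: axis_def)
  qed
  have pure: "row_pure H0 (compression H0)"
    unfolding row_pure_def
  proof
    fix h assume h: "h \<in> H0"
    have word: "word_op (compression H0) \<alpha> x = word_op T \<alpha> x \<and> word_op T \<alpha> x \<in> H0" if "x \<in> H0" for \<alpha> x
      using that by (induction \<alpha>) (auto simp: T0 inv0)
    have "adj H0 (word_op (compression H0) \<alpha>) h = proj H0 (word_op Ts (rev \<alpha>) h)" for \<alpha>
    proof (rule adj_eqI[OF closed_csubspaceD(3)[OF cH0]])
      show "bounded_op H0 H0 (word_op (compression H0) \<alpha>)"
        using bounded_op_cong[OF bclin_word_op[of T, OF bclin_T] closed_csubspaceD(3)[OF cH0],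
            of \<alpha> "word_op (compression H0) \<alpha>" H0] word by simp
      show "proj H0 (word_op Ts (rev \<alpha>) h) \<in> H0" by (rule proj_spec(1)[OF P0])
      fix x assume x: "x \<in> H0"
      then show "inner (word_op (compression H0) \<alpha> x) h = inner x (proj H0 (word_op Ts (rev \<alpha>) h))"
        using word[OF x] inner_proj[OF P0 x] inner_word_Ts[of "rev \<alpha>" h x] by (simp add: inner_commute)
    qed
    moreover have "x = 0" if "x \<in> H0" "x \<in> coiso_part" for x
      using o02[of x x] that by (simp add: H2_def)
    ultimately show "(\<lambda>k. \<Sum>\<alpha> | length \<alpha> = k. (norm (adj H0 (word_op (compression H0) \<alpha>) h))\<^sup>2) \<longlonglongrightarrow> 0"
      using isometric_part_pure[OF cH0 inv0 iso _ h] by simp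
  qed
  have isometry: "row_isometry H0 (compression H0)"
    unfolding row_isometry_def
  proof (intro allI ballI)
    fix i j h assume h: "h \<in> H0"
    show "adj H0 (compression H0 i) (compression H0 j h) = (if i = j then h else 0)"
      unfolding T0[OF h] adj_compression[OF cH0 inv0[OF h]] iso[OF h]
      using proj_id[OF P0 h] bclinD(4)[OF bclin_proj[OF cH0]] by simp
  qed
  have coisometry: "row_coisometry H2 (compression H2)"
    unfolding row_coisometry_def
  proof
    fix h assume h: "h \<in> H2"
    have "\<Delta> (word_op Ts [] h) = 0" using h unfolding H2_def coiso_part_def by blast
    then have "(\<Sum>i\<in>UNIV. T i (Ts i h)) = h" using \<Delta>_\<Delta>[of h] by (simp add: bclinD(4)[OF bclin_\<Delta>])
    then show "(\<Sum>i\<in>UNIV. compression H2 i (adj H2 (compression H2 i) h)) = h"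
      unfolding adj_compression[OF cH2 h] proj_id[OF P2 inv2[OF h]] compression_def bclinD(8)[OF bclin_proj[OF cH2], symmetric]
      by (simp add: proj_id[OF P2 h])
  qed
  have nil: "word_op (compression H1) \<alpha> h = 0" if \<alpha>: "length \<alpha> = m" and h: "h \<in> H1" for \<alpha> h
  proof -
    have c: "word_op (compression H1) \<alpha> h \<in> H1 \<and> word_op T \<alpha> h - word_op (compression H1) \<alpha> h \<in> H0"
    proof (rule word_op_compression[OF P0(1) inv0 linear_T])
      fix i y assume y: "y \<in> H1"
      show "compression H1 i y \<in> H1" unfolding compression_def by (rule proj_spec(1)[OF P1])
      have "T i y - compression H1 i y = proj H0 (T i y)" using T1[OF y, of i] by (simp add: diff_eq_eq)
      then show "T i y - compression H1 i y \<in> H0" using proj_spec(1)[OF P0] by simp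
    qed (use h in auto)
    have "word_op T \<alpha> h \<in> H0"
      unfolding H0_def
    proof (rule orthogonal_compI)
      fix s assume "s \<in> K"
      then have "word_op Ts (rev \<alpha>) s \<in> H2" using \<alpha> by (simp add: K_def)
      then have "inner (word_op Ts (rev \<alpha>) s) h = 0" using o12[OF h] by (simp add: inner_commute[of _ h])
      then show "inner s (word_op T \<alpha> h) = 0" by (simp add: inner_word_Ts)
    qed
    then have "word_op T \<alpha> h - (word_op T \<alpha> h - word_op (compression H1) \<alpha> h) \<in> H0"
      by (rule subspace_diff[OF P0(1) _ conjunct2[OF c]])
    then show ?thesis using o01[of "word_op (compression H1) \<alpha> h" "word_op (compression H1) \<alpha> h"] c by simp
  qed
  let ?nil = "\<lambda>k. \<forall>\<alpha>. length \<alpha> = k \<longrightarrow> (\<forall>h\<in>H1. word_op (compression H1) \<alpha> h = 0)"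
  define k where "k = (LEAST k. ?nil k)"
  have "?nil m" using nil by blast
  then have k: "k \<le> m" "?nil k" "\<And>l. l < k \<Longrightarrow> \<not> ?nil l"
    unfolding k_def by (auto intro: Least_le dest: not_less_Least LeastI[of ?nil])
  have nilpotent: "nilpotent_of_order H1 (compression H1) k"
    using k unfolding nilpotent_of_order_def by blast
  have osum: "orthogonal_sum3 H0 H1 H2"
    unfolding orthogonal_sum3_def
  proof (intro conjI ballI allI)
    show "cinner x y = 0" if "x \<in> H0" "y \<in> H1" for x y
      using cinner_eq_0_of_inner[OF closed_csubspaceD(3)[OF cH0], of y x] o01 that by blast
    show "cinner x y = 0" if "x \<in> H0" "y \<in> H2" for x y
      using cinner_eq_0_of_inner[OF closed_csubspaceD(3)[OF cH0], of y x] o02 that by blast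
    show "cinner x y = 0" if "x \<in> H1" "y \<in> H2" for x y
      using cinner_eq_0_of_inner[OF closed_csubspaceD(3)[OF cH1], of y x] o12 that by blast
  qed (rule decomp)
  have utr: "upper_triangular_representation T H0 H1 H2 (compression H0) (compression H1) (compression H2)"
    unfolding upper_triangular_representation_def
  proof (rule exI[of _ "\<lambda>i y. proj H0 (T i y)"], rule exI[of _ "\<lambda>i z. proj H0 (T i z)"],
      rule exI[of _ "\<lambda>i z. proj H1 (T i z)"], intro allI conjI ballI)
    fix i x y z assume "x \<in> H0" "y \<in> H1" "z \<in> H2"
    then have "T i (x + y + z) = compression H0 i x + (proj H0 (T i y) + compression H1 i y)
        + (proj H0 (T i z) + proj H1 (T i z) + compression H2 i z)"
      using T1[of y i] T2[of i z] by (simp add: bclinD(2)[OF bclin_T] T0)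
    then show "T i (x + y + z) = (compression H0 i x + proj H0 (T i y) + proj H0 (T i z))
        + (compression H1 i y + proj H1 (T i z)) + compression H2 i z"
      by (simp add: add_ac)
  qed (rule bounded_proj_T cH0 cH1 cH2)+
  have "has_representation_of_order T k"
    unfolding has_representation_of_order_def
    using cH0 cH1 cH2 osum utr row_contraction_compression[OF cH0] isometry pure
      row_contraction_compression[OF cH1] nilpotent row_contraction_compression[OF cH2] coisometry
    by blast
  with k(1) show ?thesis by blast
qed

end


section \<open>The degree as the smallest order\<close>

lemma char_fun_polynomial_of_degree_iff:
  fixes T :: "'n::finite \<Rightarrow> 'h::chilbert_space \<Rightarrow> 'h"
    and t :: "'g::chilbert_space \<Rightarrow> 'h \<Rightarrow> 'k::chilbert_space"
  assumes T: "row_contraction UNIV T" and t: "hilbert_tensor t"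
    and inf: "infinite_dimensional TYPE('g)"
  shows "char_fun_polynomial_of_degree t T m \<longleftrightarrow>
    finite (coeff_support T (char_coeff T)) \<and> m = Max (insert 0 (length ` coeff_support T (char_coeff T)))"
proof -
  note ex = char_fun_expansion_char_coeff[OF T t]
  have "coeff_support T A = coeff_support T (char_coeff T)" if "char_fun_expansion t T A" for A
    using expansion_coeff_unique[OF T t inf that ex] by (auto simp: coeff_support_def)
  then show ?thesis using ex unfolding char_fun_polynomial_of_degree_def by metis
qed

theorem theorem1p3:
  fixes T :: "'n::finite \<Rightarrow> 'h::chilbert_space \<Rightarrow> 'h"
    and t :: "'g::chilbert_space \<Rightarrow> 'h \<Rightarrow> 'k::chilbert_space"
  assumes "row_contraction UNIV T"
    and "hilbert_tensor t"
    and "infinite_dimensional TYPE('g)"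
  shows "((\<exists>m. char_fun_polynomial_of_degree t T m) \<longleftrightarrow>
            (\<exists>m. has_representation_of_order T m)) \<and>
         (\<forall>m. char_fun_polynomial_of_degree t T m \<longrightarrow>
            has_representation_of_order T m \<and>
            (\<forall>k. has_representation_of_order T k \<longrightarrow> m \<le> k))"
proof -
  interpret row_contraction_tuple T by unfold_locales (rule assms)
  let ?supp = "coeff_support T (char_coeff T)"
  note poly = char_fun_polynomial_of_degree_iff[OF assms]
  have supp_le: "?supp \<subseteq> {\<alpha>. length \<alpha> \<le> k}" if "has_representation_of_order T k" for k
    using char_coeff_eq_0_of_representation[OF that] by (force simp: coeff_support_def not_less[symmetric])
  have words: "finite {\<alpha> :: 'n list. length \<alpha> \<le> k}" for k
    using finite_lists_length_le[of "UNIV :: 'n set" k] by simp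
  have deg: "has_representation_of_order T m \<and> (\<forall>k. has_representation_of_order T k \<longrightarrow> m \<le> k)"
    if "char_fun_polynomial_of_degree t T m" for m
  proof -
    have fin: "finite ?supp" and m: "m = Max (insert 0 (length ` ?supp))" using that poly by auto
    have min: "m \<le> k" if "has_representation_of_order T k" for k
      unfolding m using fin supp_le[OF that] by auto
    have "char_coeff T \<alpha> x = 0" if "m < length \<alpha>" "x \<in> defect_space_star T" for \<alpha> x
    proof (rule ccontr)
      assume "char_coeff T \<alpha> x \<noteq> 0"
      then have "\<alpha> \<in> ?supp" using that by (auto simp: coeff_support_def)
      then have "length \<alpha> \<le> m" unfolding m using fin by (intro Max_ge) auto
      then show False using that by simp
    qed
    then obtain k where "k \<le> m" "has_representation_of_order T k"
      using representation_of_vanishing_coeffs by blast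
    with min show ?thesis by (metis le_antisym)
  qed
  moreover have "\<exists>m. char_fun_polynomial_of_degree t T m" if "has_representation_of_order T k" for k
    using poly finite_subset[OF supp_le[OF that] words] by blast
  ultimately show ?thesis by blast
qed

end
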